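(* Let $\mathcal{C}$ be a small category. (i) There exists a strict $2$-category $\mathscr{P}_{\mathcal{C}}$ (the $2$-path-category of $\mathcal{C}$, whose construction is recalled in the context) having the following properties: - the objects of $\mathscr{P}_{\mathcal{C}}$ are the objects of $\mathcal{C}$; - for every pair $(A,B)$ of objects, $\mathscr{P}_{\mathcal{C}}(A,B)$ is posetal and is a category over $\Delta$, i.e. there is a functor, called length, $\mathscr{L}_{AB}:\mathscr{P}_{\mathcal{C}}(A,B)\to\Delta$; - $0$ is in the image of $\mathscr{L}_{AB}$ if and only if $A=B$; and $\mathscr{L}_{AA}$ becomes a monoidal functor with the composition (that is, when $\mathscr{P}_{\mathcal{C}}(A,A)$ carries the monoidal structure given by the composition of $\mathscr{P}_{\mathcal{C}}$). (ii) If $\mathcal{C}\cong\mathbf{1}$, say $\mathrm{Ob}(\mathcal{C})=\{\mathbf{O}\}$ and $\mathcal{C}(\mathbf{O},\mathbf{O})=\{\mathrm{Id}_{\mathbf{O}}\}$, there is a monoidal isomorphism $\mathscr{P}_{\mathcal{C}}(\mathbf{O},\mathbf{O})\xrightarrow{\sim}\Delta$. (iii) The operation $\mathcal{C}\mapsto\mathscr{P}_{\mathcal{C}}$ is functorial in $\mathcal{C}$: there is a functor $\mathscr{P}_{[-]}:\mathrm{Cat}_{\le 1}\to\mathrm{Bicat}$ sending $F:\mathcal{C}\to\mathcal{D}$ to $\mathscr{P}_F:\mathscr{P}_{\mathcal{C}}\to\mathscr{P}_{\mathcal{D}}$, where $\mathrm{Cat}_{\le 1}$ and $\mathrm{Bicat}$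 are respectively the $1$-category of small categories and the category of bicategories.
   Context: $\Delta$ is the category of all finite ordinals $n=\{0,\dots,n-1\}$, $n\ge 0$ (including $0=\varnothing$), and nondecreasing maps; it is monoidal under ordinal addition $+$ with unit $0$. A category is posetal if there is at most one morphism from any object to any other. $\mathbf{1}$ is the category with one object and only its identity morphism. Construction of $\mathscr{P}_{\mathcal{C}}$. For objects $A,B$ of $\mathcal{C}$ and $n\ge1$, let $P_{AB}(n)$ be the set of chains $s=(A=A_0\to A_1\to\cdots\to A_n=B)$ of $n$ composable arrows of $\mathcal{C}$; if $A=B$, let $P_{AA}(0)$ have a unique element, identified with $A$; if $A\ne B$ there is no chain of length $0$. A nondecreasing map $u:n\to m$ (with $n,m\ge 1$ if $A\neq B$) induces $P_{AB}(u):P_{AB}(n)\to P_{AB}(m)$: the $j$-th arrow ($0\le j<m$) of $P_{AB}(u)s$ is the composite, in order, of the arrows of $s$ whose index $i$ satisfies $u(i)=j$, and is the identity of the appropriate vertex if there is no such $i$. Thus maps of $\Delta$ act by composing consecutive arrows and inserting identities. The category $\mathscr{P}_{\mathcal{C}}(A,B)$ has as objects the pairs $[n,s]$ with $s\in P_{AB}(n)$; a morphism $[n,s]\to[m,t]$ is a map $u:n\to m$ of $\Delta$ with $P_{AB}(u)s=t$. The length functor is $\mathscr{L}_{AB}([n,s])=n$, $\mathscr{L}_{AB}(u)=u$. The $2$-path-category $\mathscr{P}_{\mathcal{C}}$ has the objects of $\mathcal{C}$ as objects and the $\mathscr{P}_{\mathcal{C}}(A,B)$ as categories of arrows. The composition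 functor $\mathscr{P}_{\mathcal{C}}(B,C)\times\mathscr{P}_{\mathcal{C}}(A,B)\to\mathscr{P}_{\mathcal{C}}(A,C)$ is concatenation: for $[n,s]$ from $A$ to $B$ and $[m,t]$ from $B$ to $C$, $t\otimes s=[n+m,s\ast t]$, where $s\ast t$ is $s$ followed by $t$; on $2$-cells, $u'\otimes u=u+u'$ (ordinal sum). The identity $1$-cell of $A$ is $[0,A]$, and the associativity and unit isomorphisms are identities. For a functor $F:\mathcal{C}\to\mathcal{D}$, $\mathscr{P}_F$ is the strict homomorphism obtained by applying $F$ to objects and to chains.
   Formalization: "P_C(A,B) is posetal" is false (both maps 1→2 send [1,(id)] to [2,(id,id)]); it is replaced by: at most one morphism between two objects over each given map of Δ. The tensor on P_C(A,A) is composition in diagrammatic order, as needed for length to be monoidal. *)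

theory Defs
  imports "HOL-Library.FuncSet"
begin

section \<open>Categories and functors\<close>

text \<open>
  Small categories are records whose object and arrow sets are subsets of HOL types; values of the
  operations outside these sets are irrelevant. \<open>g \<cdot>\<^bsub>C\<^esub> f\<close> is ``g after f''.
\<close>

record ('o, 'a) cat =
  Ob :: "'o set"
  Ar :: "'a set"
  Dom :: "'a \<Rightarrow> 'o"
  Cod :: "'a \<Rightarrow> 'o"
  Ide :: "'o \<Rightarrow> 'a"
  Cmp :: "'a \<Rightarrow> 'a \<Rightarrow> 'a"  (infixr "\<cdot>\<index>" 70)

definition Hom :: "('o, 'a) cat \<Rightarrow> 'o \<Rightarrow> 'o \<Rightarrow> 'a set" where
  "Hom C A B = {f \<in> Ar C. Dom C f = A \<and> Cod C f = B}"

definition category :: "('o, 'a) cat \<Rightarrow> bool" where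
  "category C \<longleftrightarrow>
     (\<forall>f\<in>Ar C. Dom C f \<in> Ob C \<and> Cod C f \<in> Ob C) \<and>
     (\<forall>A\<in>Ob C. Ide C A \<in> Hom C A A) \<and>
     (\<forall>f\<in>Ar C. \<forall>g\<in>Ar C. Cod C f = Dom C g \<longrightarrow> g \<cdot>\<^bsub>C\<^esub> f \<in> Hom C (Dom C f) (Cod C g)) \<and>
     (\<forall>f\<in>Ar C. f \<cdot>\<^bsub>C\<^esub> Ide C (Dom C f) = f \<and> Ide C (Cod C f) \<cdot>\<^bsub>C\<^esub> f = f) \<and>
     (\<forall>f\<in>Ar C. \<forall>g\<in>Ar C. \<forall>h\<in>Ar C. Cod C f = Dom C g \<longrightarrow> Cod C g = Dom C h \<longrightarrow>
        (h \<cdot>\<^bsub>C\<^esub> g) \<cdot>\<^bsub>C\<^esub> f = h \<cdot>\<^bsub>C\<^esub> (g \<cdot>\<^bsub>C\<^esub> f))"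

definition is_inverse :: "('o, 'a) cat \<Rightarrow> 'a \<Rightarrow> 'a \<Rightarrow> bool" where
  "is_inverse C f g \<longleftrightarrow> g \<in> Hom C (Cod C f) (Dom C f) \<and>
     g \<cdot>\<^bsub>C\<^esub> f = Ide C (Dom C f) \<and> f \<cdot>\<^bsub>C\<^esub> g = Ide C (Cod C f)"

definition iso_hom :: "('o, 'a) cat \<Rightarrow> 'o \<Rightarrow> 'o \<Rightarrow> 'a set" where
  "iso_hom C A B = {f \<in> Hom C A B. \<exists>g. is_inverse C f g}"

definition inv_ar :: "('o, 'a) cat \<Rightarrow> 'a \<Rightarrow> 'a" where
  "inv_ar C f = (THE g. is_inverse C f g)"

record ('o, 'a, 'p, 'b) func =
  FO :: "'o \<Rightarrow> 'p"
  FA :: "'a \<Rightarrow> 'b"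

definition is_functor :: "('o, 'a) cat \<Rightarrow> ('p, 'b) cat \<Rightarrow> ('o, 'a, 'p, 'b) func \<Rightarrow> bool" where
  "is_functor C D F \<longleftrightarrow> category C \<and> category D \<and>
     (\<forall>A\<in>Ob C. FO F A \<in> Ob D) \<and>
     (\<forall>f\<in>Ar C. FA F f \<in> Hom D (FO F (Dom C f)) (FO F (Cod C f))) \<and>
     (\<forall>A\<in>Ob C. FA F (Ide C A) = Ide D (FO F A)) \<and>
     (\<forall>f\<in>Ar C. \<forall>g\<in>Ar C. Cod C f = Dom C g \<longrightarrow> FA F (g \<cdot>\<^bsub>C\<^esub> f) = FA F g \<cdot>\<^bsub>D\<^esub> FA F f)"

text \<open>Extensionality makes equality of records coincide with equality of functors on \<open>C\<close>.\<close>

definition ext_func :: "('o, 'a) cat \<Rightarrow> ('o, 'a, 'p, 'b) func \<Rightarrow> bool" where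
  "ext_func C F \<longleftrightarrow> FO F \<in> extensional (Ob C) \<and> FA F \<in> extensional (Ar C)"

definition id_func :: "('o, 'a) cat \<Rightarrow> ('o, 'a, 'o, 'a) func" where
  "id_func C = \<lparr>FO = restrict id (Ob C), FA = restrict id (Ar C)\<rparr>"

definition comp_func :: "('o, 'a) cat \<Rightarrow> ('p, 'b, 'q, 'c) func \<Rightarrow> ('o, 'a, 'p, 'b) func
    \<Rightarrow> ('o, 'a, 'q, 'c) func" where
  "comp_func C G F = \<lparr>FO = compose (Ob C) (FO G) (FO F), FA = compose (Ar C) (FA G) (FA F)\<rparr>"

definition is_cat_iso :: "('o, 'a) cat \<Rightarrow> ('p, 'b) cat \<Rightarrow> ('o, 'a, 'p, 'b) func \<Rightarrow> bool" where
  "is_cat_iso C D F \<longleftrightarrow> is_functor C D F \<and>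
     bij_betw (FO F) (Ob C) (Ob D) \<and> bij_betw (FA F) (Ar C) (Ar D)"

definition isomorphic_cat :: "('o, 'a) cat \<Rightarrow> ('p, 'b) cat \<Rightarrow> bool" where
  "isomorphic_cat C D \<longleftrightarrow> (\<exists>F. is_cat_iso C D F)"

definition one_cat :: "(unit, unit) cat" where
  "one_cat = \<lparr>Ob = UNIV, Ar = UNIV, Dom = (\<lambda>_. ()), Cod = (\<lambda>_. ()), Ide = (\<lambda>_. ()), Cmp = (\<lambda>_ _. ())\<rparr>"

definition prod_cat :: "('o, 'a) cat \<Rightarrow> ('p, 'b) cat \<Rightarrow> ('o \<times> 'p, 'a \<times> 'b) cat" where
  "prod_cat C D = \<lparr>Ob = Ob C \<times> Ob D, Ar = Ar C \<times> Ar D,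
     Dom = (\<lambda>(f, g). (Dom C f, Dom D g)), Cod = (\<lambda>(f, g). (Cod C f, Cod D g)),
     Ide = (\<lambda>(A, B). (Ide C A, Ide D B)),
     Cmp = (\<lambda>(f', g') (f, g). (f' \<cdot>\<^bsub>C\<^esub> f, g' \<cdot>\<^bsub>D\<^esub> g))\<rparr>"

definition posetal :: "('o, 'a) cat \<Rightarrow> bool" where
  "posetal K \<longleftrightarrow> (\<forall>x\<in>Ob K. \<forall>y\<in>Ob K. \<forall>f\<in>Hom K x y. \<forall>g\<in>Hom K x y. f = g)"

text \<open>
  Posetality of a category over a base (via \<open>L\<close>): at most one morphism from any object to any other
  over any given morphism of the base. See \<open>path_hom_not_posetal\<close> below for why the path categories
  are posetal only in this relative sense.
\<close>

definition posetal_over :: "('o, 'a) cat \<Rightarrow> ('o, 'a, 'p, 'b) func \<Rightarrow> bool" where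
  "posetal_over K L \<longleftrightarrow>
     (\<forall>x\<in>Ob K. \<forall>y\<in>Ob K. \<forall>f\<in>Hom K x y. \<forall>g\<in>Hom K x y. FA L f = FA L g \<longrightarrow> f = g)"


section \<open>Monoidal categories\<close>

record ('o, 'a) moncat =
  MCat :: "('o, 'a) cat"
  Tens :: "('o \<times> 'o, 'a \<times> 'a, 'o, 'a) func"
  MUnit :: 'o
  MAssoc :: "'o \<Rightarrow> 'o \<Rightarrow> 'o \<Rightarrow> 'a"
  MLUn :: "'o \<Rightarrow> 'a"
  MRUn :: "'o \<Rightarrow> 'a"

abbreviation tenO :: "('o, 'a) moncat \<Rightarrow> 'o \<Rightarrow> 'o \<Rightarrow> 'o" where
  "tenO M x y \<equiv> FO (Tens M) (x, y)"

abbreviation tenA :: "('o, 'a) moncat \<Rightarrow> 'a \<Rightarrow> 'a \<Rightarrow> 'a" where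
  "tenA M f g \<equiv> FA (Tens M) (f, g)"

definition monoidal_category :: "('o, 'a) moncat \<Rightarrow> bool" where
  "monoidal_category M \<longleftrightarrow>
     (let K = MCat M; I = MUnit M; a = MAssoc M; l = MLUn M; r = MRUn M in
     is_functor (prod_cat K K) K (Tens M) \<and> I \<in> Ob K \<and>
     (\<forall>x\<in>Ob K. \<forall>y\<in>Ob K. \<forall>z\<in>Ob K.
        a x y z \<in> iso_hom K (tenO M (tenO M x y) z) (tenO M x (tenO M y z))) \<and>
     (\<forall>f\<in>Ar K. \<forall>g\<in>Ar K. \<forall>h\<in>Ar K.
        a (Cod K f) (Cod K g) (Cod K h) \<cdot>\<^bsub>K\<^esub> tenA M (tenA M f g) h
        = tenA M f (tenA M g h) \<cdot>\<^bsub>K\<^esub> a (Dom K f) (Dom K g) (Dom K h)) \<and>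
     (\<forall>x\<in>Ob K. l x \<in> iso_hom K (tenO M I x) x \<and> r x \<in> iso_hom K (tenO M x I) x) \<and>
     (\<forall>f\<in>Ar K. l (Cod K f) \<cdot>\<^bsub>K\<^esub> tenA M (Ide K I) f = f \<cdot>\<^bsub>K\<^esub> l (Dom K f) \<and>
                r (Cod K f) \<cdot>\<^bsub>K\<^esub> tenA M f (Ide K I) = f \<cdot>\<^bsub>K\<^esub> r (Dom K f)) \<and>
     (\<forall>w\<in>Ob K. \<forall>x\<in>Ob K. \<forall>y\<in>Ob K. \<forall>z\<in>Ob K.
        tenA M (Ide K w) (a x y z) \<cdot>\<^bsub>K\<^esub> a w (tenO M x y) z \<cdot>\<^bsub>K\<^esub> tenA M (a w x y) (Ide K z)
        = a w x (tenO M y z) \<cdot>\<^bsub>K\<^esub> a (tenO M w x) y z) \<and>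
     (\<forall>x\<in>Ob K. \<forall>y\<in>Ob K.
        tenA M (Ide K x) (l y) \<cdot>\<^bsub>K\<^esub> a x I y = tenA M (r x) (Ide K y)))"

text \<open>
  (Strong) monoidal functors with structure isomorphisms
  \<open>\<phi> x y : F x \<otimes> F y \<rightarrow> F (x \<otimes> y)\<close> and \<open>\<iota> : I \<rightarrow> F I\<close>.
\<close>

definition monoidal_functor :: "('o, 'a) moncat \<Rightarrow> ('p, 'b) moncat \<Rightarrow> ('o, 'a, 'p, 'b) func
    \<Rightarrow> ('o \<Rightarrow> 'o \<Rightarrow> 'b) \<Rightarrow> 'b \<Rightarrow> bool" where
  "monoidal_functor M N F \<phi> \<iota> \<longleftrightarrow>
     (let K = MCat M; L = MCat N in
     monoidal_category M \<and> monoidal_category N \<and> is_functor K L F \<and>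
     (\<forall>x\<in>Ob K. \<forall>y\<in>Ob K. \<phi> x y \<in> iso_hom L (tenO N (FO F x) (FO F y)) (FO F (tenO M x y))) \<and>
     \<iota> \<in> iso_hom L (MUnit N) (FO F (MUnit M)) \<and>
     (\<forall>f\<in>Ar K. \<forall>g\<in>Ar K.
        \<phi> (Cod K f) (Cod K g) \<cdot>\<^bsub>L\<^esub> tenA N (FA F f) (FA F g)
        = FA F (tenA M f g) \<cdot>\<^bsub>L\<^esub> \<phi> (Dom K f) (Dom K g)) \<and>
     (\<forall>x\<in>Ob K. \<forall>y\<in>Ob K. \<forall>z\<in>Ob K.
        FA F (MAssoc M x y z) \<cdot>\<^bsub>L\<^esub> \<phi> (tenO M x y) z \<cdot>\<^bsub>L\<^esub> tenA N (\<phi> x y) (Ide L (FO F z))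
        = \<phi> x (tenO M y z) \<cdot>\<^bsub>L\<^esub> tenA N (Ide L (FO F x)) (\<phi> y z)
            \<cdot>\<^bsub>L\<^esub> MAssoc N (FO F x) (FO F y) (FO F z)) \<and>
     (\<forall>x\<in>Ob K.
        FA F (MLUn M x) \<cdot>\<^bsub>L\<^esub> \<phi> (MUnit M) x \<cdot>\<^bsub>L\<^esub> tenA N \<iota> (Ide L (FO F x)) = MLUn N (FO F x) \<and>
        FA F (MRUn M x) \<cdot>\<^bsub>L\<^esub> \<phi> x (MUnit M) \<cdot>\<^bsub>L\<^esub> tenA N (Ide L (FO F x)) \<iota> = MRUn N (FO F x)))"

definition is_monoidal_functor :: "('o, 'a) moncat \<Rightarrow> ('p, 'b) moncat \<Rightarrow> ('o, 'a, 'p, 'b) func \<Rightarrow> bool"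
  where
  "is_monoidal_functor M N F \<longleftrightarrow> (\<exists>\<phi> \<iota>. monoidal_functor M N F \<phi> \<iota>)"

definition is_monoidal_iso :: "('o, 'a) moncat \<Rightarrow> ('p, 'b) moncat \<Rightarrow> ('o, 'a, 'p, 'b) func \<Rightarrow> bool"
  where
  "is_monoidal_iso M N F \<longleftrightarrow> is_monoidal_functor M N F \<and> is_cat_iso (MCat M) (MCat N) F"


section \<open>Bicategories and their homomorphisms\<close>

text \<open>
  \<open>Hcat B X Y\<close> is the category of arrows from \<open>X\<close> to \<open>Y\<close>;
  \<open>HComp B X Y Z\<close> is composition \<open>B(Y,Z) \<times> B(X,Y) \<rightarrow> B(X,Z)\<close>; and
  \<open>Assoc B X Y Z W h g f : (h \<otimes> g) \<otimes> f \<rightarrow> h \<otimes> (g \<otimes> f)\<close>.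
\<close>

record ('o, 'f, 't) bicat =
  Obj :: "'o set"
  Hcat :: "'o \<Rightarrow> 'o \<Rightarrow> ('f, 't) cat"
  Unit1 :: "'o \<Rightarrow> 'f"
  HComp :: "'o \<Rightarrow> 'o \<Rightarrow> 'o \<Rightarrow> ('f \<times> 'f, 't \<times> 't, 'f, 't) func"
  Assoc :: "'o \<Rightarrow> 'o \<Rightarrow> 'o \<Rightarrow> 'o \<Rightarrow> 'f \<Rightarrow> 'f \<Rightarrow> 'f \<Rightarrow> 't"
  LUn :: "'o \<Rightarrow> 'o \<Rightarrow> 'f \<Rightarrow> 't"
  RUn :: "'o \<Rightarrow> 'o \<Rightarrow> 'f \<Rightarrow> 't"

abbreviation comp1 :: "('o, 'f, 't) bicat \<Rightarrow> 'o \<Rightarrow> 'o \<Rightarrow> 'o \<Rightarrow> 'f \<Rightarrow> 'f \<Rightarrow> 'f" where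
  "comp1 B X Y Z g f \<equiv> FO (HComp B X Y Z) (g, f)"

abbreviation comp2 :: "('o, 'f, 't) bicat \<Rightarrow> 'o \<Rightarrow> 'o \<Rightarrow> 'o \<Rightarrow> 't \<Rightarrow> 't \<Rightarrow> 't" where
  "comp2 B X Y Z \<tau> \<sigma> \<equiv> FA (HComp B X Y Z) (\<tau>, \<sigma>)"

definition bicategory :: "('o, 'f, 't) bicat \<Rightarrow> bool" where
  "bicategory B \<longleftrightarrow>
     (\<forall>X\<in>Obj B. \<forall>Y\<in>Obj B. category (Hcat B X Y)) \<and>
     (\<forall>X\<in>Obj B. Unit1 B X \<in> Ob (Hcat B X X)) \<and>
     (\<forall>X\<in>Obj B. \<forall>Y\<in>Obj B. \<forall>Z\<in>Obj B.
        is_functor (prod_cat (Hcat B Y Z) (Hcat B X Y)) (Hcat B X Z) (HComp B X Y Z)) \<and>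
     \<comment> \<open>associativity isomorphisms and their naturality\<close>
     (\<forall>X\<in>Obj B. \<forall>Y\<in>Obj B. \<forall>Z\<in>Obj B. \<forall>W\<in>Obj B.
        (\<forall>h\<in>Ob (Hcat B Z W). \<forall>g\<in>Ob (Hcat B Y Z). \<forall>f\<in>Ob (Hcat B X Y).
           Assoc B X Y Z W h g f \<in> iso_hom (Hcat B X W)
             (comp1 B X Y W (comp1 B Y Z W h g) f) (comp1 B X Z W h (comp1 B X Y Z g f))) \<and>
        (\<forall>\<rho>\<in>Ar (Hcat B Z W). \<forall>\<tau>\<in>Ar (Hcat B Y Z). \<forall>\<sigma>\<in>Ar (Hcat B X Y).
           Assoc B X Y Z W (Cod (Hcat B Z W) \<rho>) (Cod (Hcat B Y Z) \<tau>) (Cod (Hcat B X Y) \<sigma>)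
             \<cdot>\<^bsub>Hcat B X W\<^esub> comp2 B X Y W (comp2 B Y Z W \<rho> \<tau>) \<sigma>
           = comp2 B X Z W \<rho> (comp2 B X Y Z \<tau> \<sigma>)
             \<cdot>\<^bsub>Hcat B X W\<^esub>
             Assoc B X Y Z W (Dom (Hcat B Z W) \<rho>) (Dom (Hcat B Y Z) \<tau>) (Dom (Hcat B X Y) \<sigma>))) \<and>
     \<comment> \<open>unit isomorphisms and their naturality\<close>
     (\<forall>X\<in>Obj B. \<forall>Y\<in>Obj B.
        (\<forall>f\<in>Ob (Hcat B X Y).
           LUn B X Y f \<in> iso_hom (Hcat B X Y) (comp1 B X Y Y (Unit1 B Y) f) f \<and>
           RUn B X Y f \<in> iso_hom (Hcat B X Y) (comp1 B X X Y f (Unit1 B X)) f) \<and>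
        (\<forall>\<sigma>\<in>Ar (Hcat B X Y).
           LUn B X Y (Cod (Hcat B X Y) \<sigma>)
             \<cdot>\<^bsub>Hcat B X Y\<^esub> comp2 B X Y Y (Ide (Hcat B Y Y) (Unit1 B Y)) \<sigma>
           = \<sigma> \<cdot>\<^bsub>Hcat B X Y\<^esub> LUn B X Y (Dom (Hcat B X Y) \<sigma>) \<and>
           RUn B X Y (Cod (Hcat B X Y) \<sigma>)
             \<cdot>\<^bsub>Hcat B X Y\<^esub> comp2 B X X Y \<sigma> (Ide (Hcat B X X) (Unit1 B X))
           = \<sigma> \<cdot>\<^bsub>Hcat B X Y\<^esub> RUn B X Y (Dom (Hcat B X Y) \<sigma>))) \<and>
     \<comment> \<open>pentagon\<close>
     (\<forall>X\<in>Obj B. \<forall>Y\<in>Obj B. \<forall>Z\<in>Obj B. \<forall>W\<in>Obj B. \<forall>V\<in>Obj B.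
        \<forall>k\<in>Ob (Hcat B W V). \<forall>h\<in>Ob (Hcat B Z W). \<forall>g\<in>Ob (Hcat B Y Z). \<forall>f\<in>Ob (Hcat B X Y).
          comp2 B X W V (Ide (Hcat B W V) k) (Assoc B X Y Z W h g f)
            \<cdot>\<^bsub>Hcat B X V\<^esub> Assoc B X Y W V k (comp1 B Y Z W h g) f
            \<cdot>\<^bsub>Hcat B X V\<^esub> comp2 B X Y V (Assoc B Y Z W V k h g) (Ide (Hcat B X Y) f)
          = Assoc B X Z W V k h (comp1 B X Y Z g f)
            \<cdot>\<^bsub>Hcat B X V\<^esub> Assoc B X Y Z V (comp1 B Z W V k h) g f) \<and>
     \<comment> \<open>triangle\<close>
     (\<forall>X\<in>Obj B. \<forall>Y\<in>Obj B. \<forall>Z\<in>Obj B. \<forall>g\<in>Ob (Hcat B Y Z). \<forall>f\<in>Ob (Hcat B X Y).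
          comp2 B X Y Z (Ide (Hcat B Y Z) g) (LUn B X Y f)
            \<cdot>\<^bsub>Hcat B X Z\<^esub> Assoc B X Y Y Z g (Unit1 B Y) f
          = comp2 B X Y Z (RUn B Y Z g) (Ide (Hcat B X Y) f))"

definition strict_2category :: "('o, 'f, 't) bicat \<Rightarrow> bool" where
  "strict_2category B \<longleftrightarrow> bicategory B \<and>
     (\<forall>X\<in>Obj B. \<forall>Y\<in>Obj B. \<forall>Z\<in>Obj B. \<forall>W\<in>Obj B.
        \<forall>h\<in>Ob (Hcat B Z W). \<forall>g\<in>Ob (Hcat B Y Z). \<forall>f\<in>Ob (Hcat B X Y).
          comp1 B X Y W (comp1 B Y Z W h g) f = comp1 B X Z W h (comp1 B X Y Z g f) \<and>
          Assoc B X Y Z W h g f = Ide (Hcat B X W) (comp1 B X Z W h (comp1 B X Y Z g f))) \<and>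
     (\<forall>X\<in>Obj B. \<forall>Y\<in>Obj B. \<forall>f\<in>Ob (Hcat B X Y).
          comp1 B X Y Y (Unit1 B Y) f = f \<and> LUn B X Y f = Ide (Hcat B X Y) f \<and>
          comp1 B X X Y f (Unit1 B X) = f \<and> RUn B X Y f = Ide (Hcat B X Y) f)"

text \<open>
  The monoidal category of endo-arrows of \<open>X\<close>, with the composition of \<open>B\<close> as tensor product. The
  tensor is written in diagrammatic order (\<open>s \<otimes> t\<close> is ``s followed by t''), hence the reversed
  arguments. This is forced by the convention that concatenation acts on 2-cells by
  \<open>u' \<otimes> u = u + u'\<close>: the sum of maps in \<open>\<Delta>\<close> is not commutative, and the length functor preserves
  the tensor product for this order only.
\<close>

definition endo_mon :: "('o, 'f, 't) bicat \<Rightarrow> 'o \<Rightarrow> ('f, 't) moncat" where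
  "endo_mon B X = \<lparr>MCat = Hcat B X X,
     Tens = \<lparr>FO = (\<lambda>(s, t). comp1 B X X X t s), FA = (\<lambda>(\<sigma>, \<tau>). comp2 B X X X \<tau> \<sigma>)\<rparr>,
     MUnit = Unit1 B X,
     MAssoc = (\<lambda>r s t. inv_ar (Hcat B X X) (Assoc B X X X X t s r)),
     MLUn = RUn B X X, MRUn = LUn B X X\<rparr>"

text \<open>
  Homomorphisms (pseudofunctors): \<open>h0\<close> on objects, \<open>hF\<close> on arrow categories, and invertible structure
  2-cells \<open>hm (X,Y,Z,g,f) : F g \<otimes> F f \<rightarrow> F (g \<otimes> f)\<close> and \<open>hu X : 1 \<rightarrow> F 1\<close>.
\<close>

record ('o, 'f, 't, 'p, 'g, 's) bihom =
  h0 :: "'o \<Rightarrow> 'p"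
  hF :: "'o \<times> 'o \<Rightarrow> ('f, 't, 'g, 's) func"
  hm :: "'o \<times> 'o \<times> 'o \<times> 'f \<times> 'f \<Rightarrow> 's"
  hu :: "'o \<Rightarrow> 's"

definition composable :: "('o, 'f, 't) bicat \<Rightarrow> ('o \<times> 'o \<times> 'o \<times> 'f \<times> 'f) set" where
  "composable B = {(X, Y, Z, g, f). X \<in> Obj B \<and> Y \<in> Obj B \<and> Z \<in> Obj B \<and>
                                    g \<in> Ob (Hcat B Y Z) \<and> f \<in> Ob (Hcat B X Y)}"

definition homomorphism :: "('o, 'f, 't) bicat \<Rightarrow> ('p, 'g, 's) bicat
    \<Rightarrow> ('o, 'f, 't, 'p, 'g, 's) bihom \<Rightarrow> bool" where
  "homomorphism B B' F \<longleftrightarrow> bicategory B \<and> bicategory B' \<and>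
     (\<forall>X\<in>Obj B. h0 F X \<in> Obj B') \<and>
     (\<forall>X\<in>Obj B. \<forall>Y\<in>Obj B. is_functor (Hcat B X Y) (Hcat B' (h0 F X) (h0 F Y)) (hF F (X, Y))) \<and>
     \<comment> \<open>structure 2-cells and naturality\<close>
     (\<forall>(X, Y, Z, g, f)\<in>composable B.
        hm F (X, Y, Z, g, f) \<in> iso_hom (Hcat B' (h0 F X) (h0 F Z))
          (comp1 B' (h0 F X) (h0 F Y) (h0 F Z) (FO (hF F (Y, Z)) g) (FO (hF F (X, Y)) f))
          (FO (hF F (X, Z)) (comp1 B X Y Z g f))) \<and>
     (\<forall>X\<in>Obj B. hu F X \<in> iso_hom (Hcat B' (h0 F X) (h0 F X))
          (Unit1 B' (h0 F X)) (FO (hF F (X, X)) (Unit1 B X))) \<and>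
     (\<forall>X\<in>Obj B. \<forall>Y\<in>Obj B. \<forall>Z\<in>Obj B. \<forall>\<tau>\<in>Ar (Hcat B Y Z). \<forall>\<sigma>\<in>Ar (Hcat B X Y).
        hm F (X, Y, Z, Cod (Hcat B Y Z) \<tau>, Cod (Hcat B X Y) \<sigma>)
          \<cdot>\<^bsub>Hcat B' (h0 F X) (h0 F Z)\<^esub>
          comp2 B' (h0 F X) (h0 F Y) (h0 F Z) (FA (hF F (Y, Z)) \<tau>) (FA (hF F (X, Y)) \<sigma>)
        = FA (hF F (X, Z)) (comp2 B X Y Z \<tau> \<sigma>)
          \<cdot>\<^bsub>Hcat B' (h0 F X) (h0 F Z)\<^esub>
          hm F (X, Y, Z, Dom (Hcat B Y Z) \<tau>, Dom (Hcat B X Y) \<sigma>)) \<and>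
     \<comment> \<open>compatibility with associativity isomorphisms\<close>
     (\<forall>X\<in>Obj B. \<forall>Y\<in>Obj B. \<forall>Z\<in>Obj B. \<forall>W\<in>Obj B.
        \<forall>h\<in>Ob (Hcat B Z W). \<forall>g\<in>Ob (Hcat B Y Z). \<forall>f\<in>Ob (Hcat B X Y).
          FA (hF F (X, W)) (Assoc B X Y Z W h g f)
            \<cdot>\<^bsub>Hcat B' (h0 F X) (h0 F W)\<^esub> hm F (X, Y, W, comp1 B Y Z W h g, f)
            \<cdot>\<^bsub>Hcat B' (h0 F X) (h0 F W)\<^esub>
            comp2 B' (h0 F X) (h0 F Y) (h0 F W)
              (hm F (Y, Z, W, h, g)) (Ide (Hcat B' (h0 F X) (h0 F Y)) (FO (hF F (X, Y)) f))
          = hm F (X, Z, W, h, comp1 B X Y Z g f)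
            \<cdot>\<^bsub>Hcat B' (h0 F X) (h0 F W)\<^esub>
            comp2 B' (h0 F X) (h0 F Z) (h0 F W)
              (Ide (Hcat B' (h0 F Z) (h0 F W)) (FO (hF F (Z, W)) h)) (hm F (X, Y, Z, g, f))
            \<cdot>\<^bsub>Hcat B' (h0 F X) (h0 F W)\<^esub>
            Assoc B' (h0 F X) (h0 F Y) (h0 F Z) (h0 F W)
              (FO (hF F (Z, W)) h) (FO (hF F (Y, Z)) g) (FO (hF F (X, Y)) f)) \<and>
     \<comment> \<open>compatibility with unit isomorphisms\<close>
     (\<forall>X\<in>Obj B. \<forall>Y\<in>Obj B. \<forall>f\<in>Ob (Hcat B X Y).
          FA (hF F (X, Y)) (LUn B X Y f)
            \<cdot>\<^bsub>Hcat B' (h0 F X) (h0 F Y)\<^esub> hm F (X, Y, Y, Unit1 B Y, f)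
            \<cdot>\<^bsub>Hcat B' (h0 F X) (h0 F Y)\<^esub>
            comp2 B' (h0 F X) (h0 F Y) (h0 F Y)
              (hu F Y) (Ide (Hcat B' (h0 F X) (h0 F Y)) (FO (hF F (X, Y)) f))
          = LUn B' (h0 F X) (h0 F Y) (FO (hF F (X, Y)) f) \<and>
          FA (hF F (X, Y)) (RUn B X Y f)
            \<cdot>\<^bsub>Hcat B' (h0 F X) (h0 F Y)\<^esub> hm F (X, X, Y, f, Unit1 B X)
            \<cdot>\<^bsub>Hcat B' (h0 F X) (h0 F Y)\<^esub>
            comp2 B' (h0 F X) (h0 F X) (h0 F Y)
              (Ide (Hcat B' (h0 F X) (h0 F Y)) (FO (hF F (X, Y)) f)) (hu F X)
          = RUn B' (h0 F X) (h0 F Y) (FO (hF F (X, Y)) f))"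

definition strict_homomorphism :: "('o, 'f, 't) bicat \<Rightarrow> ('p, 'g, 's) bicat
    \<Rightarrow> ('o, 'f, 't, 'p, 'g, 's) bihom \<Rightarrow> bool" where
  "strict_homomorphism B B' F \<longleftrightarrow> homomorphism B B' F \<and>
     (\<forall>(X, Y, Z, g, f)\<in>composable B.
        comp1 B' (h0 F X) (h0 F Y) (h0 F Z) (FO (hF F (Y, Z)) g) (FO (hF F (X, Y)) f)
          = FO (hF F (X, Z)) (comp1 B X Y Z g f) \<and>
        hm F (X, Y, Z, g, f)
          = Ide (Hcat B' (h0 F X) (h0 F Z)) (FO (hF F (X, Z)) (comp1 B X Y Z g f))) \<and>
     (\<forall>X\<in>Obj B. Unit1 B' (h0 F X) = FO (hF F (X, X)) (Unit1 B X) \<and>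
        hu F X = Ide (Hcat B' (h0 F X) (h0 F X)) (Unit1 B' (h0 F X)))"

definition ext_bihom :: "('o, 'f, 't) bicat \<Rightarrow> ('o, 'f, 't, 'p, 'g, 's) bihom \<Rightarrow> bool" where
  "ext_bihom B F \<longleftrightarrow> h0 F \<in> extensional (Obj B) \<and> hF F \<in> extensional (Obj B \<times> Obj B) \<and>
     (\<forall>X\<in>Obj B. \<forall>Y\<in>Obj B. ext_func (Hcat B X Y) (hF F (X, Y))) \<and>
     hm F \<in> extensional (composable B) \<and> hu F \<in> extensional (Obj B)"

definition id_bihom :: "('o, 'f, 't) bicat \<Rightarrow> ('o, 'f, 't, 'o, 'f, 't) bihom" where
  "id_bihom B = \<lparr>h0 = restrict id (Obj B),
     hF = (\<lambda>(X, Y)\<in>Obj B \<times> Obj B. id_func (Hcat B X Y)),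
     hm = (\<lambda>(X, Y, Z, g, f)\<in>composable B. Ide (Hcat B X Z) (comp1 B X Y Z g f)),
     hu = (\<lambda>X\<in>Obj B. Ide (Hcat B X X) (Unit1 B X))\<rparr>"

definition comp_bihom :: "('o, 'f, 't) bicat \<Rightarrow> ('q, 'k, 'r) bicat
    \<Rightarrow> ('p, 'g, 's, 'q, 'k, 'r) bihom \<Rightarrow> ('o, 'f, 't, 'p, 'g, 's) bihom
    \<Rightarrow> ('o, 'f, 't, 'q, 'k, 'r) bihom" where
  "comp_bihom B B'' G F = \<lparr>h0 = compose (Obj B) (h0 G) (h0 F),
     hF = (\<lambda>(X, Y)\<in>Obj B \<times> Obj B.
             comp_func (Hcat B X Y) (hF G (h0 F X, h0 F Y)) (hF F (X, Y))),
     hm = (\<lambda>(X, Y, Z, g, f)\<in>composable B.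
             FA (hF G (h0 F X, h0 F Z)) (hm F (X, Y, Z, g, f))
             \<cdot>\<^bsub>Hcat B'' (h0 G (h0 F X)) (h0 G (h0 F Z))\<^esub>
             hm G (h0 F X, h0 F Y, h0 F Z, FO (hF F (Y, Z)) g, FO (hF F (X, Y)) f)),
     hu = (\<lambda>X\<in>Obj B. FA (hF G (h0 F X, h0 F X)) (hu F X)
             \<cdot>\<^bsub>Hcat B'' (h0 G (h0 F X)) (h0 G (h0 F X))\<^esub> hu G (h0 F X))\<rparr>"


section \<open>The categories of small categories and of bicategories\<close>

text \<open>
  Relative to the type parameters, which play the role of the universe. An arrow is a triple
  (source, map, target).
\<close>

definition Cat :: "(('o, 'a) cat, ('o, 'a) cat \<times> ('o, 'a, 'o, 'a) func \<times> ('o, 'a) cat) cat" where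
  "Cat = \<lparr>Ob = {C. category C},
     Ar = {(C, F, D). is_functor C D F \<and> ext_func C F},
     Dom = (\<lambda>(C, F, D). C), Cod = (\<lambda>(C, F, D). D),
     Ide = (\<lambda>C. (C, id_func C, C)),
     Cmp = (\<lambda>(D', G, E) (C, F, D). (C, comp_func C G F, E))\<rparr>"

definition Bicat :: "(('o, 'f, 't) bicat,
    ('o, 'f, 't) bicat \<times> ('o, 'f, 't, 'o, 'f, 't) bihom \<times> ('o, 'f, 't) bicat) cat" where
  "Bicat = \<lparr>Ob = {B. bicategory B},
     Ar = {(B, F, B'). homomorphism B B' F \<and> ext_bihom B F},
     Dom = (\<lambda>(B, F, B'). B), Cod = (\<lambda>(B, F, B'). B'),
     Ide = (\<lambda>B. (B, id_bihom B, B)),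
     Cmp = (\<lambda>(D', G, E) (B, F, D). (B, comp_bihom B E G F, E))\<rparr>"


section \<open>The category of finite ordinals\<close>

text \<open>
  The natural number \<open>n\<close> stands for the ordinal \<open>{..<n}\<close>; an arrow is a triple \<open>(n, u, m)\<close> with \<open>u\<close>
  extensional on \<open>{..<n}\<close>.
\<close>

type_synonym ordmap = "nat \<times> (nat \<Rightarrow> nat) \<times> nat"

definition Delta :: "(nat, ordmap) cat" where
  "Delta = \<lparr>Ob = UNIV,
     Ar = {(n, u, m). u \<in> {..<n} \<rightarrow>\<^sub>E {..<m} \<and> mono_on {..<n} u},
     Dom = (\<lambda>(n, u, m). n), Cod = (\<lambda>(n, u, m). m),
     Ide = (\<lambda>n. (n, restrict id {..<n}, n)),
     Cmp = (\<lambda>(m', v, k) (n, u, m). (n, compose {..<n} v u, k))\<rparr>"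

definition ord_sum :: "ordmap \<Rightarrow> ordmap \<Rightarrow> ordmap" where
  "ord_sum = (\<lambda>(n, u, m) (n', u', m').
     (n + n', (\<lambda>i\<in>{..<n + n'}. if i < n then u i else m + u' (i - n)), m + m'))"

definition Delta_mon :: "(nat, ordmap) moncat" where
  "Delta_mon = \<lparr>MCat = Delta,
     Tens = \<lparr>FO = (\<lambda>(n, m). n + m), FA = (\<lambda>(u, u'). ord_sum u u')\<rparr>,
     MUnit = 0,
     MAssoc = (\<lambda>n m k. Ide Delta (n + m + k)), MLUn = Ide Delta, MRUn = Ide Delta\<rparr>"


section \<open>The 2-path-category\<close>

text \<open>
  A chain from \<open>A\<close> to \<open>B\<close> is the list of its arrows in the order in which they are traversed.
  The end points are not part of the list; in particular the chain of length 0 at any object is \<open>[]\<close>.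
\<close>

primrec is_chain :: "('o, 'a) cat \<Rightarrow> 'o \<Rightarrow> 'a list \<Rightarrow> 'o \<Rightarrow> bool" where
  "is_chain C A [] B \<longleftrightarrow> A \<in> Ob C \<and> A = B"
| "is_chain C A (f # s) B \<longleftrightarrow> f \<in> Ar C \<and> Dom C f = A \<and> is_chain C (Cod C f) s B"

definition chains :: "('o, 'a) cat \<Rightarrow> 'o \<Rightarrow> 'o \<Rightarrow> nat \<Rightarrow> 'a list set" where
  "chains C A B n = {s. is_chain C A s B \<and> length s = n}"

definition vertex :: "('o, 'a) cat \<Rightarrow> 'o \<Rightarrow> 'a list \<Rightarrow> nat \<Rightarrow> 'o" where
  "vertex C A s k = (if k = 0 then A else Cod C (s ! (k - 1)))"

definition composite :: "('o, 'a) cat \<Rightarrow> 'o \<Rightarrow> 'a list \<Rightarrow> 'a" where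
  "composite C X s = foldl (\<lambda>g f. f \<cdot>\<^bsub>C\<^esub> g) (Ide C X) s"

text \<open>
  The arrows of \<open>s\<close> with index in the fibre of \<open>u\<close> over \<open>j\<close> are consecutive and start at the vertex
  whose index is the number of \<open>i\<close> with \<open>u i < j\<close>; if the fibre is empty, the composite is the
  identity of that vertex.
\<close>

definition chain_map :: "('o, 'a) cat \<Rightarrow> 'o \<Rightarrow> ordmap \<Rightarrow> 'a list \<Rightarrow> 'a list" where
  "chain_map C A = (\<lambda>(n, u, m) s.
     map (\<lambda>j. composite C (vertex C A s (card {i. i < n \<and> u i < j}))
                [s ! i. i \<leftarrow> [0..<n], u i = j]) [0..<m])"

type_synonym 'a path = "nat \<times> 'a list"
type_synonym 'a path_cell = "'a path \<times> ordmap \<times> 'a path"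

definition path_hom :: "('o, 'a) cat \<Rightarrow> 'o \<Rightarrow> 'o \<Rightarrow> ('a path, 'a path_cell) cat" where
  "path_hom C A B = \<lparr>Ob = {(n, s). s \<in> chains C A B n},
     Ar = {((n, s), u, (m, t)). s \<in> chains C A B n \<and> t \<in> chains C A B m \<and>
                                u \<in> Hom Delta n m \<and> chain_map C A u s = t},
     Dom = (\<lambda>(x, u, y). x), Cod = (\<lambda>(x, u, y). y),
     Ide = (\<lambda>(n, s). ((n, s), Ide Delta n, (n, s))),
     Cmp = (\<lambda>(y', v, z) (x, u, y). (x, v \<cdot>\<^bsub>Delta\<^esub> u, z))\<rparr>"

definition path_length :: "('a path, 'a path_cell, nat, ordmap) func" where
  "path_length = \<lparr>FO = (\<lambda>(n, s). n), FA = (\<lambda>(x, u, y). u)\<rparr>"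

text \<open>\<open>concat_path t s\<close> is \<open>t \<otimes> s\<close>, that is, \<open>s\<close> followed by \<open>t\<close>.\<close>

definition concat_path :: "'a path \<Rightarrow> 'a path \<Rightarrow> 'a path" where
  "concat_path = (\<lambda>(m, t) (n, s). (n + m, s @ t))"

definition concat_cell :: "'a path_cell \<Rightarrow> 'a path_cell \<Rightarrow> 'a path_cell" where
  "concat_cell = (\<lambda>(x', u', y') (x, u, y). (concat_path x' x, ord_sum u u', concat_path y' y))"

definition path_2cat :: "('o, 'a) cat \<Rightarrow> ('o, 'a path, 'a path_cell) bicat" where
  "path_2cat C = \<lparr>Obj = Ob C,
     Hcat = path_hom C,
     Unit1 = (\<lambda>A. (0, [])),
     HComp = (\<lambda>X Y Z. \<lparr>FO = (\<lambda>(t, s). concat_path t s), FA = (\<lambda>(\<tau>, \<sigma>). concat_cell \<tau> \<sigma>)\<rparr>),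
     Assoc = (\<lambda>X Y Z W h g f. Ide (path_hom C X W) (concat_path h (concat_path g f))),
     LUn = (\<lambda>X Y. Ide (path_hom C X Y)),
     RUn = (\<lambda>X Y. Ide (path_hom C X Y))\<rparr>"

definition map_path :: "('a \<Rightarrow> 'b) \<Rightarrow> 'a path \<Rightarrow> 'b path" where
  "map_path f = (\<lambda>(n, s). (n, map f s))"

definition path_bihom :: "('o, 'a) cat \<Rightarrow> ('o, 'a, 'p, 'b) func \<Rightarrow> ('p, 'b) cat
    \<Rightarrow> ('o, 'a path, 'a path_cell, 'p, 'b path, 'b path_cell) bihom" where
  "path_bihom C F D = \<lparr>h0 = restrict (FO F) (Ob C),
     hF = (\<lambda>(X, Y)\<in>Ob C \<times> Ob C.
       \<lparr>FO = restrict (map_path (FA F)) (Ob (path_hom C X Y)),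
        FA = (\<lambda>(x, u, y)\<in>Ar (path_hom C X Y). (map_path (FA F) x, u, map_path (FA F) y))\<rparr>),
     hm = (\<lambda>(X, Y, Z, g, f)\<in>composable (path_2cat C).
       Ide (path_hom D (FO F X) (FO F Z)) (map_path (FA F) (concat_path g f))),
     hu = (\<lambda>X\<in>Ob C. Ide (path_hom D (FO F X) (FO F X)) (0, []))\<rparr>"

definition path_functor :: "(('o, 'a) cat, ('o, 'a) cat \<times> ('o, 'a, 'o, 'a) func \<times> ('o, 'a) cat,
    ('o, 'a path, 'a path_cell) bicat,
    ('o, 'a path, 'a path_cell) bicat
      \<times> ('o, 'a path, 'a path_cell, 'o, 'a path, 'a path_cell) bihom
      \<times> ('o, 'a path, 'a path_cell) bicat) func" where
  "path_functor = \<lparr>FO = path_2cat, FA = (\<lambda>(C, F, D). (path_2cat C, path_bihom C F D, path_2cat D))\<rparr>"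

text \<open>
  \<open>path_hom C A A\<close> is never posetal in the absolute sense: both maps \<open>1 \<rightarrow> 2\<close> of \<open>\<Delta>\<close> send the chain
  \<open>A \<rightarrow> A\<close> to \<open>A \<rightarrow> A \<rightarrow> A\<close> when all arrows are identities. (For \<open>C = 1\<close> this is the fact that \<open>\<Delta>\<close>
  itself is not posetal.)
\<close>

lemma path_hom_not_posetal:
  assumes "category C" "A \<in> Ob C"
  shows "\<not> posetal (path_hom C A A)"
proof
  let ?i = "Ide C A"
  assume P: "posetal (path_hom C A A)"
  have i: "?i \<in> Ar C" "Dom C ?i = A" "Cod C ?i = A"
    using assms by (auto simp: category_def Hom_def)
  have ii: "?i \<cdot>\<^bsub>C\<^esub> ?i = ?i"
    using assms i unfolding category_def by metis
  define u where "u k = (1::nat, (\<lambda>i\<in>{..<1::nat}. k), 2::nat)" for k :: nat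
  have cell: "((1, [?i]), u k, (2, [?i, ?i])) \<in> Hom (path_hom C A A) (1, [?i]) (2, [?i, ?i])"
    if "k < 2" for k
  proof -
    have "chain_map C A (u k) [?i] = [?i, ?i]"
      using that i ii
      by (auto simp: u_def chain_map_def composite_def vertex_def numeral_2_eq_2 less_Suc_eq)
    then show ?thesis
      using that i assms(2)
      by (auto simp: Hom_def path_hom_def chains_def u_def Delta_def mono_on_def)
  qed
  have ob: "(1, [?i]) \<in> Ob (path_hom C A A)" "(2, [?i, ?i]) \<in> Ob (path_hom C A A)"
    using i assms(2) by (auto simp: path_hom_def chains_def)
  have "((1, [?i]), u 0, (2, [?i, ?i])) = ((1, [?i]), u 1, (2, [?i, ?i]))"
    using P[unfolded posetal_def, rule_format, OF ob cell[of 0] cell[of 1]] by simp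
  then have "u 0 = u 1"
    by (elim Pair_inject)
  then have "fst (snd (u 0)) 0 = fst (snd (u 1)) 0"
    by (rule arg_cong)
  then show False
    by (simp add: u_def)
qed

end

theory Submission
  imports Defs
begin

text \<open>
  A map \<open>u : n \<rightarrow> m\<close> of \<open>\<Delta>\<close> is determined by its cut points, the numbers
  \<open>cut j = #{i. u i < j}\<close>: the fibre over \<open>j\<close> is the interval from \<open>cut j\<close> to \<open>cut (j + 1)\<close>. Hence the
  \<open>j\<close>-th arrow of the chain \<open>u s\<close> is the composite of that segment of \<open>s\<close>, and more generally
  segments of \<open>u s\<close> are segments of \<open>s\<close> between cut points. Cut points of a composite are
  \<open>cut u (cut v j)\<close> and those of an ordinal sum are juxtaposed, so the action on chains is functorial
  and compatible with concatenation, and it is natural in the category because functors preserve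
  composites of segments. All structure cells of the 2-path-category are identities, which makes the
  coherence conditions trivial. What remains is that bicategories form a category, where
  the only work is the coherence of a composite homomorphism.
\<close>

section \<open>Categories and functors\<close>

text \<open>Posetality is relative to length because a 2-cell is stored as its source, its map of
  \<open>\<Delta>\<close> and its target, so that the map separates parallel cells. For the terminal
  category a chain is nothing but its length, and the length functor itself is the isomorphism onto
  \<open>\<Delta>\<close>. An empty fibre contains no arrow that could tell where the inserted
  identity belongs. Its cut point still records the vertex, which is why segments between cut
  points, and not fibres, carry the proof. The definition of strictness speaks only of 1-cells and
  of structure cells being identities; strict associativity and unit laws for 2-cells are the
  naturality of these identities. Functors and homomorphisms are compared as records, so equality
  needs extensionality besides agreement on the given sets. In a composite homomorphism each
  structure cell is a product of two cells, and the coherence laws of the two factors do not meet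
  until a naturality square of the outer factor has interchanged some of these cells.\<close>

lemma Hom_iff: "f \<in> Hom C A B \<longleftrightarrow> f \<in> Ar C \<and> Dom C f = A \<and> Cod C f = B"
  by (simp add: Hom_def)

lemma Ar_in_Hom: "f \<in> Ar C \<Longrightarrow> f \<in> Hom C (Dom C f) (Cod C f)"
  by (simp add: Hom_def)

lemma categoryI:
  assumes "\<And>f. f \<in> Ar C \<Longrightarrow> Dom C f \<in> Ob C"
    and "\<And>f. f \<in> Ar C \<Longrightarrow> Cod C f \<in> Ob C"
    and "\<And>A. A \<in> Ob C \<Longrightarrow> Ide C A \<in> Hom C A A"
    and "\<And>f g. f \<in> Ar C \<Longrightarrow> g \<in> Ar C \<Longrightarrow> Cod C f = Dom C g \<Longrightarrow>
           g \<cdot>\<^bsub>C\<^esub> f \<in> Hom C (Dom C f) (Cod C g)"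
    and "\<And>f. f \<in> Ar C \<Longrightarrow> f \<cdot>\<^bsub>C\<^esub> Ide C (Dom C f) = f"
    and "\<And>f. f \<in> Ar C \<Longrightarrow> Ide C (Cod C f) \<cdot>\<^bsub>C\<^esub> f = f"
    and "\<And>f g h. f \<in> Ar C \<Longrightarrow> g \<in> Ar C \<Longrightarrow> h \<in> Ar C \<Longrightarrow> Cod C f = Dom C g \<Longrightarrow>
           Cod C g = Dom C h \<Longrightarrow> (h \<cdot>\<^bsub>C\<^esub> g) \<cdot>\<^bsub>C\<^esub> f = h \<cdot>\<^bsub>C\<^esub> (g \<cdot>\<^bsub>C\<^esub> f)"
  shows "category C"
  unfolding category_def by (intro conjI ballI impI assms)

context
  fixes C :: "('o, 'a) cat"
  assumes C: "category C"
begin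

lemma Hom_Ob: "f \<in> Hom C A B \<Longrightarrow> A \<in> Ob C \<and> B \<in> Ob C"
  using C by (auto simp: category_def Hom_def)

lemma Ide_in_Hom: "A \<in> Ob C \<Longrightarrow> Ide C A \<in> Hom C A A"
  using C by (simp add: category_def)

lemma Cmp_in_Hom: "f \<in> Hom C A B \<Longrightarrow> g \<in> Hom C B D \<Longrightarrow> g \<cdot>\<^bsub>C\<^esub> f \<in> Hom C A D"
  using C by (auto simp: category_def Hom_def)

lemma Cmp_Ide: "f \<in> Hom C A B \<Longrightarrow> f \<cdot>\<^bsub>C\<^esub> Ide C A = f"
  using C by (auto simp: category_def Hom_def)

lemma Ide_Cmp: "f \<in> Hom C A B \<Longrightarrow> Ide C B \<cdot>\<^bsub>C\<^esub> f = f"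
  using C by (auto simp: category_def Hom_def)

lemma Cmp_assoc:
  "f \<in> Hom C A B \<Longrightarrow> g \<in> Hom C B D \<Longrightarrow> h \<in> Hom C D E \<Longrightarrow>
     (h \<cdot>\<^bsub>C\<^esub> g) \<cdot>\<^bsub>C\<^esub> f = h \<cdot>\<^bsub>C\<^esub> (g \<cdot>\<^bsub>C\<^esub> f)"
  using C by (auto simp: category_def Hom_def)

lemma iso_homI:
  "f \<in> Hom C A B \<Longrightarrow> g \<in> Hom C B A \<Longrightarrow> g \<cdot>\<^bsub>C\<^esub> f = Ide C A \<Longrightarrow> f \<cdot>\<^bsub>C\<^esub> g = Ide C B \<Longrightarrow>
     f \<in> iso_hom C A B"
  by (auto simp: iso_hom_def is_inverse_def Hom_def)

lemma iso_homE:
  assumes "f \<in> iso_hom C A B"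
  obtains g where "f \<in> Hom C A B" "g \<in> Hom C B A" "g \<cdot>\<^bsub>C\<^esub> f = Ide C A" "f \<cdot>\<^bsub>C\<^esub> g = Ide C B"
  using assms by (auto simp: iso_hom_def is_inverse_def Hom_def)

lemma iso_hom_in_Hom: "f \<in> iso_hom C A B \<Longrightarrow> f \<in> Hom C A B"
  by (simp add: iso_hom_def)

lemma Ide_iso: "A \<in> Ob C \<Longrightarrow> Ide C A \<in> iso_hom C A A"
  by (rule iso_homI[OF Ide_in_Hom Ide_in_Hom]) (auto intro: Cmp_Ide Ide_in_Hom)

lemma Cmp_iso:
  assumes f: "f \<in> iso_hom C A B" and g: "g \<in> iso_hom C B D"
  shows "g \<cdot>\<^bsub>C\<^esub> f \<in> iso_hom C A D"
proof -
  obtain f' where f': "f \<in> Hom C A B" "f' \<in> Hom C B A" "f' \<cdot>\<^bsub>C\<^esub> f = Ide C A" "f \<cdot>\<^bsub>C\<^esub> f' = Ide C B"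
    using f by (rule iso_homE)
  obtain g' where g': "g \<in> Hom C B D" "g' \<in> Hom C D B" "g' \<cdot>\<^bsub>C\<^esub> g = Ide C B" "g \<cdot>\<^bsub>C\<^esub> g' = Ide C D"
    using g by (rule iso_homE)
  have gf: "g \<cdot>\<^bsub>C\<^esub> f \<in> Hom C A D" and fg': "f' \<cdot>\<^bsub>C\<^esub> g' \<in> Hom C D A"
    using f' g' by (blast intro: Cmp_in_Hom)+
  have "(f' \<cdot>\<^bsub>C\<^esub> g') \<cdot>\<^bsub>C\<^esub> (g \<cdot>\<^bsub>C\<^esub> f) = f' \<cdot>\<^bsub>C\<^esub> ((g' \<cdot>\<^bsub>C\<^esub> g) \<cdot>\<^bsub>C\<^esub> f)"
    using Cmp_assoc[OF gf g'(2) f'(2)] Cmp_assoc[OF f'(1) g'(1,2)] by simp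
  moreover have "(g \<cdot>\<^bsub>C\<^esub> f) \<cdot>\<^bsub>C\<^esub> (f' \<cdot>\<^bsub>C\<^esub> g') = g \<cdot>\<^bsub>C\<^esub> ((f \<cdot>\<^bsub>C\<^esub> f') \<cdot>\<^bsub>C\<^esub> g')"
    using Cmp_assoc[OF fg' f'(1) g'(1)] Cmp_assoc[OF g'(2) f'(2,1)] by simp
  ultimately show ?thesis
    using f' g' Ide_Cmp[OF f'(1)] Ide_Cmp[OF g'(2)] by (intro iso_homI[OF gf fg']) simp_all
qed

text \<open>The tensor of \<open>endo_mon\<close> reverses the arguments of composition, so its
  associator is an inverse of \<open>Assoc\<close>; in the strict case that inverse has to be
  recognised as an identity. It is unique because every inverse \<open>g\<close> satisfies
  \<open>g = g \<cdot> Ide C A = Ide C A\<close>.\<close>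

lemma inv_ar_Ide:
  assumes "A \<in> Ob C"
  shows "inv_ar C (Ide C A) = Ide C A"
proof -
  have i: "Ide C A \<in> Hom C A A" using assms by (rule Ide_in_Hom)
  then have dc: "Dom C (Ide C A) = A" "Cod C (Ide C A) = A"
    by (simp_all add: Hom_def)
  show ?thesis
    unfolding inv_ar_def is_inverse_def dc
    using i Cmp_Ide[OF i] by (intro the_equality) (auto dest: Cmp_Ide)
qed

end

lemma is_functorI:
  assumes "category C" "category D"
    and "\<And>A. A \<in> Ob C \<Longrightarrow> FO F A \<in> Ob D"
    and "\<And>f. f \<in> Ar C \<Longrightarrow> FA F f \<in> Hom D (FO F (Dom C f)) (FO F (Cod C f))"
    and "\<And>A. A \<in> Ob C \<Longrightarrow> FA F (Ide C A) = Ide D (FO F A)"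
    and "\<And>f g. f \<in> Ar C \<Longrightarrow> g \<in> Ar C \<Longrightarrow> Cod C f = Dom C g \<Longrightarrow>
           FA F (g \<cdot>\<^bsub>C\<^esub> f) = FA F g \<cdot>\<^bsub>D\<^esub> FA F f"
  shows "is_functor C D F"
  unfolding is_functor_def by (intro conjI ballI impI assms)

context
  fixes C :: "('o, 'a) cat" and D :: "('p, 'b) cat" and F :: "('o, 'a, 'p, 'b) func"
  assumes F: "is_functor C D F"
begin

lemma functor_dom: "category C" and functor_cod: "category D"
  using F by (simp_all add: is_functor_def)

lemma functor_Ob: "A \<in> Ob C \<Longrightarrow> FO F A \<in> Ob D"
  using F by (simp add: is_functor_def)

lemma functor_Hom: "f \<in> Hom C A B \<Longrightarrow> FA F f \<in> Hom D (FO F A) (FO F B)"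
  using F by (auto simp: is_functor_def Hom_def)

lemma functor_Ide: "A \<in> Ob C \<Longrightarrow> FA F (Ide C A) = Ide D (FO F A)"
  using F by (simp add: is_functor_def)

lemma functor_Cmp:
  "f \<in> Hom C A B \<Longrightarrow> g \<in> Hom C B E \<Longrightarrow> FA F (g \<cdot>\<^bsub>C\<^esub> f) = FA F g \<cdot>\<^bsub>D\<^esub> FA F f"
  using F by (auto simp: is_functor_def Hom_def)

lemma functor_iso:
  assumes "f \<in> iso_hom C A B"
  shows "FA F f \<in> iso_hom D (FO F A) (FO F B)"
proof -
  obtain g where "f \<in> Hom C A B" "g \<in> Hom C B A" "g \<cdot>\<^bsub>C\<^esub> f = Ide C A" "f \<cdot>\<^bsub>C\<^esub> g = Ide C B"
    using assms iso_homE[OF functor_dom] by metis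
  then show ?thesis
    by (metis functor_Hom functor_Cmp functor_Ide Hom_Ob functor_dom functor_cod iso_homI)
qed

end

section \<open>Product categories and functors of two variables\<close>

lemma category_prod_cat:
  assumes "category C" "category D"
  shows "category (prod_cat C D)"
  using assms by (auto simp: category_def prod_cat_def Hom_def)

lemma prod_cat_Hom:
  "(f, g) \<in> Hom (prod_cat C D) (A, A') (B, B') \<longleftrightarrow> f \<in> Hom C A B \<and> g \<in> Hom D A' B'"
  by (auto simp: prod_cat_def Hom_def)

lemma prod_cat_simps [simp]:
  "Ob (prod_cat C D) = Ob C \<times> Ob D" "Ar (prod_cat C D) = Ar C \<times> Ar D"
  "Dom (prod_cat C D) (f, g) = (Dom C f, Dom D g)" "Cod (prod_cat C D) (f, g) = (Cod C f, Cod D g)"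
  "Ide (prod_cat C D) (A, B) = (Ide C A, Ide D B)"
  "(f', g') \<cdot>\<^bsub>prod_cat C D\<^esub> (f, g) = (f' \<cdot>\<^bsub>C\<^esub> f, g' \<cdot>\<^bsub>D\<^esub> g)"
  by (simp_all add: prod_cat_def)

context
  fixes C :: "('o, 'a) cat" and D :: "('p, 'b) cat" and E :: "('q, 'c) cat" and T
  assumes T: "is_functor (prod_cat C D) E T"
begin

lemma bifunctor_Ob: "A \<in> Ob C \<Longrightarrow> B \<in> Ob D \<Longrightarrow> FO T (A, B) \<in> Ob E"
  using functor_Ob[OF T] by simp

lemma bifunctor_Hom:
  "f \<in> Hom C A B \<Longrightarrow> g \<in> Hom D A' B' \<Longrightarrow> FA T (f, g) \<in> Hom E (FO T (A, A')) (FO T (B, B'))"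
  using functor_Hom[OF T] by (simp add: prod_cat_Hom)

lemma bifunctor_Ide:
  "A \<in> Ob C \<Longrightarrow> B \<in> Ob D \<Longrightarrow> FA T (Ide C A, Ide D B) = Ide E (FO T (A, B))"
  using functor_Ide[OF T, of "(A, B)"] by simp

text \<open>The interchange law, which is what functoriality of horizontal composition amounts
  to.\<close>

lemma bifunctor_Cmp:
  "f \<in> Hom C X Y \<Longrightarrow> f' \<in> Hom C Y Z \<Longrightarrow> g \<in> Hom D X' Y' \<Longrightarrow> g' \<in> Hom D Y' Z' \<Longrightarrow>
     FA T (f' \<cdot>\<^bsub>C\<^esub> f, g' \<cdot>\<^bsub>D\<^esub> g) = FA T (f', g') \<cdot>\<^bsub>E\<^esub> FA T (f, g)"
  using functor_Cmp[OF T, of "(f, g)" "(X, X')" "(Y, Y')" "(f', g')" "(Z, Z')"]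
  by (simp add: prod_cat_Hom)

end

section \<open>Composition of functors and the category of small categories\<close>

lemma func_eqI: "FO F = FO G \<Longrightarrow> FA F = FA G \<Longrightarrow> F = (G :: ('o, 'a, 'p, 'b) func)"
  by (cases F, cases G) simp

lemma is_functor_id_func:
  assumes "category C"
  shows "is_functor C C (id_func C)"
  using assms Cmp_in_Hom[OF assms] Ide_in_Hom[OF assms]
  by (auto intro!: is_functorI simp: id_func_def Hom_def restrict_def category_def)

lemma is_functor_comp_func:
  assumes F: "is_functor C D F" and G: "is_functor D E G"
  shows "is_functor C E (comp_func C G F)"
proof (rule is_functorI)
  fix A assume A: "A \<in> Ob C"
  then have "Ide C A \<in> Ar C"
    using Ide_in_Hom[OF functor_dom[OF F]] by (simp add: Hom_def)
  then show "FA (comp_func C G F) (Ide C A) = Ide E (FO (comp_func C G F) A)"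
    using A by (simp add: comp_func_def compose_def functor_Ide[OF F] functor_Ide[OF G] functor_Ob[OF F])
next
  fix f assume f: "f \<in> Ar C"
  then have "Dom C f \<in> Ob C" "Cod C f \<in> Ob C"
    using Hom_Ob[OF functor_dom[OF F] Ar_in_Hom] by auto
  then show "FA (comp_func C G F) f
      \<in> Hom E (FO (comp_func C G F) (Dom C f)) (FO (comp_func C G F) (Cod C f))"
    using functor_Hom[OF G functor_Hom[OF F Ar_in_Hom[OF f]]] f
    by (simp add: comp_func_def compose_def)
next
  fix f g assume fg: "f \<in> Ar C" "g \<in> Ar C" "Cod C f = Dom C g"
  have h: "f \<in> Hom C (Dom C f) (Cod C f)" "g \<in> Hom C (Cod C f) (Cod C g)"
    using fg by (auto simp: Hom_def)
  have "g \<cdot>\<^bsub>C\<^esub> f \<in> Ar C"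
    using Cmp_in_Hom[OF functor_dom[OF F] h] by (simp add: Hom_def)
  then show "FA (comp_func C G F) (g \<cdot>\<^bsub>C\<^esub> f) = FA (comp_func C G F) g \<cdot>\<^bsub>E\<^esub> FA (comp_func C G F) f"
    using fg by (simp add: comp_func_def compose_def functor_Cmp[OF F h]
        functor_Cmp[OF G functor_Hom[OF F h(1)] functor_Hom[OF F h(2)]])
qed (use F G in \<open>auto simp: functor_dom functor_cod comp_func_def compose_def intro: functor_Ob\<close>)

lemma ext_func_id_func: "ext_func C (id_func C)"
  by (simp add: ext_func_def id_func_def)

lemma ext_func_comp_func: "ext_func C (comp_func C G F)"
  by (simp add: ext_func_def comp_func_def)

text \<open>The composite is restricted to \<open>C\<close>, and restriction changes nothing because
  \<open>F\<close> is already \<open>undefined\<close> outside \<open>C\<close>. Here extensionality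
  turns agreement on \<open>C\<close> into equality of records.\<close>

lemma comp_func_id_right: "ext_func C F \<Longrightarrow> comp_func C F (id_func C) = F"
  by (intro func_eqI ext) (auto simp: comp_func_def id_func_def ext_func_def compose_def extensional_def)

lemma comp_func_id_left:
  assumes "is_functor C D F" "ext_func C F"
  shows "comp_func C (id_func D) F = F"
  using assms functor_Ob[OF assms(1)] functor_Hom[OF assms(1) Ar_in_Hom]
  by (intro func_eqI ext) (auto simp: comp_func_def id_func_def ext_func_def compose_def extensional_def Hom_def)

text \<open>On the left the inner composite is restricted to \<open>D\<close>. Since
  \<open>F\<close> takes its values in \<open>D\<close>, this restriction is never felt.\<close>

lemma comp_func_assoc:
  assumes "is_functor C D F"
  shows "comp_func C (comp_func D H G) F = comp_func C H (comp_func C G F)"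
  using functor_Ob[OF assms] functor_Hom[OF assms Ar_in_Hom]
  by (intro func_eqI ext) (auto simp: comp_func_def compose_def Hom_def)

lemma category_Cat: "category (Cat :: (('o, 'a) cat, _) cat)"
proof -
  have 1: "is_functor C D F \<Longrightarrow> category C" "is_functor C D F \<Longrightarrow> category D" for C D :: "('o, 'a) cat" and F
    by (simp_all add: functor_dom functor_cod)
  show ?thesis
    by (rule categoryI)
      (auto simp: Cat_def Hom_def is_functor_id_func is_functor_comp_func ext_func_id_func
        ext_func_comp_func comp_func_id_right comp_func_id_left comp_func_assoc 1)
qed

section \<open>Strict 2-categories and strict monoidal structures\<close>

context
  fixes B :: "('o, 'f, 't) bicat"
  assumes B: "bicategory B"
begin

lemma bicategory_Hcat: "X \<in> Obj B \<Longrightarrow> Y \<in> Obj B \<Longrightarrow> category (Hcat B X Y)"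
  using B unfolding bicategory_def by (elim conjE) simp

lemma bicategory_Unit1: "X \<in> Obj B \<Longrightarrow> Unit1 B X \<in> Ob (Hcat B X X)"
  using B unfolding bicategory_def by (elim conjE) simp

lemma bicategory_HComp:
  "X \<in> Obj B \<Longrightarrow> Y \<in> Obj B \<Longrightarrow> Z \<in> Obj B \<Longrightarrow>
     is_functor (prod_cat (Hcat B Y Z) (Hcat B X Y)) (Hcat B X Z) (HComp B X Y Z)"
  using B unfolding bicategory_def by (elim conjE) simp

lemma bicategory_Assoc:
  "X \<in> Obj B \<Longrightarrow> Y \<in> Obj B \<Longrightarrow> Z \<in> Obj B \<Longrightarrow> W \<in> Obj B \<Longrightarrow>
     h \<in> Ob (Hcat B Z W) \<Longrightarrow> g \<in> Ob (Hcat B Y Z) \<Longrightarrow> f \<in> Ob (Hcat B X Y) \<Longrightarrow>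
     Assoc B X Y Z W h g f \<in> iso_hom (Hcat B X W)
       (comp1 B X Y W (comp1 B Y Z W h g) f) (comp1 B X Z W h (comp1 B X Y Z g f))"
  using B unfolding bicategory_def by (elim conjE) simp

text \<open>The endpoints are variables instead of \<open>Dom\<close> and \<open>Cod\<close> terms,
  so that facts about \<open>Hom\<close> sets can be plugged in and no endpoint has to be rewritten
  afterwards.\<close>

lemma bicategory_Assoc_natural:
  "X \<in> Obj B \<Longrightarrow> Y \<in> Obj B \<Longrightarrow> Z \<in> Obj B \<Longrightarrow> W \<in> Obj B \<Longrightarrow>
     \<rho> \<in> Hom (Hcat B Z W) h h' \<Longrightarrow> \<tau> \<in> Hom (Hcat B Y Z) g g' \<Longrightarrow> \<sigma> \<in> Hom (Hcat B X Y) f f' \<Longrightarrow>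
     Assoc B X Y Z W h' g' f' \<cdot>\<^bsub>Hcat B X W\<^esub> comp2 B X Y W (comp2 B Y Z W \<rho> \<tau>) \<sigma>
     = comp2 B X Z W \<rho> (comp2 B X Y Z \<tau> \<sigma>) \<cdot>\<^bsub>Hcat B X W\<^esub> Assoc B X Y Z W h g f"
  using B unfolding bicategory_def Hom_def by (elim conjE) auto

lemma bicategory_LUn:
  "X \<in> Obj B \<Longrightarrow> Y \<in> Obj B \<Longrightarrow> f \<in> Ob (Hcat B X Y) \<Longrightarrow>
     LUn B X Y f \<in> iso_hom (Hcat B X Y) (comp1 B X Y Y (Unit1 B Y) f) f"
  using B unfolding bicategory_def by (elim conjE) simp

lemma bicategory_RUn:
  "X \<in> Obj B \<Longrightarrow> Y \<in> Obj B \<Longrightarrow> f \<in> Ob (Hcat B X Y) \<Longrightarrow>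
     RUn B X Y f \<in> iso_hom (Hcat B X Y) (comp1 B X X Y f (Unit1 B X)) f"
  using B unfolding bicategory_def by (elim conjE) simp

lemma bicategory_LUn_natural:
  "X \<in> Obj B \<Longrightarrow> Y \<in> Obj B \<Longrightarrow> \<sigma> \<in> Hom (Hcat B X Y) f f' \<Longrightarrow>
     LUn B X Y f' \<cdot>\<^bsub>Hcat B X Y\<^esub> comp2 B X Y Y (Ide (Hcat B Y Y) (Unit1 B Y)) \<sigma>
     = \<sigma> \<cdot>\<^bsub>Hcat B X Y\<^esub> LUn B X Y f"
  using B unfolding bicategory_def Hom_def by (elim conjE) auto

lemma bicategory_RUn_natural:
  "X \<in> Obj B \<Longrightarrow> Y \<in> Obj B \<Longrightarrow> \<sigma> \<in> Hom (Hcat B X Y) f f' \<Longrightarrow>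
     RUn B X Y f' \<cdot>\<^bsub>Hcat B X Y\<^esub> comp2 B X X Y \<sigma> (Ide (Hcat B X X) (Unit1 B X))
     = \<sigma> \<cdot>\<^bsub>Hcat B X Y\<^esub> RUn B X Y f"
  using B unfolding bicategory_def Hom_def by (elim conjE) auto

end

section \<open>Criteria for strict structures\<close>

lemma strict_2categoryI:
  fixes B :: "('o, 'f, 't) bicat"
  assumes K: "\<And>X Y. X \<in> Obj B \<Longrightarrow> Y \<in> Obj B \<Longrightarrow> category (Hcat B X Y)"
    and I: "\<And>X. X \<in> Obj B \<Longrightarrow> Unit1 B X \<in> Ob (Hcat B X X)"
    and T: "\<And>X Y Z. X \<in> Obj B \<Longrightarrow> Y \<in> Obj B \<Longrightarrow> Z \<in> Obj B \<Longrightarrow>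
      is_functor (prod_cat (Hcat B Y Z) (Hcat B X Y)) (Hcat B X Z) (HComp B X Y Z)"
    and assoc1: "\<And>X Y Z W h g f. X \<in> Obj B \<Longrightarrow> Y \<in> Obj B \<Longrightarrow> Z \<in> Obj B \<Longrightarrow> W \<in> Obj B \<Longrightarrow>
      h \<in> Ob (Hcat B Z W) \<Longrightarrow> g \<in> Ob (Hcat B Y Z) \<Longrightarrow> f \<in> Ob (Hcat B X Y) \<Longrightarrow>
      comp1 B X Y W (comp1 B Y Z W h g) f = comp1 B X Z W h (comp1 B X Y Z g f)"
    and assoc2: "\<And>X Y Z W \<rho> \<tau> \<sigma>. X \<in> Obj B \<Longrightarrow> Y \<in> Obj B \<Longrightarrow> Z \<in> Obj B \<Longrightarrow> W \<in> Obj B \<Longrightarrow>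
      \<rho> \<in> Ar (Hcat B Z W) \<Longrightarrow> \<tau> \<in> Ar (Hcat B Y Z) \<Longrightarrow> \<sigma> \<in> Ar (Hcat B X Y) \<Longrightarrow>
      comp2 B X Y W (comp2 B Y Z W \<rho> \<tau>) \<sigma> = comp2 B X Z W \<rho> (comp2 B X Y Z \<tau> \<sigma>)"
    and Assoc: "\<And>X Y Z W h g f. X \<in> Obj B \<Longrightarrow> Y \<in> Obj B \<Longrightarrow> Z \<in> Obj B \<Longrightarrow> W \<in> Obj B \<Longrightarrow>
      h \<in> Ob (Hcat B Z W) \<Longrightarrow> g \<in> Ob (Hcat B Y Z) \<Longrightarrow> f \<in> Ob (Hcat B X Y) \<Longrightarrow>
      Assoc B X Y Z W h g f = Ide (Hcat B X W) (comp1 B X Z W h (comp1 B X Y Z g f))"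
    and un1: "\<And>X Y f. X \<in> Obj B \<Longrightarrow> Y \<in> Obj B \<Longrightarrow> f \<in> Ob (Hcat B X Y) \<Longrightarrow>
      comp1 B X Y Y (Unit1 B Y) f = f \<and> comp1 B X X Y f (Unit1 B X) = f"
    and un2: "\<And>X Y \<sigma>. X \<in> Obj B \<Longrightarrow> Y \<in> Obj B \<Longrightarrow> \<sigma> \<in> Ar (Hcat B X Y) \<Longrightarrow>
      comp2 B X Y Y (Ide (Hcat B Y Y) (Unit1 B Y)) \<sigma> = \<sigma> \<and>
      comp2 B X X Y \<sigma> (Ide (Hcat B X X) (Unit1 B X)) = \<sigma>"
    and Un: "\<And>X Y f. X \<in> Obj B \<Longrightarrow> Y \<in> Obj B \<Longrightarrow> f \<in> Ob (Hcat B X Y) \<Longrightarrow>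
      LUn B X Y f = Ide (Hcat B X Y) f \<and> RUn B X Y f = Ide (Hcat B X Y) f"
  shows "strict_2category B"
proof -
  note T1 = bifunctor_Ob[OF T]
  note Ti = bifunctor_Ide[OF T]
  have T2: "comp2 B X Y Z \<tau> \<sigma> \<in> Hom (Hcat B X Z)
      (comp1 B X Y Z (Dom (Hcat B Y Z) \<tau>) (Dom (Hcat B X Y) \<sigma>))
      (comp1 B X Y Z (Cod (Hcat B Y Z) \<tau>) (Cod (Hcat B X Y) \<sigma>))"
    if "X \<in> Obj B" "Y \<in> Obj B" "Z \<in> Obj B" "\<tau> \<in> Ar (Hcat B Y Z)" "\<sigma> \<in> Ar (Hcat B X Y)"
    for X Y Z \<tau> \<sigma>
    using that by (intro bifunctor_Hom[OF T] Ar_in_Hom)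
  have dom: "Dom (Hcat B X Y) \<sigma> \<in> Ob (Hcat B X Y)" "Cod (Hcat B X Y) \<sigma> \<in> Ob (Hcat B X Y)"
    if "X \<in> Obj B" "Y \<in> Obj B" "\<sigma> \<in> Ar (Hcat B X Y)" for X Y \<sigma>
    using Hom_Ob[OF K Ar_in_Hom] that by blast+
  have ide: "Ide (Hcat B X Y) f \<cdot>\<^bsub>Hcat B X Y\<^esub> Ide (Hcat B X Y) f = Ide (Hcat B X Y) f"
    if "X \<in> Obj B" "Y \<in> Obj B" "f \<in> Ob (Hcat B X Y)" for X Y f
    using that by (metis K Ide_in_Hom Cmp_Ide)
  \<comment> \<open>Naturality of an identity associator says that the two bracketings of three
    2-cells coincide, once the identities on either side have been absorbed. This is where
    \<open>assoc2\<close> enters.\<close>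
  have nat: "Ide (Hcat B X W) (comp1 B X Z W (Cod (Hcat B Z W) \<rho>)
             (comp1 B X Y Z (Cod (Hcat B Y Z) \<tau>) (Cod (Hcat B X Y) \<sigma>)))
      \<cdot>\<^bsub>Hcat B X W\<^esub> comp2 B X Y W (comp2 B Y Z W \<rho> \<tau>) \<sigma>
    = comp2 B X Z W \<rho> (comp2 B X Y Z \<tau> \<sigma>) \<cdot>\<^bsub>Hcat B X W\<^esub>
      Ide (Hcat B X W) (comp1 B X Z W (Dom (Hcat B Z W) \<rho>)
             (comp1 B X Y Z (Dom (Hcat B Y Z) \<tau>) (Dom (Hcat B X Y) \<sigma>)))"
    if XW: "X \<in> Obj B" "Y \<in> Obj B" "Z \<in> Obj B" "W \<in> Obj B"
      and ar: "\<rho> \<in> Ar (Hcat B Z W)" "\<tau> \<in> Ar (Hcat B Y Z)" "\<sigma> \<in> Ar (Hcat B X Y)"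
    for X Y Z W \<rho> \<tau> \<sigma>
  proof -
    have "comp2 B X Z W \<rho> (comp2 B X Y Z \<tau> \<sigma>) \<in> Hom (Hcat B X W)
        (comp1 B X Z W (Dom (Hcat B Z W) \<rho>) (comp1 B X Y Z (Dom (Hcat B Y Z) \<tau>) (Dom (Hcat B X Y) \<sigma>)))
        (comp1 B X Z W (Cod (Hcat B Z W) \<rho>) (comp1 B X Y Z (Cod (Hcat B Y Z) \<tau>) (Cod (Hcat B X Y) \<sigma>)))"
      using XW ar T2 by (intro bifunctor_Hom[OF T] Ar_in_Hom) auto
    from Cmp_Ide[OF K this] Ide_Cmp[OF K this] show ?thesis
      using XW ar by (simp add: assoc2)
  qed
  have "bicategory B"
    unfolding bicategory_def
  proof (intro conjI ballI, goal_cases)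
    \<comment> \<open>Goals 5, 8 and 9 are the naturality conditions, the coherence conditions that
      involve arbitrary 2-cells. Pentagon and triangle only compare products of identities.\<close>
    case (5 X Y Z W \<rho> \<tau> \<sigma>)
    then show ?case using nat by (simp add: Assoc dom)
  next
    case (8 X Y \<sigma>)
    then show ?case
      using Ide_Cmp[OF K Ar_in_Hom] Cmp_Ide[OF K Ar_in_Hom] by (simp add: Un un2 dom)
  next
    case (9 X Y \<sigma>)
    then show ?case
      using Ide_Cmp[OF K Ar_in_Hom] Cmp_Ide[OF K Ar_in_Hom] by (simp add: Un un2 dom)
  qed (simp_all add: K I T T1 Ti Assoc assoc1 Un un1 ide Ide_iso)
  then show ?thesis
    by (simp add: strict_2category_def Assoc assoc1 Un un1)
qed

text \<open>The analogue of \<open>strict_2categoryI\<close> with a single object, for the separate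
  record type \<open>moncat\<close>. The argument is the same: naturality is \<open>assoc2\<close>
  and \<open>un2\<close>, the rest are identities.\<close>

lemma strict_monoidal_categoryI:
  fixes M :: "('o, 'a) moncat"
  defines "K \<equiv> MCat M" and "I \<equiv> MUnit M"
  assumes T: "is_functor (prod_cat K K) K (Tens M)"
    and I: "I \<in> Ob K"
    and assoc1: "\<And>x y z. x \<in> Ob K \<Longrightarrow> y \<in> Ob K \<Longrightarrow> z \<in> Ob K \<Longrightarrow>
      tenO M (tenO M x y) z = tenO M x (tenO M y z)"
    and assoc2: "\<And>f g h. f \<in> Ar K \<Longrightarrow> g \<in> Ar K \<Longrightarrow> h \<in> Ar K \<Longrightarrow>
      tenA M (tenA M f g) h = tenA M f (tenA M g h)"
    and un1: "\<And>x. x \<in> Ob K \<Longrightarrow> tenO M I x = x \<and> tenO M x I = x"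
    and un2: "\<And>f. f \<in> Ar K \<Longrightarrow> tenA M (Ide K I) f = f \<and> tenA M f (Ide K I) = f"
    and Assoc: "\<And>x y z. x \<in> Ob K \<Longrightarrow> y \<in> Ob K \<Longrightarrow> z \<in> Ob K \<Longrightarrow>
      MAssoc M x y z = Ide K (tenO M x (tenO M y z))"
    and Un: "\<And>x. x \<in> Ob K \<Longrightarrow> MLUn M x = Ide K x \<and> MRUn M x = Ide K x"
  shows "monoidal_category M"
proof -
  have K: "category K" using T by (rule functor_cod)
  note T1 = bifunctor_Ob[OF T] and Ti = bifunctor_Ide[OF T]
  have dom: "Dom K f \<in> Ob K" "Cod K f \<in> Ob K" if "f \<in> Ar K" for f
    using Hom_Ob[OF K Ar_in_Hom] that by blast+
  have ide: "Ide K x \<cdot>\<^bsub>K\<^esub> Ide K x = Ide K x" if "x \<in> Ob K" for x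
    using that by (metis K Ide_in_Hom Cmp_Ide)
  have nat: "Ide K (tenO M (Cod K f) (tenO M (Cod K g) (Cod K h))) \<cdot>\<^bsub>K\<^esub> tenA M (tenA M f g) h
      = tenA M f (tenA M g h) \<cdot>\<^bsub>K\<^esub> Ide K (tenO M (Dom K f) (tenO M (Dom K g) (Dom K h)))"
    if ar: "f \<in> Ar K" "g \<in> Ar K" "h \<in> Ar K" for f g h
  proof -
    have "tenA M f (tenA M g h) \<in> Hom K (tenO M (Dom K f) (tenO M (Dom K g) (Dom K h)))
        (tenO M (Cod K f) (tenO M (Cod K g) (Cod K h)))"
      using ar by (intro bifunctor_Hom[OF T] Ar_in_Hom)
    from Cmp_Ide[OF K this] Ide_Cmp[OF K this] show ?thesis
      using ar by (simp add: assoc2)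
  qed
  show ?thesis
    unfolding monoidal_category_def Let_def K_def[symmetric] I_def[symmetric]
    using T I K Ide_Cmp[OF K Ar_in_Hom] Cmp_Ide[OF K Ar_in_Hom] nat
    by (auto simp: T1 Ti Assoc assoc1 Un un1 un2 ide Ide_iso dom)
qed

text \<open>The structure isomorphisms are chosen to be identities. By \<open>ten1\<close> and
  \<open>unit\<close> they have the right codomain, by \<open>ten2\<close> they are natural, and the
  coherence equations reduce to preservation of associators and unit isomorphisms.\<close>

lemma strict_monoidal_functorI:
  fixes M :: "('o, 'a) moncat" and N :: "('p, 'b) moncat"
  defines "K \<equiv> MCat M" and "L \<equiv> MCat N"
  assumes M: "monoidal_category M" and N: "monoidal_category N" and F: "is_functor K L F"
    and ten1: "\<And>x y. x \<in> Ob K \<Longrightarrow> y \<in> Ob K \<Longrightarrow>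
      FO F (tenO M x y) = tenO N (FO F x) (FO F y)"
    and ten2: "\<And>f g. f \<in> Ar K \<Longrightarrow> g \<in> Ar K \<Longrightarrow> FA F (tenA M f g) = tenA N (FA F f) (FA F g)"
    and unit: "FO F (MUnit M) = MUnit N"
    and Assoc: "\<And>x y z. x \<in> Ob K \<Longrightarrow> y \<in> Ob K \<Longrightarrow> z \<in> Ob K \<Longrightarrow>
      FA F (MAssoc M x y z) = MAssoc N (FO F x) (FO F y) (FO F z)"
    and Un: "\<And>x. x \<in> Ob K \<Longrightarrow> FA F (MLUn M x) = MLUn N (FO F x) \<and> FA F (MRUn M x) = MRUn N (FO F x)"
  shows "is_monoidal_functor M N F"
proof -
  have L: "category L" using F by (rule functor_cod)
  have S: "is_functor (prod_cat K K) K (Tens M)" and I: "MUnit M \<in> Ob K"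
    using M by (simp_all add: monoidal_category_def Let_def K_def)
  have T: "is_functor (prod_cat L L) L (Tens N)" and J: "MUnit N \<in> Ob L"
    and a: "\<And>x y z. x \<in> Ob L \<Longrightarrow> y \<in> Ob L \<Longrightarrow> z \<in> Ob L \<Longrightarrow>
        MAssoc N x y z \<in> Hom L (tenO N (tenO N x y) z) (tenO N x (tenO N y z))"
    and l: "\<And>x. x \<in> Ob L \<Longrightarrow> MLUn N x \<in> Hom L (tenO N (MUnit N) x) x"
    and r: "\<And>x. x \<in> Ob L \<Longrightarrow> MRUn N x \<in> Hom L (tenO N x (MUnit N)) x"
    using N by (simp_all add: monoidal_category_def Let_def L_def iso_hom_def)
  note S1 = bifunctor_Ob[OF S] and T1 = bifunctor_Ob[OF T] and Ti = bifunctor_Ide[OF T]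
  note F1 = functor_Ob[OF F]
  have ide: "Ide L x \<cdot>\<^bsub>L\<^esub> Ide L x = Ide L x" if "x \<in> Ob L" for x
    using that by (metis L Ide_in_Hom Cmp_Ide)
  have dom: "Dom K f \<in> Ob K" "Cod K f \<in> Ob K" if "f \<in> Ar K" for f
    using Hom_Ob[OF functor_dom[OF F] Ar_in_Hom] that by blast+
  have nat: "Ide L (tenO N (FO F (Cod K f)) (FO F (Cod K g))) \<cdot>\<^bsub>L\<^esub> tenA N (FA F f) (FA F g)
      = tenA N (FA F f) (FA F g) \<cdot>\<^bsub>L\<^esub> Ide L (tenO N (FO F (Dom K f)) (FO F (Dom K g)))"
    if "f \<in> Ar K" "g \<in> Ar K" for f g
  proof -
    have "tenA N (FA F f) (FA F g) \<in> Hom L (tenO N (FO F (Dom K f)) (FO F (Dom K g)))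
       (tenO N (FO F (Cod K f)) (FO F (Cod K g)))"
      using that by (intro bifunctor_Hom[OF T] functor_Hom[OF F] Ar_in_Hom)
    from Cmp_Ide[OF L this] Ide_Cmp[OF L this] show ?thesis
      by simp
  qed
  have "monoidal_functor M N F (\<lambda>x y. Ide L (tenO N (FO F x) (FO F y))) (Ide L (MUnit N))"
    unfolding monoidal_functor_def Let_def K_def[symmetric] L_def[symmetric]
    using M N F nat I J
    by (auto simp: ten1 ten2 unit Assoc Un Ti ide S1 T1 F1 L dom Ide_iso
        Cmp_Ide[OF L a] Ide_Cmp[OF L a] Cmp_Ide[OF L l] Cmp_Ide[OF L r])
  then show ?thesis
    unfolding is_monoidal_functor_def by blast
qed

text \<open>Strictness of \<open>B\<close> gives equations between 1-cells and identity structure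
  cells. The equations between 2-cells required by \<open>strict_monoidal_categoryI\<close> are
  extracted from the naturality of these identities.\<close>

lemma monoidal_category_endo_mon:
  assumes B: "strict_2category B" and X: "X \<in> Obj B"
  shows "monoidal_category (endo_mon B X)"
proof -
  let ?K = "Hcat B X X" and ?I = "Unit1 B X"
  have bi: "bicategory B"
    and s1: "\<And>f g h. h \<in> Ob ?K \<Longrightarrow> g \<in> Ob ?K \<Longrightarrow> f \<in> Ob ?K \<Longrightarrow>
        comp1 B X X X (comp1 B X X X h g) f = comp1 B X X X h (comp1 B X X X g f)"
    and s2: "\<And>f g h. h \<in> Ob ?K \<Longrightarrow> g \<in> Ob ?K \<Longrightarrow> f \<in> Ob ?K \<Longrightarrow>
        Assoc B X X X X h g f = Ide ?K (comp1 B X X X h (comp1 B X X X g f))"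
    and s3: "\<And>f. f \<in> Ob ?K \<Longrightarrow> comp1 B X X X ?I f = f"
    and s4: "\<And>f. f \<in> Ob ?K \<Longrightarrow> comp1 B X X X f ?I = f"
    and s5: "\<And>f. f \<in> Ob ?K \<Longrightarrow> LUn B X X f = Ide ?K f"
    and s6: "\<And>f. f \<in> Ob ?K \<Longrightarrow> RUn B X X f = Ide ?K f"
    using B X unfolding strict_2category_def by blast+
  have K: "category ?K" and I: "?I \<in> Ob ?K"
    using bicategory_Hcat[OF bi X X] bicategory_Unit1[OF bi X] .
  note T = bicategory_HComp[OF bi X X X]
  note T1 = bifunctor_Ob[OF T] and T2 = bifunctor_Hom[OF T]
  have dom: "Dom ?K f \<in> Ob ?K" "Cod ?K f \<in> Ob ?K" if "f \<in> Ar ?K" for f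
    using Hom_Ob[OF K Ar_in_Hom] that by blast+
  have assoc2: "comp2 B X X X (comp2 B X X X \<rho> \<tau>) \<sigma> = comp2 B X X X \<rho> (comp2 B X X X \<tau> \<sigma>)"
    if ar: "\<rho> \<in> Ar ?K" "\<tau> \<in> Ar ?K" "\<sigma> \<in> Ar ?K" for \<rho> \<tau> \<sigma>
  proof -
    note h = ar[THEN Ar_in_Hom]
    note n = bicategory_Assoc_natural[OF bi X X X X h]
    show ?thesis
      using n Ide_Cmp[OF K T2[OF T2[OF h(1,2)] h(3)]] Cmp_Ide[OF K T2[OF h(1) T2[OF h(2,3)]]]
      by (simp add: s1 s2 dom ar)
  qed
  have un2: "comp2 B X X X (Ide ?K ?I) \<sigma> = \<sigma> \<and> comp2 B X X X \<sigma> (Ide ?K ?I) = \<sigma>"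
    if ar: "\<sigma> \<in> Ar ?K" for \<sigma>
  proof -
    note h = Ar_in_Hom[OF ar] and i = Ide_in_Hom[OF K I]
    show ?thesis
      using bicategory_LUn_natural[OF bi X X h] bicategory_RUn_natural[OF bi X X h]
        Ide_Cmp[OF K T2[OF i h]] Ide_Cmp[OF K T2[OF h i]] Cmp_Ide[OF K h]
      by (simp add: s3 s4 s5 s6 dom ar)
  qed
  \<comment> \<open>The reversed tensor is again a functor because the interchange law is symmetric
    in the two factors.\<close>
  have fu: "is_functor (prod_cat ?K ?K) ?K
      \<lparr>FO = \<lambda>(s, t). comp1 B X X X t s, FA = \<lambda>(\<sigma>, \<tau>). comp2 B X X X \<tau> \<sigma>\<rparr>"
    using category_prod_cat[OF K K] K T1 T2[OF Ar_in_Hom Ar_in_Hom]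
      bifunctor_Ide[OF T] bifunctor_Cmp[OF T Ar_in_Hom _ Ar_in_Hom]
    by (intro is_functorI) (auto simp: Hom_iff)
  show ?thesis
    by (rule strict_monoidal_categoryI)
      (simp_all add: endo_mon_def fu I s1 s2 s3 s4 s5 s6 assoc2 un2 T1 inv_ar_Ide[OF K])
qed

section \<open>Chains and cut points\<close>

definition cut :: "nat \<Rightarrow> (nat \<Rightarrow> nat) \<Rightarrow> nat \<Rightarrow> nat" where
  "cut n u j = card {i. i < n \<and> u i < j}"

text \<open>The segment is half open: it contains the arrows with index \<open>i\<close> such that
  \<open>a \<le> i\<close> and \<open>i < b\<close>. For \<open>a = b\<close> it is the identity of
  the vertex \<open>a\<close>, exactly what an empty fibre contributes to a chain.\<close>

definition seg :: "('o, 'a) cat \<Rightarrow> 'o \<Rightarrow> 'a list \<Rightarrow> nat \<Rightarrow> nat \<Rightarrow> 'a" where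
  "seg C A s a b = composite C (vertex C A s a) (map ((!) s) [a..<b])"

lemma vertex_0: "vertex C A s 0 = A"
  by (simp add: vertex_def)

lemma seg_same: "seg C A s a a = Ide C (vertex C A s a)"
  by (simp add: seg_def composite_def)

lemma seg_Suc: "a \<le> b \<Longrightarrow> seg C A s a (Suc b) = s ! b \<cdot>\<^bsub>C\<^esub> seg C A s a b"
  by (simp add: seg_def composite_def)

text \<open>Monotonicity of \<open>u\<close> makes \<open>{i. i < n \<and> u i < j}\<close> downward
  closed. This lemma then converts the cardinality used in \<open>chain_map\<close> into the
  endpoint of an interval.\<close>

lemma initial_segment:
  fixes S :: "nat set"
  assumes "finite S" and "\<And>i j. j \<in> S \<Longrightarrow> i < j \<Longrightarrow> i \<in> S"
  shows "S = {..<card S}"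
proof -
  \<comment> \<open>\<open>k\<close> is the least number outside \<open>S\<close>; there is one
    since \<open>S\<close> is finite.\<close>
  obtain k where k: "k \<notin> S" "\<And>i. i < k \<Longrightarrow> i \<in> S"
    using assms(1) infinite_UNIV_nat exists_least_iff[of "\<lambda>k. k \<notin> S"] by (metis UNIV_eq_I)
  then have "S = {..<k}"
    using assms(2) by (auto simp: not_less) (metis linorder_neqE_nat not_less)
  then show ?thesis by simp
qed

context
  fixes n m :: nat and u :: "nat \<Rightarrow> nat"
  assumes u: "mono_on {..<n} u" "\<And>i. i < n \<Longrightarrow> u i < m"
begin

lemma below_cut: "{i. i < n \<and> u i < j} = {..<cut n u j}"
proof -
  have "i < n \<and> u i < j" if "k < n \<and> u k < j" "i < k" for i k
    using that mono_onD[OF u(1), of i k] by auto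
  then show ?thesis
    unfolding cut_def by (intro initial_segment) auto
qed

text \<open>A Galois connection between \<open>u\<close> and \<open>cut n u\<close>. The facts
  \<open>cut_le\<close>, \<open>fibre_eq\<close> and \<open>cut_compose\<close> are read off from
  it.\<close>

lemma less_cut_iff: "i < cut n u j \<longleftrightarrow> i < n \<and> u i < j"
  using below_cut[of j] by blast

lemma cut_mono: "j \<le> k \<Longrightarrow> cut n u j \<le> cut n u k"
  unfolding cut_def by (intro card_mono) auto

lemma cut_le: "cut n u j \<le> n"
  using less_cut_iff[of n j] by (meson less_irrefl not_le)

lemma cut_0: "cut n u 0 = 0"
  by (simp add: cut_def)

lemma cut_top: "cut n u m = n"
proof -
  have "{i. i < n \<and> u i < m} = {..<n}" using u(2) by auto
  then show ?thesis by (simp add: cut_def)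
qed

text \<open>Both lists are sorted and distinct, so they agree as soon as their sets do. An index
  lies over \<open>j\<close> if it is below the cut point of \<open>Suc j\<close> but not below that
  of \<open>j\<close>.\<close>

lemma fibre_eq: "filter (\<lambda>i. u i = j) [0..<n] = [cut n u j..<cut n u (Suc j)]"
proof (rule sorted_distinct_set_unique)
  have "i < n \<and> u i = j \<longleftrightarrow> \<not> i < cut n u j \<and> i < cut n u (Suc j)" for i
    unfolding less_cut_iff by auto
  then have "{i. i < n \<and> u i = j} = {cut n u j..<cut n u (Suc j)}"
    by (simp only: set_eq_iff mem_Collect_eq atLeastLessThan_iff not_less) blast
  then show "set (filter (\<lambda>i. u i = j) [0..<n]) = set [cut n u j..<cut n u (Suc j)]"
    by simp
qed (simp_all add: sorted_filter[of id, simplified])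

lemma chain_map_eq_seg:
  "chain_map C A (n, u, m) s = map (\<lambda>j. seg C A s (cut n u j) (cut n u (Suc j))) [0..<m]"
proof -
  \<comment> \<open>The comprehension in \<open>chain_map\<close> is a \<open>concat\<close> of
    lists of length at most one.\<close>
  have "concat (map (\<lambda>i. if u i = j then [s ! i] else []) [0..<k]) = map ((!) s) (filter (\<lambda>i. u i = j) [0..<k])"
    for j k by (induction k) auto
  then show ?thesis
    by (simp add: chain_map_def seg_def cut_def[symmetric] fibre_eq)
qed

end

text \<open>Galois connections compose in the opposite order: \<open>v (u i) < j\<close> holds if
  and only if \<open>u i < cut m v j\<close>.\<close>

lemma cut_compose:
  assumes u: "mono_on {..<n} u" "\<And>i. i < n \<Longrightarrow> u i < m" and v: "mono_on {..<m} v" "\<And>i. i < m \<Longrightarrow> v i < k"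
  shows "cut n (compose {..<n} v u) j = cut n u (cut m v j)"
proof -
  have "{i. i < n \<and> compose {..<n} v u i < j} = {i. i < n \<and> u i < cut m v j}"
    using less_cut_iff[OF v] u(2) by (auto simp: compose_def)
  then show ?thesis by (simp add: cut_def)
qed

lemma cut_restrict_id: "cut n (restrict id {..<n}) j = min n j"
proof -
  have "{i. i < n \<and> restrict id {..<n} i < j} = {..<min n j}" by auto
  then show ?thesis by (simp add: cut_def)
qed

text \<open>The recursive definition consumes a chain from the left, whereas segments need access to
  arbitrary positions. Here each arrow is typed by the two vertices next to it.\<close>

lemma is_chain_iff:
  assumes C: "category C"
  shows "is_chain C A s B \<longleftrightarrow> A \<in> Ob C \<and> vertex C A s (length s) = B \<and>
    (\<forall>i<length s. s ! i \<in> Hom C (vertex C A s i) (vertex C A s (Suc i)))"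
proof (induction s arbitrary: A)
  case Nil
  then show ?case by (auto simp: vertex_def)
next
  case (Cons f s)
  \<comment> \<open>Dropping the first arrow shifts the vertices by one and makes
    \<open>Cod C f\<close> the new starting point.\<close>
  have v: "vertex C A (f # s) (Suc i) = vertex C (Cod C f) s i" for i
    by (cases i) (simp_all add: vertex_def)
  have "A \<in> Ob C" "Cod C f \<in> Ob C" if "f \<in> Hom C A (Cod C f)"
    using Hom_Ob[OF C that] by auto
  moreover have "vertex C A (f # s) 0 = A" "vertex C (Cod C f) s 0 = Cod C f"
    by (simp_all add: vertex_def)
  ultimately show ?case
    by (auto simp: Cons.IH All_less_Suc2 v Hom_iff)
qed

context
  fixes C :: "('o, 'a) cat" and A s B
  assumes C: "category C" and s: "is_chain C A s B"
begin

lemma chain_Hom: "i < length s \<Longrightarrow> s ! i \<in> Hom C (vertex C A s i) (vertex C A s (Suc i))"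
  using s is_chain_iff[OF C] by blast

lemma vertex_length: "vertex C A s (length s) = B"
  using s is_chain_iff[OF C] by blast

lemma vertex_Ob: "i \<le> length s \<Longrightarrow> vertex C A s i \<in> Ob C"
  using s is_chain_iff[OF C, of A s B] Hom_Ob[OF C chain_Hom[of "i - 1"]]
  by (cases i) (auto simp: vertex_0)

lemma seg_Hom:
  assumes "a \<le> b" "b \<le> length s"
  shows "seg C A s a b \<in> Hom C (vertex C A s a) (vertex C A s b)"
  using assms
proof (induction b rule: dec_induct)
  case base
  then show ?case by (simp add: seg_same Ide_in_Hom[OF C] vertex_Ob)
next
  case (step b)
  then show ?case by (simp add: seg_Suc) (rule Cmp_in_Hom[OF C _ chain_Hom], simp_all)
qed

lemma seg_one: "a < length s \<Longrightarrow> seg C A s a (Suc a) = s ! a"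
  by (simp add: seg_Suc seg_same Cmp_Ide[OF C chain_Hom])

text \<open>Induction on the right end: \<open>composite\<close> folds from the left, so a longer
  segment is obtained by one more composition on the outside.\<close>

lemma seg_Cmp:
  assumes "a \<le> b" "b \<le> c" "c \<le> length s"
  shows "seg C A s b c \<cdot>\<^bsub>C\<^esub> seg C A s a b = seg C A s a c"
  using assms(2,3)
proof (induction c rule: dec_induct)
  case base
  with assms(1) show ?case by (simp add: seg_same Ide_Cmp[OF C seg_Hom])
next
  case (step c)
  then have "seg C A s a b \<in> Hom C (vertex C A s a) (vertex C A s b)"
    "seg C A s b c \<in> Hom C (vertex C A s b) (vertex C A s c)"
    "s ! c \<in> Hom C (vertex C A s c) (vertex C A s (Suc c))"
    using assms(1) by (auto intro: seg_Hom chain_Hom)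
  from Cmp_assoc[OF C this] show ?case
    using step assms(1) by (simp add: seg_Suc)
qed

lemma length_chain_map: "length (chain_map C A (n, u, m) s) = m"
  by (simp add: chain_map_def)

context
  fixes u :: "nat \<Rightarrow> nat" and m :: nat and t
  assumes u: "mono_on {..<length s} u" "\<And>i. i < length s \<Longrightarrow> u i < m"
    and t: "t = chain_map C A (length s, u, m) s"
begin

lemma chain_map_nth: "j < m \<Longrightarrow> t ! j = seg C A s (cut (length s) u j) (cut (length s) u (Suc j))"
  by (simp add: t chain_map_eq_seg[OF u])

text \<open>A vertex other than the first is the codomain of the arrow before it, and that arrow is
  a segment of \<open>s\<close> ending at the cut point of \<open>j\<close>. If the segment is
  empty, it is an identity and still has this codomain.\<close>

lemma vertex_chain_map: "j \<le> m \<Longrightarrow> vertex C A t j = vertex C A s (cut (length s) u j)"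
proof (cases j)
  case 0
  then show ?thesis by (simp add: cut_0[OF u] vertex_0)
next
  case (Suc k)
  assume "j \<le> m"
  then have "t ! k \<in> Hom C (vertex C A s (cut (length s) u k)) (vertex C A s (cut (length s) u j))"
    using Suc by (simp add: chain_map_nth seg_Hom cut_mono[OF u] cut_le[OF u])
  then show ?thesis by (simp add: Suc vertex_def Hom_iff)
qed

text \<open>The new chain ends at \<open>B\<close> because \<open>cut_top\<close> places the last
  cut point at the end of \<open>s\<close>. The bound on \<open>u\<close> allows
  \<open>m = 0\<close> only when \<open>s\<close> is empty, and then \<open>A = B\<close>.\<close>

lemma is_chain_chain_map: "is_chain C A t B"
proof -
  have "A \<in> Ob C" using s is_chain_iff[OF C] by blast
  moreover have "length t = m" by (simp add: t length_chain_map)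
  moreover have "t ! j \<in> Hom C (vertex C A t j) (vertex C A t (Suc j))" if "j < m" for j
    using that by (simp add: vertex_chain_map chain_map_nth seg_Hom cut_mono[OF u] cut_le[OF u])
  ultimately show ?thesis
    by (simp add: is_chain_iff[OF C] vertex_chain_map cut_top[OF u] vertex_length)
qed

text \<open>The arrows of \<open>t\<close> are the segments of \<open>s\<close> between neighbouring
  cut points; by \<open>seg_Cmp\<close> consecutive ones join into a single segment.\<close>

lemma seg_chain_map:
  assumes "a \<le> b" "b \<le> m"
  shows "seg C A t a b = seg C A s (cut (length s) u a) (cut (length s) u b)"
  using assms
proof (induction b rule: dec_induct)
  case base
  then show ?case by (simp add: seg_def composite_def vertex_chain_map)
next
  case (step b)
  then show ?case
    by (simp add: seg_Suc chain_map_nth cut_mono[OF u] cut_le[OF u] seg_Cmp)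
qed

text \<open>Functoriality of the action on chains. An arrow of the twice transported chain is a
  segment of \<open>t\<close>, hence a segment of \<open>s\<close> between iterated cut points, and
  these are the cut points of the composite.\<close>

lemma chain_map_compose:
  assumes v: "mono_on {..<m} v" "\<And>i. i < m \<Longrightarrow> v i < k"
  shows "chain_map C A (length s, compose {..<length s} v u, k) s = chain_map C A (m, v, k) t"
proof -
  have w: "mono_on {..<length s} (compose {..<length s} v u)"
    "\<And>i. i < length s \<Longrightarrow> compose {..<length s} v u i < k"
    using u v by (auto simp: mono_on_def compose_def)
  show ?thesis
    by (simp add: chain_map_eq_seg[OF w] chain_map_eq_seg[OF v] cut_compose[OF u v]
        seg_chain_map cut_mono[OF v] cut_le[OF v])
qed

end

text \<open>The cut points of the identity are all the numbers up to \<open>length s\<close>, so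
  every segment consists of one arrow.\<close>

lemma chain_map_id: "chain_map C A (length s, restrict id {..<length s}, length s) s = s"
proof -
  have r: "mono_on {..<length s} (restrict id {..<length s})"
    "\<And>i. i < length s \<Longrightarrow> restrict id {..<length s} i < length s"
    by (auto simp: mono_on_def)
  show ?thesis
    by (rule nth_equalityI, simp_all only: chain_map_eq_seg[OF r] cut_restrict_id)
      (simp_all add: min_absorb2 seg_one)
qed

end

section \<open>Concatenation of chains and ordinal sums of maps\<close>

lemma is_chain_append: "is_chain C A s B \<Longrightarrow> is_chain C B t D \<Longrightarrow> is_chain C A (s @ t) D"
  by (induction s arbitrary: A) auto

context
  fixes C :: "('o, 'a) cat" and A B D s t
  assumes C: "category C" and s: "is_chain C A s B" and t: "is_chain C B t D"
begin

lemma vertex_append_left: "i \<le> length s \<Longrightarrow> vertex C A (s @ t) i = vertex C A s i"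
  by (auto simp: vertex_def nth_append)

lemma vertex_append_right: "vertex C A (s @ t) (length s + i) = vertex C B t i"
  using vertex_length[OF C s] by (cases i) (auto simp: vertex_def nth_append)

lemma seg_append_left: "a \<le> b \<Longrightarrow> b \<le> length s \<Longrightarrow> seg C A (s @ t) a b = seg C A s a b"
  unfolding seg_def
  by (intro arg_cong2[of _ _ _ _ "composite C"] map_cong) (auto simp: vertex_append_left nth_append)

lemma seg_append_right: "seg C A (s @ t) (length s + a) (length s + b) = seg C B t a b"
proof -
  have "map ((!) (s @ t)) [length s + a..<length s + b] = map ((!) t) [a..<b]"
    by (rule nth_equalityI) (auto simp: nth_append)
  then show ?thesis by (simp add: seg_def vertex_append_right)
qed

end

definition glue :: "nat \<Rightarrow> (nat \<Rightarrow> nat) \<Rightarrow> nat \<Rightarrow> nat \<Rightarrow> (nat \<Rightarrow> nat) \<Rightarrow> nat \<Rightarrow> nat" where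
  "glue n u m n' u' = (\<lambda>i\<in>{..<n + n'}. if i < n then u i else m + u' (i - n))"

lemma ord_sum_glue: "ord_sum (n, u, m) (n', u', m') = (n + n', glue n u m n' u', m + m')"
  by (simp add: ord_sum_def glue_def)

context
  fixes n m n' m' :: nat and u u' :: "nat \<Rightarrow> nat"
  assumes u: "mono_on {..<n} u" "\<And>i. i < n \<Longrightarrow> u i < m"
    and u': "mono_on {..<n'} u'" "\<And>i. i < n' \<Longrightarrow> u' i < m'"
begin

lemma glue_mono: "mono_on {..<n + n'} (glue n u m n' u')"
  unfolding mono_on_def
proof (intro allI impI)
  fix i j assume ij: "i \<in> {..<n + n'} \<and> j \<in> {..<n + n'} \<and> i \<le> j"
  show "glue n u m n' u' i \<le> glue n u m n' u' j"
  proof (cases "j < n")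
    case True
    then show ?thesis using ij u(1) by (auto simp: glue_def mono_on_def)
  next
    case False
    have "u i \<le> m + u' (j - n)" if "i < n" using u(2)[OF that] by simp
    moreover have "u' (i - n) \<le> u' (j - n)" if "n \<le> i"
      using mono_onD[OF u'(1), of "i - n" "j - n"] False ij that by auto
    ultimately show ?thesis using False ij by (auto simp: glue_def)
  qed
qed

lemma glue_less: "i < n + n' \<Longrightarrow> glue n u m n' u' i < m + m'"
  using u(2)[of i] u'(2)[of "i - n"] by (auto simp: glue_def)

text \<open>The second block takes values at least \<open>m\<close> and so contributes nothing below
  \<open>j\<close>. The case \<open>j = m\<close> is included because it bounds the last segment of
  the first chain.\<close>

lemma cut_glue_left:
  assumes "j \<le> m"
  shows "cut (n + n') (glue n u m n' u') j = cut n u j"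
proof -
  have "{i. i < n + n' \<and> glue n u m n' u' i < j} = {i. i < n \<and> u i < j}"
    using assms by (auto simp: glue_def)
  then show ?thesis by (simp add: cut_def)
qed

text \<open>All \<open>n\<close> elements of the first block lie below \<open>m\<close> and are
  counted; in the second block the shift by \<open>m\<close> cancels.\<close>

lemma cut_glue_right: "cut (n + n') (glue n u m n' u') (m + j) = n + cut n' u' j"
proof -
  have "i < n + n' \<and> glue n u m n' u' i < m + j \<longleftrightarrow> i < n + cut n' u' j" for i
    using u(2)[of i] less_cut_iff[OF u', of "i - n" j] cut_le[OF u', of j] by (auto simp: glue_def)
  then have "{i. i < n + n' \<and> glue n u m n' u' i < m + j} = {..<n + cut n' u' j}" by auto
  then show ?thesis by (simp add: cut_def)
qed

end

text \<open>At \<open>m\<close> both cut formulas give \<open>length s\<close>, so no segment of the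
  image crosses the joint between \<open>s\<close> and \<open>t\<close>. This is what makes
  concatenation well defined on 2-cells.\<close>

lemma chain_map_append:
  fixes C :: "('o, 'a) cat"
  assumes C: "category C" and s: "is_chain C A s B" and t: "is_chain C B t D"
    and u: "mono_on {..<length s} u" "\<And>i. i < length s \<Longrightarrow> u i < m"
    and u': "mono_on {..<length t} u'" "\<And>i. i < length t \<Longrightarrow> u' i < m'"
  shows "chain_map C A (ord_sum (length s, u, m) (length t, u', m')) (s @ t)
    = chain_map C A (length s, u, m) s @ chain_map C B (length t, u', m') t"
proof -
  let ?w = "glue (length s) u m (length t) u'"
  note w = glue_mono[OF u u'] glue_less[OF u u']
  have l: "j < m \<Longrightarrow> cut (length s + length t) ?w j = cut (length s) u j \<and>
     cut (length s + length t) ?w (Suc j) = cut (length s) u (Suc j)" for j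
    by (simp add: cut_glue_left[OF u u'])
  have map_upt_add: "map f [0..<m + m'] = map f [0..<m] @ map (\<lambda>j. f (m + j)) [0..<m']"
    for f :: "nat \<Rightarrow> 'a"
    by (rule nth_equalityI) (auto simp: nth_append)
  have r: "cut (length s + length t) ?w (m + j) = length s + cut (length t) u' j \<and>
     cut (length s + length t) ?w (Suc (m + j)) = length s + cut (length t) u' (Suc j)" for j
    using cut_glue_right[OF u u', of j] cut_glue_right[OF u u', of "Suc j"] by simp
  show ?thesis
    by (simp add: ord_sum_glue chain_map_eq_seg[OF w] chain_map_eq_seg[OF u] chain_map_eq_seg[OF u']
        map_upt_add l r seg_append_left[OF C s t] cut_mono[OF u] cut_le[OF u] seg_append_right[OF C s t])
qed

section \<open>Functors acting on chains\<close>

lemma is_chain_map: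
  assumes "is_functor C D F" "is_chain C A s B"
  shows "is_chain D (FO F A) (map (FA F) s) (FO F B)"
  using assms(2)
proof (induction s arbitrary: A)
  case Nil
  then show ?case using functor_Ob[OF assms(1)] by auto
next
  case (Cons f s)
  then show ?case using functor_Hom[OF assms(1) Ar_in_Hom[of f]] by (auto simp: Hom_iff)
qed

text \<open>Cut points depend on \<open>u\<close> alone, so both sides divide the chain at the same
  places. \<open>F\<close> preserves the composite of each segment, including the identity of an
  empty one.\<close>

lemma chain_map_natural:
  assumes F: "is_functor C D F" and s: "is_chain C A s B"
    and u: "mono_on {..<length s} u" "\<And>i. i < length s \<Longrightarrow> u i < m"
  shows "chain_map D (FO F A) (length s, u, m) (map (FA F) s)
    = map (FA F) (chain_map C A (length s, u, m) s)"
proof -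
  note C = functor_dom[OF F]
  note ch = chain_Hom[OF C s] and v = vertex_Ob[OF C s]
  have vx: "vertex D (FO F A) (map (FA F) s) i = FO F (vertex C A s i)" if "i \<le> length s" for i
    using that functor_Hom[OF F ch[of "i - 1"]] by (cases i) (auto simp: vertex_def Hom_iff)
  have "seg D (FO F A) (map (FA F) s) a b = FA F (seg C A s a b)" if "a \<le> b" "b \<le> length s" for a b
    using that
  proof (induction b rule: dec_induct)
    case base
    then show ?case by (simp add: seg_same vx functor_Ide[OF F v])
  next
    case (step b)
    then show ?case
      using functor_Cmp[OF F seg_Hom[OF C s, of a b] ch[of b]] by (simp add: seg_Suc)
  qed
  then show ?thesis
    by (simp add: chain_map_eq_seg[OF u] cut_mono[OF u] cut_le[OF u])
qed

section \<open>The 2-path-category\<close>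

lemma Delta_simps [simp]:
  "Ob Delta = UNIV" "Dom Delta (n, u, m) = n" "Cod Delta (n, u, m) = m"
  "Ide Delta n = (n, restrict id {..<n}, n)"
  "(m', v, k) \<cdot>\<^bsub>Delta\<^esub> (n, u, m) = (n, compose {..<n} v u, k)"
  by (simp_all add: Delta_def)

lemma Delta_Ar_iff: "(n, u, m) \<in> Ar Delta \<longleftrightarrow> u \<in> {..<n} \<rightarrow>\<^sub>E {..<m} \<and> mono_on {..<n} u"
  by (simp add: Delta_def)

lemma Delta_ArE:
  assumes "w \<in> Ar Delta"
  obtains n u m where "w = (n, u, m)" "u \<in> {..<n} \<rightarrow>\<^sub>E {..<m}" "mono_on {..<n} u"
    "\<And>i. i < n \<Longrightarrow> u i < m"
proof -
  obtain n u m where "w = (n, u, m)" by (cases w)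
  with assms that[of n u m] show ?thesis by (auto simp: Delta_Ar_iff)
qed

lemma mono_on_compose:
  "mono_on {..<n} u \<Longrightarrow> u \<in> {..<n} \<rightarrow> {..<m} \<Longrightarrow> mono_on {..<m} v \<Longrightarrow>
     mono_on {..<n} (compose {..<n} v u)" for u v :: "nat \<Rightarrow> nat" and n m :: nat
  by (auto simp: mono_on_def compose_def Pi_iff)

lemma category_Delta: "category Delta"
proof (rule categoryI)
  fix f assume "f \<in> Ar Delta"
  then show "f \<cdot>\<^bsub>Delta\<^esub> Ide Delta (Dom Delta f) = f"
    by (elim Delta_ArE) (auto simp: compose_def PiE_iff extensional_def)
next
  fix f assume "f \<in> Ar Delta"
  then show "Ide Delta (Cod Delta f) \<cdot>\<^bsub>Delta\<^esub> f = f"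
    by (elim Delta_ArE) (auto simp: compose_def PiE_iff extensional_def)
next
  fix f g assume "f \<in> Ar Delta" "g \<in> Ar Delta" "Cod Delta f = Dom Delta g"
  then show "g \<cdot>\<^bsub>Delta\<^esub> f \<in> Hom Delta (Dom Delta f) (Cod Delta g)"
  proof (elim Delta_ArE)
    fix n u m n' v k
    assume eq: "Cod Delta f = Dom Delta g" and f: "f = (n, u, m)" and u: "u \<in> {..<n} \<rightarrow>\<^sub>E {..<m}" "mono_on {..<n} u"
      and g: "g = (n', v, k)" and v: "v \<in> {..<n'} \<rightarrow>\<^sub>E {..<k}" "mono_on {..<n'} v"
    have "mono_on {..<n} (compose {..<n} v u)"
      using u v eq by (intro mono_on_compose[where m = m]) (auto simp: f g)
    moreover have "compose {..<n} v u \<in> {..<n} \<rightarrow>\<^sub>E {..<k}"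
      using u v eq by (auto simp: f g compose_def PiE_iff)
    ultimately show ?thesis by (simp add: f g Hom_iff Delta_Ar_iff)
  qed
next
  fix f g h assume "f \<in> Ar Delta" "g \<in> Ar Delta" "h \<in> Ar Delta"
    "Cod Delta f = Dom Delta g" "Cod Delta g = Dom Delta h"
  then show "(h \<cdot>\<^bsub>Delta\<^esub> g) \<cdot>\<^bsub>Delta\<^esub> f = h \<cdot>\<^bsub>Delta\<^esub> (g \<cdot>\<^bsub>Delta\<^esub> f)"
    by (elim Delta_ArE) (auto simp: compose_def PiE_iff)
qed (auto simp: Hom_iff Delta_Ar_iff mono_on_def)

lemma ord_sum_in_Hom:
  assumes "f \<in> Ar Delta" "g \<in> Ar Delta"
  shows "ord_sum f g \<in> Hom Delta (Dom Delta f + Dom Delta g) (Cod Delta f + Cod Delta g)"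
  using assms
proof (elim Delta_ArE)
  fix n u m n' u' m'
  assume f: "f = (n, u, m)" "mono_on {..<n} u" "\<And>i. i < n \<Longrightarrow> u i < m"
    and g: "g = (n', u', m')" "mono_on {..<n'} u'" "\<And>i. i < n' \<Longrightarrow> u' i < m'"
  have "glue n u m n' u' \<in> extensional {..<n + n'}"
    by (simp add: glue_def)
  then show ?thesis
    using glue_mono[OF f(2,3) g(2,3)] glue_less[OF f(2,3) g(2,3)]
    by (auto simp: f(1) g(1) ord_sum_glue Hom_iff Delta_Ar_iff PiE_iff)
qed

lemma ord_sum_Ide: "ord_sum (Ide Delta n) (Ide Delta m) = Ide Delta (n + m)"
  by (auto simp: ord_sum_def restrict_def fun_eq_iff)

text \<open>The bounds \<open>u i < m\<close> and \<open>u' i < m'\<close> keep each block inside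
  the corresponding block of the middle ordinal, so the two halves compose separately.\<close>

lemma ord_sum_Cmp:
  assumes "f \<in> Ar Delta" "g \<in> Ar Delta" "Cod Delta f = Dom Delta g"
    and "f' \<in> Ar Delta" "g' \<in> Ar Delta" "Cod Delta f' = Dom Delta g'"
  shows "ord_sum (g \<cdot>\<^bsub>Delta\<^esub> f) (g' \<cdot>\<^bsub>Delta\<^esub> f') = ord_sum g g' \<cdot>\<^bsub>Delta\<^esub> ord_sum f f'"
proof -
  obtain n u m v k where f: "f = (n, u, m)" and u: "\<And>i. i < n \<Longrightarrow> u i < m" and g: "g = (m, v, k)"
    using assms(1-3) by (auto elim!: Delta_ArE)
  obtain n' u' m' v' k' where f': "f' = (n', u', m')" and u': "\<And>i. i < n' \<Longrightarrow> u' i < m'" and g': "g' = (m', v', k')"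
    using assms(4-6) by (auto elim!: Delta_ArE)
  have "glue n (compose {..<n} v u) k n' (compose {..<n'} v' u') i
      = compose {..<n + n'} (glue m v k m' v') (glue n u m n' u') i" for i
    using u[of i] u'[of "i - n"] by (cases "i < n") (auto simp: glue_def compose_def)
  then show ?thesis
    by (simp add: f g f' g' ord_sum_glue fun_eq_iff)
qed

lemma ord_sum_assoc: "ord_sum (ord_sum f g) h = ord_sum f (ord_sum g h)"
  by (cases f, cases g, cases h) (auto simp: ord_sum_def fun_eq_iff add.assoc)

lemma ord_sum_unit:
  assumes "f \<in> Ar Delta"
  shows "ord_sum (Ide Delta 0) f = f" "ord_sum f (Ide Delta 0) = f"
  using assms by (auto elim!: Delta_ArE simp: ord_sum_def PiE_iff extensional_def fun_eq_iff)

lemma monoidal_category_Delta_mon: "monoidal_category Delta_mon"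
proof -
  have "is_functor (prod_cat Delta Delta) Delta
      \<lparr>FO = (\<lambda>(n, m). n + m), FA = (\<lambda>(u, u'). ord_sum u u')\<rparr>"
    by (intro is_functorI)
      (auto simp: category_prod_cat category_Delta ord_sum_in_Hom ord_sum_Cmp
        ord_sum_Ide simp del: Delta_simps(2-))
  then show ?thesis
    by (intro strict_monoidal_categoryI)
      (simp_all add: Delta_mon_def ord_sum_assoc ord_sum_unit[simplified] add.assoc)
qed

section \<open>Categories of paths over the finite ordinals\<close>

lemma path_hom_simps [simp]:
  "Dom (path_hom C A B) (x, u, y) = x" "Cod (path_hom C A B) (x, u, y) = y"
  "Ide (path_hom C A B) (n, s) = ((n, s), Ide Delta n, (n, s))"
  "(y', v, z) \<cdot>\<^bsub>path_hom C A B\<^esub> (x, u, y) = (x, v \<cdot>\<^bsub>Delta\<^esub> u, z)"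
  by (simp_all add: path_hom_def)

lemma path_hom_Ob_iff: "(n, s) \<in> Ob (path_hom C A B) \<longleftrightarrow> is_chain C A s B \<and> n = length s"
  by (auto simp: path_hom_def chains_def)

text \<open>The normal form of a 2-cell: the source chain and the map of \<open>\<Delta>\<close> are
  arbitrary, and the target chain is forced.\<close>

lemma path_hom_ArE:
  assumes "\<sigma> \<in> Ar (path_hom C A B)"
  obtains s u m where
    "\<sigma> = ((length s, s), (length s, u, m), (m, chain_map C A (length s, u, m) s))"
    "is_chain C A s B" "u \<in> {..<length s} \<rightarrow>\<^sub>E {..<m}"
    "mono_on {..<length s} u" "\<And>i. i < length s \<Longrightarrow> u i < m"
proof -
  obtain n s w m t where \<sigma>: "\<sigma> = ((n, s), w, (m, t))" by (metis prod.exhaust)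
  then have "is_chain C A s B" "n = length s" "w \<in> Hom Delta n m" "t = chain_map C A w s"
    using assms by (auto simp: path_hom_def chains_def)
  moreover then obtain u where "w = (n, u, m)" "u \<in> {..<n} \<rightarrow>\<^sub>E {..<m}" "mono_on {..<n} u"
    by (auto simp: Hom_iff elim!: Delta_ArE)
  ultimately show ?thesis using that[of s u m] \<sigma> by auto
qed

context
  fixes C :: "('o, 'a) cat"
  assumes C: "category C"
begin

lemma path_hom_ArI:
  assumes "is_chain C A s B" "w \<in> Hom Delta (length s) m"
  shows "((length s, s), w, (m, chain_map C A w s)) \<in> Hom (path_hom C A B) (length s, s) (m, chain_map C A w s)"
    "(m, chain_map C A w s) \<in> Ob (path_hom C A B)"
proof -
  obtain u where w: "w = (length s, u, m)" "mono_on {..<length s} u" "\<And>i. i < length s \<Longrightarrow> u i < m"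
    using assms(2) by (auto simp: Hom_iff elim!: Delta_ArE)
  then have "chain_map C A w s \<in> chains C A B m"
    using is_chain_chain_map[OF C assms(1) w(2,3)] by (simp add: chains_def chain_map_def)
  then show "((length s, s), w, (m, chain_map C A w s)) \<in> Hom (path_hom C A B) (length s, s) (m, chain_map C A w s)"
    "(m, chain_map C A w s) \<in> Ob (path_hom C A B)"
    using assms by (auto simp: Hom_def path_hom_def chains_def)
qed

text \<open>The equations are those of \<open>Delta\<close>, since cells compose through their
  underlying maps. Chains matter only for closure: \<open>chain_map_id\<close> gives the target of
  an identity and \<open>chain_map_compose\<close> that of a composite.\<close>

lemma category_path_hom: "category (path_hom C A B)"
proof (rule categoryI)
  fix \<sigma> assume "\<sigma> \<in> Ar (path_hom C A B)"
  then obtain s u m where \<sigma>: "\<sigma> = ((length s, s), (length s, u, m), (m, chain_map C A (length s, u, m) s))"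
    and s: "is_chain C A s B" and u: "(length s, u, m) \<in> Ar Delta"
    by (elim path_hom_ArE) (auto simp: Delta_Ar_iff)
  show "Dom (path_hom C A B) \<sigma> \<in> Ob (path_hom C A B)"
    using s by (simp add: \<sigma> path_hom_Ob_iff)
  show "Cod (path_hom C A B) \<sigma> \<in> Ob (path_hom C A B)"
    using path_hom_ArI(2)[OF s, of "(length s, u, m)" m] u by (simp add: \<sigma> Hom_iff)
  show "\<sigma> \<cdot>\<^bsub>path_hom C A B\<^esub> Ide (path_hom C A B) (Dom (path_hom C A B) \<sigma>) = \<sigma>"
    using Cmp_Ide[OF category_Delta Ar_in_Hom[OF u]] by (simp add: \<sigma> del: Delta_simps(4,5))
  show "Ide (path_hom C A B) (Cod (path_hom C A B) \<sigma>) \<cdot>\<^bsub>path_hom C A B\<^esub> \<sigma> = \<sigma>"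
    using Ide_Cmp[OF category_Delta Ar_in_Hom[OF u]] by (simp add: \<sigma> del: Delta_simps(4,5))
next
  fix x assume "x \<in> Ob (path_hom C A B)"
  then obtain s where x: "x = (length s, s)" and s: "is_chain C A s B"
    by (cases x) (auto simp: path_hom_Ob_iff)
  show "Ide (path_hom C A B) x \<in> Hom (path_hom C A B) x x"
    using path_hom_ArI(1)[OF s Ide_in_Hom[OF category_Delta]] chain_map_id[OF C s] by (simp add: x)
next
  fix \<sigma> \<tau> assume "\<sigma> \<in> Ar (path_hom C A B)" "\<tau> \<in> Ar (path_hom C A B)"
    and eq: "Cod (path_hom C A B) \<sigma> = Dom (path_hom C A B) \<tau>"
  then show "\<tau> \<cdot>\<^bsub>path_hom C A B\<^esub> \<sigma> \<in> Hom (path_hom C A B) (Dom (path_hom C A B) \<sigma>) (Cod (path_hom C A B) \<tau>)"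
  proof (elim path_hom_ArE)
    fix s u m t v k
    assume \<sigma>: "\<sigma> = ((length s, s), (length s, u, m), (m, chain_map C A (length s, u, m) s))"
      and s: "is_chain C A s B" and ue: "u \<in> {..<length s} \<rightarrow>\<^sub>E {..<m}"
      and u: "mono_on {..<length s} u" "\<And>i. i < length s \<Longrightarrow> u i < m"
      and \<tau>: "\<tau> = ((length t, t), (length t, v, k), (k, chain_map C A (length t, v, k) t))"
      and ve: "v \<in> {..<length t} \<rightarrow>\<^sub>E {..<k}"
      and v: "mono_on {..<length t} v" "\<And>i. i < length t \<Longrightarrow> v i < k"
    have m: "m = length t" and t: "t = chain_map C A (length s, u, m) s"
      using eq by (auto simp: \<sigma> \<tau>)
    have "(length s, compose {..<length s} v u, k) \<in> Hom Delta (length s) k"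
      using Cmp_in_Hom[OF category_Delta, of "(length s, u, m)" "length s" m "(m, v, k)" k] ue ve u v m
      by (simp add: Hom_iff Delta_Ar_iff)
    from path_hom_ArI(1)[OF s this] show ?thesis
      using chain_map_compose[OF C s u t v[folded m]] by (simp add: \<sigma> \<tau> m)
  qed
next
  fix \<rho> \<sigma> \<tau> assume "\<rho> \<in> Ar (path_hom C A B)" "\<sigma> \<in> Ar (path_hom C A B)" "\<tau> \<in> Ar (path_hom C A B)"
    "Cod (path_hom C A B) \<rho> = Dom (path_hom C A B) \<sigma>" "Cod (path_hom C A B) \<sigma> = Dom (path_hom C A B) \<tau>"
  then show "(\<tau> \<cdot>\<^bsub>path_hom C A B\<^esub> \<sigma>) \<cdot>\<^bsub>path_hom C A B\<^esub> \<rho> = \<tau> \<cdot>\<^bsub>path_hom C A B\<^esub> \<sigma> \<cdot>\<^bsub>path_hom C A B\<^esub> \<rho>"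
    using Cmp_assoc[OF category_Delta] by (elim path_hom_ArE) (auto simp: compose_def PiE_iff)
qed

lemma is_functor_path_length: "is_functor (path_hom C A B) Delta path_length"
proof (rule is_functorI)
  show "category (path_hom C A B)" by (rule category_path_hom)
qed (auto simp: category_Delta path_length_def Hom_iff Delta_Ar_iff path_hom_Ob_iff elim!: path_hom_ArE)

text \<open>Parallel cells share the first and third component of the triple, and length reads off
  the second.\<close>

lemma posetal_over_path_length: "posetal_over (path_hom C A B) path_length"
  by (auto simp: posetal_over_def path_length_def Hom_iff)

lemma zero_length_iff:
  assumes "A \<in> Ob C"
  shows "0 \<in> FO path_length ` Ob (path_hom C A B) \<longleftrightarrow> A = B"
proof
  assume "A = B"
  then have "(0, []) \<in> Ob (path_hom C A B)" using assms by (simp add: path_hom_Ob_iff)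
  then show "0 \<in> FO path_length ` Ob (path_hom C A B)" by (force simp: path_length_def)
qed (auto simp: path_length_def path_hom_Ob_iff)

text \<open>Pairs are written with the later path first, while chains and maps are joined with the
  earlier one first. That cells go to cells is \<open>chain_map_append\<close>; preservation of
  composites is the interchange law \<open>ord_sum_Cmp\<close>.\<close>

lemma is_functor_concat:
  "is_functor (prod_cat (path_hom C Y Z) (path_hom C X Y)) (path_hom C X Z)
    \<lparr>FO = (\<lambda>(t, s). concat_path t s), FA = (\<lambda>(\<tau>, \<sigma>). concat_cell \<tau> \<sigma>)\<rparr>"
proof (rule is_functorI)
  fix p assume "p \<in> Ar (prod_cat (path_hom C Y Z) (path_hom C X Y))"
  then obtain \<tau> \<sigma> where p: "p = (\<tau>, \<sigma>)" and "\<sigma> \<in> Ar (path_hom C X Y)" "\<tau> \<in> Ar (path_hom C Y Z)"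
    by (cases p) simp
  then show "FA \<lparr>FO = \<lambda>(t, s). concat_path t s, FA = \<lambda>(\<tau>, \<sigma>). concat_cell \<tau> \<sigma>\<rparr> p
      \<in> Hom (path_hom C X Z)
         (FO \<lparr>FO = \<lambda>(t, s). concat_path t s, FA = \<lambda>(\<tau>, \<sigma>). concat_cell \<tau> \<sigma>\<rparr>
            (Dom (prod_cat (path_hom C Y Z) (path_hom C X Y)) p))
         (FO \<lparr>FO = \<lambda>(t, s). concat_path t s, FA = \<lambda>(\<tau>, \<sigma>). concat_cell \<tau> \<sigma>\<rparr>
            (Cod (prod_cat (path_hom C Y Z) (path_hom C X Y)) p))"
  proof (elim path_hom_ArE)
    fix s u m t v k
    assume \<sigma>: "\<sigma> = ((length s, s), (length s, u, m), (m, chain_map C X (length s, u, m) s))"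
      and s: "is_chain C X s Y" and ue: "u \<in> {..<length s} \<rightarrow>\<^sub>E {..<m}"
      and u: "mono_on {..<length s} u" "\<And>i. i < length s \<Longrightarrow> u i < m"
      and \<tau>: "\<tau> = ((length t, t), (length t, v, k), (k, chain_map C Y (length t, v, k) t))"
      and t: "is_chain C Y t Z" and ve: "v \<in> {..<length t} \<rightarrow>\<^sub>E {..<k}"
      and v: "mono_on {..<length t} v" "\<And>i. i < length t \<Longrightarrow> v i < k"
    have "ord_sum (length s, u, m) (length t, v, k) \<in> Hom Delta (length (s @ t)) (m + k)"
      using ord_sum_in_Hom[of "(length s, u, m)" "(length t, v, k)"] ue ve u v
      by (simp add: Delta_Ar_iff)
    from path_hom_ArI(1)[OF is_chain_append[OF s t] this] show ?thesis
      using chain_map_append[OF C s t u v]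
      by (simp add: p \<sigma> \<tau> concat_cell_def concat_path_def)
  qed
next
  fix p q assume "p \<in> Ar (prod_cat (path_hom C Y Z) (path_hom C X Y))"
    "q \<in> Ar (prod_cat (path_hom C Y Z) (path_hom C X Y))"
    "Cod (prod_cat (path_hom C Y Z) (path_hom C X Y)) p = Dom (prod_cat (path_hom C Y Z) (path_hom C X Y)) q"
  then show "FA \<lparr>FO = \<lambda>(t, s). concat_path t s, FA = \<lambda>(\<tau>, \<sigma>). concat_cell \<tau> \<sigma>\<rparr>
        (q \<cdot>\<^bsub>prod_cat (path_hom C Y Z) (path_hom C X Y)\<^esub> p)
      = FA \<lparr>FO = \<lambda>(t, s). concat_path t s, FA = \<lambda>(\<tau>, \<sigma>). concat_cell \<tau> \<sigma>\<rparr> q \<cdot>\<^bsub>path_hom C X Z\<^esub>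
        FA \<lparr>FO = \<lambda>(t, s). concat_path t s, FA = \<lambda>(\<tau>, \<sigma>). concat_cell \<tau> \<sigma>\<rparr> p"
    by (cases p, cases q)
      (auto elim!: path_hom_ArE simp: concat_cell_def ord_sum_Cmp Delta_Ar_iff simp del: Delta_simps(5))
qed (auto simp: category_prod_cat category_path_hom concat_path_def concat_cell_def path_hom_Ob_iff
    is_chain_append ord_sum_Ide add.commute simp del: Delta_simps(4))

lemma concat_path_assoc: "concat_path (concat_path h g) f = concat_path h (concat_path g f)"
  by (cases f, cases g, cases h) (simp add: concat_path_def)

lemma concat_cell_assoc: "concat_cell (concat_cell \<rho> \<tau>) \<sigma> = concat_cell \<rho> (concat_cell \<tau> \<sigma>)"
  by (simp add: concat_cell_def concat_path_assoc ord_sum_assoc split: prod.split)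

lemma concat_path_unit: "concat_path (0, []) f = f" "concat_path f (0, []) = f"
  by (cases f; simp add: concat_path_def)+

lemma concat_cell_unit:
  assumes "\<sigma> \<in> Ar (path_hom C X Y)"
  shows "concat_cell (Ide (path_hom C A A) (0, [])) \<sigma> = \<sigma>"
    "concat_cell \<sigma> (Ide (path_hom C A A) (0, [])) = \<sigma>"
  using assms by (auto elim!: path_hom_ArE
      simp: concat_cell_def concat_path_unit ord_sum_unit Delta_Ar_iff simp del: Delta_simps(4))

lemma strict_2category_path_2cat: "strict_2category (path_2cat C)"
  by (rule strict_2categoryI)
    (simp_all add: path_2cat_def category_path_hom is_functor_concat concat_path_assoc concat_cell_assoc
      concat_path_unit concat_cell_unit path_hom_Ob_iff del: Delta_simps path_hom_simps)

text \<open>Length preserves the structure strictly: lengths add under concatenation, maps add under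
  \<open>ord_sum\<close>, and all structure cells on both sides are identities.\<close>

lemma is_monoidal_functor_path_length:
  assumes "A \<in> Ob C"
  shows "is_monoidal_functor (endo_mon (path_2cat C) A) Delta_mon path_length"
proof -
  have inv: "inv_ar (path_hom C A A) (Ide (path_hom C A A) x) = Ide (path_hom C A A) x"
    if "x \<in> Ob (path_hom C A A)" for x
    using that by (intro inv_ar_Ide category_path_hom)
  note concat = bifunctor_Ob[OF is_functor_concat, simplified]
  have ide: "FA path_length (Ide (path_hom C A A) x) = Ide Delta (FO path_length x)" for x
    by (cases x) (simp add: path_length_def)
  \<comment> \<open>The reversal here cancels the one in the tensor of \<open>endo_mon\<close>, so
    the maps are summed in the order of the tensor factors. On maps, unlike on lengths, this order
    matters.\<close>
  have cell: "FA path_length (concat_cell \<tau> \<sigma>) = ord_sum (FA path_length \<sigma>) (FA path_length \<tau>)" for \<sigma> \<tau>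
    by (simp add: path_length_def concat_cell_def split: prod.split)
  have path: "FO path_length (concat_path y x) = FO path_length x + FO path_length y" for x y
    by (simp add: path_length_def concat_path_def split: prod.split)
  have "FO path_length (0, []) = 0"
    by (simp add: path_length_def)
  then show ?thesis
    using monoidal_category_endo_mon[OF strict_2category_path_2cat] assms
    by (intro strict_monoidal_functorI monoidal_category_Delta_mon)
      (simp_all add: endo_mon_def Delta_mon_def path_2cat_def is_functor_path_length inv concat ide cell path
        add.assoc del: path_hom_simps Delta_simps)
qed

text \<open>When the identity of \<open>A\<close> is the only arrow, there is exactly one chain of
  each length. As a cell is determined by its source chain and its map, length is bijective on
  objects and on arrows.\<close>

lemma is_monoidal_iso_path_length:
  assumes one: "isomorphic_cat C one_cat" and A: "A \<in> Ob C"
  shows "is_monoidal_iso (endo_mon (path_2cat C) A) Delta_mon path_length"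
proof -
  obtain F :: "('o, 'a, unit, unit) func" where F: "bij_betw (FO F) (Ob C) (UNIV :: unit set)" "bij_betw (FA F) (Ar C) (UNIV :: unit set)"
    using one by (auto simp: isomorphic_cat_def is_cat_iso_def one_cat_def)
  let ?i = "Ide C A"
  have i: "?i \<in> Ar C" "Dom C ?i = A" "Cod C ?i = A"
    using Ide_in_Hom[OF C A] by (simp_all add: Hom_iff)
  \<comment> \<open>\<open>FA F\<close> is an injection into a one-element type.\<close>
  have arr: "f = ?i" if "f \<in> Ar C" for f
    using bij_betw_imp_inj_on[OF F(2)] that i(1) by (auto simp: inj_on_def)
  have chain: "is_chain C A s A \<longleftrightarrow> s = replicate (length s) ?i" for s
  proof (induction s)
    case (Cons f s)
    then show ?case
    proof (cases "f = ?i")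
      case True
      then show ?thesis using Cons by (simp add: i)
    next
      case False
      then show ?thesis using arr[of f] by auto
    qed
  qed (simp add: A)
  have chain_eq: "s = t" if "is_chain C A s A" "is_chain C A t A" "length s = length t" for s t
    using that chain by metis
  have "inj_on (FO path_length) (Ob (path_hom C A A))"
    using chain_eq by (auto simp: inj_on_def path_length_def path_hom_Ob_iff)
  moreover have "n \<in> FO path_length ` Ob (path_hom C A A)" for n
    using chain by (intro image_eqI[of _ _ "(n, replicate n ?i)"]) (simp_all add: path_length_def path_hom_Ob_iff)
  ultimately have "bij_betw (FO path_length) (Ob (path_hom C A A)) (Ob Delta)"
    by (auto simp: bij_betw_def)
  moreover
  have "inj_on (FA path_length) (Ar (path_hom C A A))"
  proof (rule inj_onI)
    fix \<sigma> \<tau> assume "\<sigma> \<in> Ar (path_hom C A A)" "\<tau> \<in> Ar (path_hom C A A)"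
      and eq: "FA path_length \<sigma> = FA path_length \<tau>"
    then show "\<sigma> = \<tau>"
    proof (elim path_hom_ArE)
      fix s u m t v k
      assume st: "is_chain C A s A" "is_chain C A t A"
        and "\<sigma> = ((length s, s), (length s, u, m), (m, chain_map C A (length s, u, m) s))"
        and "\<tau> = ((length t, t), (length t, v, k), (k, chain_map C A (length t, v, k) t))"
      \<comment> \<open>The common underlying map includes its domain and codomain, so the source
        chains have equal length and therefore coincide; then so do the targets.\<close>
      then show ?thesis
        using eq chain_eq[OF st] by (simp add: path_length_def)
    qed
  qed
  moreover have "w \<in> FA path_length ` Ar (path_hom C A A)" if "w \<in> Ar Delta" for w
  proof -
    \<comment> \<open>The preimage of \<open>w\<close> starts at the unique chain whose length is
      the domain of \<open>w\<close>; its target is the image of that chain.\<close>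
    let ?s = "replicate (Dom Delta w) ?i"
    have "is_chain C A ?s A" using chain by simp
    from path_hom_ArI(1)[OF this, of w "Cod Delta w"] that
    show ?thesis
      by (intro image_eqI[of _ _ "((length ?s, ?s), w, (Cod Delta w, chain_map C A w ?s))"])
        (simp_all add: path_length_def Hom_iff)
  qed
  moreover have "FA path_length \<sigma> \<in> Ar Delta" if "\<sigma> \<in> Ar (path_hom C A A)" for \<sigma>
    using functor_Hom[OF is_functor_path_length Ar_in_Hom[OF that]] by (simp add: Hom_iff)
  ultimately have "is_cat_iso (path_hom C A A) Delta path_length"
    by (auto simp: is_cat_iso_def is_functor_path_length bij_betw_def)
  then show ?thesis
    using is_monoidal_functor_path_length[OF A]
    by (simp add: is_monoidal_iso_def endo_mon_def path_2cat_def Delta_mon_def)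
qed

end

section \<open>Homomorphisms of bicategories\<close>

lemma composable_iff:
  "(X, Y, Z, g, f) \<in> composable B \<longleftrightarrow> X \<in> Obj B \<and> Y \<in> Obj B \<and> Z \<in> Obj B \<and>
     g \<in> Ob (Hcat B Y Z) \<and> f \<in> Ob (Hcat B X Y)"
  by (simp add: composable_def)

context
  fixes B :: "('o, 'f, 't) bicat" and B' :: "('p, 'g, 's) bicat" and F
  assumes F: "homomorphism B B' F"
begin

lemma homomorphism_dom: "bicategory B" and homomorphism_cod: "bicategory B'"
  using F by (simp_all add: homomorphism_def)

lemma homomorphism_Obj: "X \<in> Obj B \<Longrightarrow> h0 F X \<in> Obj B'"
  using F unfolding homomorphism_def by (elim conjE) simp

lemma homomorphism_functor:
  "X \<in> Obj B \<Longrightarrow> Y \<in> Obj B \<Longrightarrow> is_functor (Hcat B X Y) (Hcat B' (h0 F X) (h0 F Y)) (hF F (X, Y))"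
  using F unfolding homomorphism_def by (elim conjE) simp

lemma homomorphism_hm:
  "(X, Y, Z, g, f) \<in> composable B \<Longrightarrow>
     hm F (X, Y, Z, g, f) \<in> iso_hom (Hcat B' (h0 F X) (h0 F Z))
       (comp1 B' (h0 F X) (h0 F Y) (h0 F Z) (FO (hF F (Y, Z)) g) (FO (hF F (X, Y)) f))
       (FO (hF F (X, Z)) (comp1 B X Y Z g f))"
  using F unfolding homomorphism_def by (elim conjE) blast

lemma homomorphism_hu:
  "X \<in> Obj B \<Longrightarrow>
     hu F X \<in> iso_hom (Hcat B' (h0 F X) (h0 F X)) (Unit1 B' (h0 F X)) (FO (hF F (X, X)) (Unit1 B X))"
  using F unfolding homomorphism_def by (elim conjE) simp

lemma homomorphism_hm_natural:
  "X \<in> Obj B \<Longrightarrow> Y \<in> Obj B \<Longrightarrow> Z \<in> Obj B \<Longrightarrow>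
     \<tau> \<in> Hom (Hcat B Y Z) g g' \<Longrightarrow> \<sigma> \<in> Hom (Hcat B X Y) f f' \<Longrightarrow>
     hm F (X, Y, Z, g', f') \<cdot>\<^bsub>Hcat B' (h0 F X) (h0 F Z)\<^esub>
       comp2 B' (h0 F X) (h0 F Y) (h0 F Z) (FA (hF F (Y, Z)) \<tau>) (FA (hF F (X, Y)) \<sigma>)
     = FA (hF F (X, Z)) (comp2 B X Y Z \<tau> \<sigma>) \<cdot>\<^bsub>Hcat B' (h0 F X) (h0 F Z)\<^esub> hm F (X, Y, Z, g, f)"
  using F unfolding homomorphism_def Hom_def by (elim conjE) auto

lemma homomorphism_Assoc:
  "X \<in> Obj B \<Longrightarrow> Y \<in> Obj B \<Longrightarrow> Z \<in> Obj B \<Longrightarrow> W \<in> Obj B \<Longrightarrow>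
     h \<in> Ob (Hcat B Z W) \<Longrightarrow> g \<in> Ob (Hcat B Y Z) \<Longrightarrow> f \<in> Ob (Hcat B X Y) \<Longrightarrow>
     FA (hF F (X, W)) (Assoc B X Y Z W h g f)
       \<cdot>\<^bsub>Hcat B' (h0 F X) (h0 F W)\<^esub> hm F (X, Y, W, comp1 B Y Z W h g, f)
       \<cdot>\<^bsub>Hcat B' (h0 F X) (h0 F W)\<^esub>
       comp2 B' (h0 F X) (h0 F Y) (h0 F W)
         (hm F (Y, Z, W, h, g)) (Ide (Hcat B' (h0 F X) (h0 F Y)) (FO (hF F (X, Y)) f))
     = hm F (X, Z, W, h, comp1 B X Y Z g f)
       \<cdot>\<^bsub>Hcat B' (h0 F X) (h0 F W)\<^esub>
       comp2 B' (h0 F X) (h0 F Z) (h0 F W)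
         (Ide (Hcat B' (h0 F Z) (h0 F W)) (FO (hF F (Z, W)) h)) (hm F (X, Y, Z, g, f))
       \<cdot>\<^bsub>Hcat B' (h0 F X) (h0 F W)\<^esub>
       Assoc B' (h0 F X) (h0 F Y) (h0 F Z) (h0 F W)
         (FO (hF F (Z, W)) h) (FO (hF F (Y, Z)) g) (FO (hF F (X, Y)) f)"
  using F unfolding homomorphism_def by (elim conjE) simp

lemma homomorphism_LUn:
  "X \<in> Obj B \<Longrightarrow> Y \<in> Obj B \<Longrightarrow> f \<in> Ob (Hcat B X Y) \<Longrightarrow>
     FA (hF F (X, Y)) (LUn B X Y f)
       \<cdot>\<^bsub>Hcat B' (h0 F X) (h0 F Y)\<^esub> hm F (X, Y, Y, Unit1 B Y, f)
       \<cdot>\<^bsub>Hcat B' (h0 F X) (h0 F Y)\<^esub>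
       comp2 B' (h0 F X) (h0 F Y) (h0 F Y)
         (hu F Y) (Ide (Hcat B' (h0 F X) (h0 F Y)) (FO (hF F (X, Y)) f))
     = LUn B' (h0 F X) (h0 F Y) (FO (hF F (X, Y)) f)"
  using F unfolding homomorphism_def by (elim conjE) simp

lemma homomorphism_RUn:
  "X \<in> Obj B \<Longrightarrow> Y \<in> Obj B \<Longrightarrow> f \<in> Ob (Hcat B X Y) \<Longrightarrow>
     FA (hF F (X, Y)) (RUn B X Y f)
       \<cdot>\<^bsub>Hcat B' (h0 F X) (h0 F Y)\<^esub> hm F (X, X, Y, f, Unit1 B X)
       \<cdot>\<^bsub>Hcat B' (h0 F X) (h0 F Y)\<^esub>
       comp2 B' (h0 F X) (h0 F X) (h0 F Y)
         (Ide (Hcat B' (h0 F X) (h0 F Y)) (FO (hF F (X, Y)) f)) (hu F X)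
     = RUn B' (h0 F X) (h0 F Y) (FO (hF F (X, Y)) f)"
  using F unfolding homomorphism_def by (elim conjE) simp

end

section \<open>Identity and composite homomorphisms\<close>

lemma id_func_simps [simp]:
  "A \<in> Ob C \<Longrightarrow> FO (id_func C) A = A" "f \<in> Ar C \<Longrightarrow> FA (id_func C) f = f"
  by (simp_all add: id_func_def)

lemma comp_func_simps [simp]:
  "A \<in> Ob C \<Longrightarrow> FO (comp_func C G F) A = FO G (FO F A)"
  "f \<in> Ar C \<Longrightarrow> FA (comp_func C G F) f = FA G (FA F f)"
  by (simp_all add: comp_func_def compose_def)

lemma id_bihom_simps [simp]:
  "X \<in> Obj B \<Longrightarrow> h0 (id_bihom B) X = X"
  "X \<in> Obj B \<Longrightarrow> Y \<in> Obj B \<Longrightarrow> hF (id_bihom B) (X, Y) = id_func (Hcat B X Y)"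
  "(X, Y, Z, g, f) \<in> composable B \<Longrightarrow>
     hm (id_bihom B) (X, Y, Z, g, f) = Ide (Hcat B X Z) (comp1 B X Y Z g f)"
  "X \<in> Obj B \<Longrightarrow> hu (id_bihom B) X = Ide (Hcat B X X) (Unit1 B X)"
  by (simp_all add: id_bihom_def)

lemma comp_bihom_simps [simp]:
  "X \<in> Obj B \<Longrightarrow> h0 (comp_bihom B B'' G F) X = h0 G (h0 F X)"
  "X \<in> Obj B \<Longrightarrow> Y \<in> Obj B \<Longrightarrow> hF (comp_bihom B B'' G F) (X, Y)
     = comp_func (Hcat B X Y) (hF G (h0 F X, h0 F Y)) (hF F (X, Y))"
  "(X, Y, Z, g, f) \<in> composable B \<Longrightarrow> hm (comp_bihom B B'' G F) (X, Y, Z, g, f)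
     = FA (hF G (h0 F X, h0 F Z)) (hm F (X, Y, Z, g, f))
       \<cdot>\<^bsub>Hcat B'' (h0 G (h0 F X)) (h0 G (h0 F Z))\<^esub>
       hm G (h0 F X, h0 F Y, h0 F Z, FO (hF F (Y, Z)) g, FO (hF F (X, Y)) f)"
  "X \<in> Obj B \<Longrightarrow> hu (comp_bihom B B'' G F) X = FA (hF G (h0 F X, h0 F X)) (hu F X)
     \<cdot>\<^bsub>Hcat B'' (h0 G (h0 F X)) (h0 G (h0 F X))\<^esub> hu G (h0 F X)"
  by (simp_all add: comp_bihom_def compose_def)

lemma ext_bihom_id_bihom: "ext_bihom B (id_bihom B)"
  by (simp add: ext_bihom_def ext_func_id_func) (simp add: id_bihom_def)

lemma ext_bihom_comp_bihom: "ext_bihom B (comp_bihom B B'' G F)"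
  by (simp add: ext_bihom_def ext_func_comp_func) (simp add: comp_bihom_def)

lemma bihom_eqI:
  fixes F G :: "('o, 'f, 't, 'p, 'g, 's) bihom"
  assumes F: "ext_bihom B F" and G: "ext_bihom B G"
    and "\<And>X. X \<in> Obj B \<Longrightarrow> h0 F X = h0 G X"
    and "\<And>X Y. X \<in> Obj B \<Longrightarrow> Y \<in> Obj B \<Longrightarrow> hF F (X, Y) = hF G (X, Y)"
    and hm: "\<And>X Y Z g f. (X, Y, Z, g, f) \<in> composable B \<Longrightarrow> hm F (X, Y, Z, g, f) = hm G (X, Y, Z, g, f)"
    and "\<And>X. X \<in> Obj B \<Longrightarrow> hu F X = hu G X"
  shows "F = G"
proof -
  have "h0 F = h0 G" "hu F = hu G"
    using assms by (auto intro!: extensionalityI[of _ "Obj B"] simp: ext_bihom_def)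
  moreover have "hF F = hF G"
    using assms by (intro extensionalityI[of _ "Obj B \<times> Obj B"]) (auto simp: ext_bihom_def)
  moreover have "hm F = hm G"
    using F G hm by (intro extensionalityI[of _ "composable B"]) (auto simp: ext_bihom_def)
  ultimately show ?thesis by (cases F, cases G) simp
qed

lemma homomorphismI:
  fixes B :: "('o, 'f, 't) bicat" and B' :: "('p, 'g, 's) bicat"
  assumes "bicategory B" "bicategory B'"
    and "\<And>X. X \<in> Obj B \<Longrightarrow> h0 F X \<in> Obj B'"
    and "\<And>X Y. X \<in> Obj B \<Longrightarrow> Y \<in> Obj B \<Longrightarrow>
      is_functor (Hcat B X Y) (Hcat B' (h0 F X) (h0 F Y)) (hF F (X, Y))"
    and "\<And>X Y Z g f. (X, Y, Z, g, f) \<in> composable B \<Longrightarrow>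
      hm F (X, Y, Z, g, f) \<in> iso_hom (Hcat B' (h0 F X) (h0 F Z))
        (comp1 B' (h0 F X) (h0 F Y) (h0 F Z) (FO (hF F (Y, Z)) g) (FO (hF F (X, Y)) f))
        (FO (hF F (X, Z)) (comp1 B X Y Z g f))"
    and "\<And>X. X \<in> Obj B \<Longrightarrow>
      hu F X \<in> iso_hom (Hcat B' (h0 F X) (h0 F X)) (Unit1 B' (h0 F X)) (FO (hF F (X, X)) (Unit1 B X))"
    and "\<And>X Y Z \<tau> \<sigma> g g' f f'. X \<in> Obj B \<Longrightarrow> Y \<in> Obj B \<Longrightarrow> Z \<in> Obj B \<Longrightarrow>
      \<tau> \<in> Hom (Hcat B Y Z) g g' \<Longrightarrow> \<sigma> \<in> Hom (Hcat B X Y) f f' \<Longrightarrow>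
      hm F (X, Y, Z, g', f') \<cdot>\<^bsub>Hcat B' (h0 F X) (h0 F Z)\<^esub>
        comp2 B' (h0 F X) (h0 F Y) (h0 F Z) (FA (hF F (Y, Z)) \<tau>) (FA (hF F (X, Y)) \<sigma>)
      = FA (hF F (X, Z)) (comp2 B X Y Z \<tau> \<sigma>) \<cdot>\<^bsub>Hcat B' (h0 F X) (h0 F Z)\<^esub> hm F (X, Y, Z, g, f)"
    and "\<And>X Y Z W h g f. X \<in> Obj B \<Longrightarrow> Y \<in> Obj B \<Longrightarrow> Z \<in> Obj B \<Longrightarrow> W \<in> Obj B \<Longrightarrow>
      h \<in> Ob (Hcat B Z W) \<Longrightarrow> g \<in> Ob (Hcat B Y Z) \<Longrightarrow> f \<in> Ob (Hcat B X Y) \<Longrightarrow>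
      FA (hF F (X, W)) (Assoc B X Y Z W h g f)
        \<cdot>\<^bsub>Hcat B' (h0 F X) (h0 F W)\<^esub> hm F (X, Y, W, comp1 B Y Z W h g, f)
        \<cdot>\<^bsub>Hcat B' (h0 F X) (h0 F W)\<^esub>
        comp2 B' (h0 F X) (h0 F Y) (h0 F W)
          (hm F (Y, Z, W, h, g)) (Ide (Hcat B' (h0 F X) (h0 F Y)) (FO (hF F (X, Y)) f))
      = hm F (X, Z, W, h, comp1 B X Y Z g f)
        \<cdot>\<^bsub>Hcat B' (h0 F X) (h0 F W)\<^esub>
        comp2 B' (h0 F X) (h0 F Z) (h0 F W)
          (Ide (Hcat B' (h0 F Z) (h0 F W)) (FO (hF F (Z, W)) h)) (hm F (X, Y, Z, g, f))
        \<cdot>\<^bsub>Hcat B' (h0 F X) (h0 F W)\<^esub>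
        Assoc B' (h0 F X) (h0 F Y) (h0 F Z) (h0 F W)
          (FO (hF F (Z, W)) h) (FO (hF F (Y, Z)) g) (FO (hF F (X, Y)) f)"
    and "\<And>X Y f. X \<in> Obj B \<Longrightarrow> Y \<in> Obj B \<Longrightarrow> f \<in> Ob (Hcat B X Y) \<Longrightarrow>
      FA (hF F (X, Y)) (LUn B X Y f)
        \<cdot>\<^bsub>Hcat B' (h0 F X) (h0 F Y)\<^esub> hm F (X, Y, Y, Unit1 B Y, f)
        \<cdot>\<^bsub>Hcat B' (h0 F X) (h0 F Y)\<^esub>
        comp2 B' (h0 F X) (h0 F Y) (h0 F Y)
          (hu F Y) (Ide (Hcat B' (h0 F X) (h0 F Y)) (FO (hF F (X, Y)) f))
      = LUn B' (h0 F X) (h0 F Y) (FO (hF F (X, Y)) f)"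
    and "\<And>X Y f. X \<in> Obj B \<Longrightarrow> Y \<in> Obj B \<Longrightarrow> f \<in> Ob (Hcat B X Y) \<Longrightarrow>
      FA (hF F (X, Y)) (RUn B X Y f)
        \<cdot>\<^bsub>Hcat B' (h0 F X) (h0 F Y)\<^esub> hm F (X, X, Y, f, Unit1 B X)
        \<cdot>\<^bsub>Hcat B' (h0 F X) (h0 F Y)\<^esub>
        comp2 B' (h0 F X) (h0 F X) (h0 F Y)
          (Ide (Hcat B' (h0 F X) (h0 F Y)) (FO (hF F (X, Y)) f)) (hu F X)
      = RUn B' (h0 F X) (h0 F Y) (FO (hF F (X, Y)) f)"
  shows "homomorphism B B' F"
  unfolding homomorphism_def split_paired_Ball_Sigma
  by (intro conjI ballI; (clarsimp simp only: prod.case)?; (intro assms Ar_in_Hom)?; assumption?)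

text \<open>\<open>B\<close> is an arbitrary bicategory, but the structure cells of the identity
  homomorphism are identities. Each coherence law thus says that an associator or unit isomorphism
  is unchanged by composing it with identities.\<close>

lemma homomorphism_id_bihom:
  fixes B :: "('o, 'f, 't) bicat"
  assumes B: "bicategory B"
  shows "homomorphism B B (id_bihom B)"
proof -
  note K = bicategory_Hcat[OF B] and I = bicategory_Unit1[OF B] and T = bicategory_HComp[OF B]
  note T1 = bifunctor_Ob[OF T] and T2 = bifunctor_Hom[OF T] and Ti = bifunctor_Ide[OF T]
  have ide: "Ide (Hcat B X Y) f \<cdot>\<^bsub>Hcat B X Y\<^esub> Ide (Hcat B X Y) f = Ide (Hcat B X Y) f"
    if "X \<in> Obj B" "Y \<in> Obj B" "f \<in> Ob (Hcat B X Y)" for X Y f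
    using that by (metis K Ide_in_Hom Cmp_Ide)
  show ?thesis
  proof (rule homomorphismI[OF B B], goal_cases)
    case (5 X Y Z \<tau> \<sigma> g g' f f')
    note o = 5(1-3) and h = 5(4,5)
    note t = T2[OF o h] and ob = Hom_Ob[OF K[OF o(2,3)] h(1)] Hom_Ob[OF K[OF o(1,2)] h(2)]
    have "\<tau> \<in> Ar (Hcat B Y Z)" "\<sigma> \<in> Ar (Hcat B X Y)" "comp2 B X Y Z \<tau> \<sigma> \<in> Ar (Hcat B X Z)"
      using h t by (simp_all add: Hom_iff)
    then show ?case
      using o ob Ide_Cmp[OF K t] Cmp_Ide[OF K t] by (simp add: composable_iff)
  next
    case (6 X Y Z W h g f)
    note a = bicategory_Assoc[OF B 6, THEN iso_hom_in_Hom[OF K[OF 6(1,4)]]]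
    then have "Assoc B X Y Z W h g f \<in> Ar (Hcat B X W)"
      by (simp add: Hom_iff)
    then show ?case
      using 6 Ide_Cmp[OF K a] Cmp_Ide[OF K a] by (simp add: composable_iff T1 Ti ide)
  next
    case (7 X Y f)
    note l = bicategory_LUn[OF B 7, THEN iso_hom_in_Hom[OF K[OF 7(1,2)]]]
    then have "LUn B X Y f \<in> Ar (Hcat B X Y)"
      by (simp add: Hom_iff)
    then show ?case
      using 7 Cmp_Ide[OF K l] by (simp add: composable_iff T1 Ti ide I)
  next
    case (8 X Y f)
    note r = bicategory_RUn[OF B 8, THEN iso_hom_in_Hom[OF K[OF 8(1,2)]]]
    then have "RUn B X Y f \<in> Ar (Hcat B X Y)"
      by (simp add: Hom_iff)
    then show ?case
      using 8 Cmp_Ide[OF K r] by (simp add: composable_iff T1 Ti ide I)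
  qed (auto simp: composable_iff K I T1 Ide_iso is_functor_id_func)
qed

text \<open>
  In both lemmas the two bracketed products come from the structure cells of a composite homomorphism,
  and the hypothesis \<open>eq\<close> is a naturality square of the outer factor.
\<close>

lemma Cmp_slide:
  assumes K: "category K"
    and "y \<in> Hom K A0 A1" "x \<in> Hom K A1 A2" "P \<in> Hom K A2 A3" "p \<in> Hom K A3 A4" "a \<in> Hom K A4 A5"
    and "P0 \<in> Hom K A1 A6" "u \<in> Hom K A6 A3"
    and eq: "P \<cdot>\<^bsub>K\<^esub> x = u \<cdot>\<^bsub>K\<^esub> P0"
  shows "a \<cdot>\<^bsub>K\<^esub> (p \<cdot>\<^bsub>K\<^esub> P) \<cdot>\<^bsub>K\<^esub> (x \<cdot>\<^bsub>K\<^esub> y) = (a \<cdot>\<^bsub>K\<^esub> p \<cdot>\<^bsub>K\<^esub> u) \<cdot>\<^bsub>K\<^esub> (P0 \<cdot>\<^bsub>K\<^esub> y)"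
proof -
  note h = assms(2-8)
  note c = Cmp_in_Hom[OF K] and as = Cmp_assoc[OF K]
  have "(p \<cdot>\<^bsub>K\<^esub> P) \<cdot>\<^bsub>K\<^esub> (x \<cdot>\<^bsub>K\<^esub> y) = p \<cdot>\<^bsub>K\<^esub> ((P \<cdot>\<^bsub>K\<^esub> x) \<cdot>\<^bsub>K\<^esub> y)"
    using as[OF c[OF h(1,2)] h(3,4)] as[OF h(1-3)] by simp
  also have "\<dots> = (p \<cdot>\<^bsub>K\<^esub> u) \<cdot>\<^bsub>K\<^esub> (P0 \<cdot>\<^bsub>K\<^esub> y)"
    using as[OF h(1,6,7)] as[OF c[OF h(1,6)] h(7,4)] by (simp add: eq)
  finally show ?thesis
    using as[OF c[OF h(1,6)] c[OF h(7,4)] h(5)] by simp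
qed

lemma Cmp_slide':
  assumes K: "category K"
    and "a \<in> Hom K A0 A1" "z \<in> Hom K A1 A2" "w \<in> Hom K A2 A3" "R \<in> Hom K A3 A4" "r \<in> Hom K A4 A5"
    and "R0 \<in> Hom K A2 A6" "v \<in> Hom K A6 A4"
    and eq: "R \<cdot>\<^bsub>K\<^esub> w = v \<cdot>\<^bsub>K\<^esub> R0"
  shows "(r \<cdot>\<^bsub>K\<^esub> R) \<cdot>\<^bsub>K\<^esub> (w \<cdot>\<^bsub>K\<^esub> z) \<cdot>\<^bsub>K\<^esub> a = r \<cdot>\<^bsub>K\<^esub> v \<cdot>\<^bsub>K\<^esub> R0 \<cdot>\<^bsub>K\<^esub> z \<cdot>\<^bsub>K\<^esub> a"
proof -
  note h = assms(2-8)
  note c = Cmp_in_Hom[OF K] and as = Cmp_assoc[OF K]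
  have "(r \<cdot>\<^bsub>K\<^esub> R) \<cdot>\<^bsub>K\<^esub> (w \<cdot>\<^bsub>K\<^esub> z) \<cdot>\<^bsub>K\<^esub> a = r \<cdot>\<^bsub>K\<^esub> R \<cdot>\<^bsub>K\<^esub> w \<cdot>\<^bsub>K\<^esub> z \<cdot>\<^bsub>K\<^esub> a"
    using as[OF c[OF h(1) c[OF h(2,3)]] h(4,5)] as[OF h(1-3)] by simp
  also have "R \<cdot>\<^bsub>K\<^esub> w \<cdot>\<^bsub>K\<^esub> z \<cdot>\<^bsub>K\<^esub> a = v \<cdot>\<^bsub>K\<^esub> R0 \<cdot>\<^bsub>K\<^esub> z \<cdot>\<^bsub>K\<^esub> a"
    using as[OF c[OF h(1,2)] h(3,4)] as[OF c[OF h(1,2)] h(6,7)] by (simp add: eq)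
  finally show ?thesis .
qed

text \<open>Whiskering respects vertical composition, by interchange and
  \<open>Ide \<cdot> Ide = Ide\<close>. It serves to split the whiskered structure cells of a
  composite homomorphism, which are themselves products.\<close>

lemma bifunctor_Cmp_left:
  assumes T: "is_functor (prod_cat C D) E T" and D: "category D" "A \<in> Ob D"
    and "f \<in> Hom C X Y" "f' \<in> Hom C Y Z"
  shows "FA T (f' \<cdot>\<^bsub>C\<^esub> f, Ide D A) = FA T (f', Ide D A) \<cdot>\<^bsub>E\<^esub> FA T (f, Ide D A)"
  using bifunctor_Cmp[OF T assms(4,5) Ide_in_Hom[OF D] Ide_in_Hom[OF D]] Cmp_Ide[OF D(1) Ide_in_Hom[OF D]]
  by simp

lemma bifunctor_Cmp_right:
  assumes T: "is_functor (prod_cat C D) E T" and C: "category C" "A \<in> Ob C"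
    and "f \<in> Hom D X Y" "f' \<in> Hom D Y Z"
  shows "FA T (Ide C A, f' \<cdot>\<^bsub>D\<^esub> f) = FA T (Ide C A, f') \<cdot>\<^bsub>E\<^esub> FA T (Ide C A, f)"
  using bifunctor_Cmp[OF T Ide_in_Hom[OF C] Ide_in_Hom[OF C] assms(4,5)] Cmp_Ide[OF C(1) Ide_in_Hom[OF C]]
  by simp

text \<open>A structure cell of the composite is the cell of \<open>G\<close> at the images followed
  by the image under \<open>G\<close> of the cell of \<open>F\<close>. Each coherence law is the
  image under \<open>G\<close> of the law for \<open>F\<close>, pasted to the law for
  \<open>G\<close> along a naturality square of the cells of \<open>G\<close>.\<close>

lemma homomorphism_comp_bihom:
  fixes B :: "('o, 'f, 't) bicat" and B' :: "('p, 'g, 's) bicat" and B'' :: "('q, 'k, 'r) bicat"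
  assumes F: "homomorphism B B' F" and G: "homomorphism B' B'' G"
  shows "homomorphism B B'' (comp_bihom B B'' G F)"
proof -
  note b = homomorphism_dom[OF F] and b' = homomorphism_cod[OF F] and b'' = homomorphism_cod[OF G]
  note K = bicategory_Hcat[OF b] and K' = bicategory_Hcat[OF b'] and K'' = bicategory_Hcat[OF b'']
  note T = bicategory_HComp[OF b] and T' = bicategory_HComp[OF b'] and T'' = bicategory_HComp[OF b'']
  note F0 = homomorphism_Obj[OF F] and G0 = homomorphism_Obj[OF G]
  note FF = homomorphism_functor[OF F] and GF = homomorphism_functor[OF G]
  note F1 = functor_Ob[OF FF] and G1 = functor_Ob[OF GF]
  note F2 = functor_Hom[OF FF] and G2 = functor_Hom[OF GF]
  have hmF: "hm F (X, Y, Z, g, f) \<in> Hom (Hcat B' (h0 F X) (h0 F Z))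
      (comp1 B' (h0 F X) (h0 F Y) (h0 F Z) (FO (hF F (Y, Z)) g) (FO (hF F (X, Y)) f))
      (FO (hF F (X, Z)) (comp1 B X Y Z g f))"
    if "(X, Y, Z, g, f) \<in> composable B" for X Y Z g f
    using homomorphism_hm[OF F that] by (simp add: iso_hom_def)
  have hmG: "hm G (X, Y, Z, g, f) \<in> Hom (Hcat B'' (h0 G X) (h0 G Z))
      (comp1 B'' (h0 G X) (h0 G Y) (h0 G Z) (FO (hF G (Y, Z)) g) (FO (hF G (X, Y)) f))
      (FO (hF G (X, Z)) (comp1 B' X Y Z g f))"
    if "(X, Y, Z, g, f) \<in> composable B'" for X Y Z g f
    using homomorphism_hm[OF G that] by (simp add: iso_hom_def)
  have huF: "hu F X \<in> Hom (Hcat B' (h0 F X) (h0 F X)) (Unit1 B' (h0 F X)) (FO (hF F (X, X)) (Unit1 B X))"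
    if "X \<in> Obj B" for X
    using homomorphism_hu[OF F that] by (simp add: iso_hom_def)
  have huG: "hu G X \<in> Hom (Hcat B'' (h0 G X) (h0 G X)) (Unit1 B'' (h0 G X)) (FO (hF G (X, X)) (Unit1 B' X))"
    if "X \<in> Obj B'" for X
    using homomorphism_hu[OF G that] by (simp add: iso_hom_def)
  show ?thesis
  proof (rule homomorphismI[OF b b''], goal_cases)
    case (1 X)
    then show ?case by (simp add: F0 G0)
  next
    case (2 X Y)
    then show ?case by (simp add: is_functor_comp_func[OF FF GF] F0)
  next
    case (3 X Y Z g f)
    then have o: "X \<in> Obj B" "Y \<in> Obj B" "Z \<in> Obj B" "g \<in> Ob (Hcat B Y Z)" "f \<in> Ob (Hcat B X Y)"
      by (simp_all add: composable_iff)
    then have "(h0 F X, h0 F Y, h0 F Z, FO (hF F (Y, Z)) g, FO (hF F (X, Y)) f) \<in> composable B'"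
      by (simp add: composable_iff F0 F1)
    from Cmp_iso[OF K'' homomorphism_hm[OF G this] functor_iso[OF GF homomorphism_hm[OF F 3]]]
    show ?case
      using o 3 by (simp add: F0 G0 bifunctor_Ob[OF T])
  next
    case (4 X)
    from Cmp_iso[OF K'' homomorphism_hu[OF G] functor_iso[OF GF homomorphism_hu[OF F 4]]] 4
    show ?case by (simp add: F0 G0 bicategory_Unit1[OF b])
  next
    case (5 X Y Z \<tau> \<sigma> g g' f f')
    note o = 5(1-3) and h = 5(4,5)
    note o' = o[THEN F0] note o'' = o'[THEN G0]
    note h' = F2[OF o(2,3) h(1)] F2[OF o(1,2) h(2)]
    note h'' = G2[OF o'(2,3) h'(1)] G2[OF o'(1,2) h'(2)]
    note t = bifunctor_Hom[OF T[OF o] h] and t' = bifunctor_Hom[OF T'[OF o'] h']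
      and t'' = bifunctor_Hom[OF T''[OF o''] h'']
    note ob = Hom_Ob[OF K[OF o(2,3)] h(1)] Hom_Ob[OF K[OF o(1,2)] h(2)]
    have c: "(X, Y, Z, g, f) \<in> composable B" "(X, Y, Z, g', f') \<in> composable B"
      using o ob by (simp_all add: composable_iff)
    have c': "(h0 F X, h0 F Y, h0 F Z, FO (hF F (Y, Z)) g, FO (hF F (X, Y)) f) \<in> composable B'"
      "(h0 F X, h0 F Y, h0 F Z, FO (hF F (Y, Z)) g', FO (hF F (X, Y)) f') \<in> composable B'"
      using o ob by (simp_all add: composable_iff F0 F1)
    have ar: "\<tau> \<in> Ar (Hcat B Y Z)" "\<sigma> \<in> Ar (Hcat B X Y)" "comp2 B X Y Z \<tau> \<sigma> \<in> Ar (Hcat B X Z)"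
      using h t by (simp_all add: Hom_iff)
    let ?K = "Hcat B'' (h0 G (h0 F X)) (h0 G (h0 F Z))" and ?G = "FA (hF G (h0 F X, h0 F Z))"
    let ?p = "?G (hm F (X, Y, Z, g, f))" and ?p' = "?G (hm F (X, Y, Z, g', f'))"
    let ?P = "hm G (h0 F X, h0 F Y, h0 F Z, FO (hF F (Y, Z)) g, FO (hF F (X, Y)) f)"
      and ?P' = "hm G (h0 F X, h0 F Y, h0 F Z, FO (hF F (Y, Z)) g', FO (hF F (X, Y)) f')"
    note k = K''[OF o''(1,3)]
    note gp = G2[OF o'(1,3) hmF[OF c(1)]] and gp' = G2[OF o'(1,3) hmF[OF c(2)]]
    note P = hmG[OF c'(1)] and P' = hmG[OF c'(2)]
    let ?\<tau>\<sigma> = "comp2 B'' (h0 G (h0 F X)) (h0 G (h0 F Y)) (h0 G (h0 F Z))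
       (FA (hF G (h0 F Y, h0 F Z)) (FA (hF F (Y, Z)) \<tau>)) (FA (hF G (h0 F X, h0 F Y)) (FA (hF F (X, Y)) \<sigma>))"
    let ?\<tau>\<sigma>' = "comp2 B' (h0 F X) (h0 F Y) (h0 F Z) (FA (hF F (Y, Z)) \<tau>) (FA (hF F (X, Y)) \<sigma>)"
    \<comment> \<open>Two naturality squares are pasted: that of \<open>G\<close> at the images of
      the 2-cells, then the image under \<open>G\<close> of that of \<open>F\<close>.\<close>
    have "(?p' \<cdot>\<^bsub>?K\<^esub> ?P') \<cdot>\<^bsub>?K\<^esub> ?\<tau>\<sigma> = ?p' \<cdot>\<^bsub>?K\<^esub> (?G ?\<tau>\<sigma>' \<cdot>\<^bsub>?K\<^esub> ?P)"
      using Cmp_assoc[OF k t'' P' gp'] homomorphism_hm_natural[OF G o' h'] by simp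
    also have "\<dots> = ?G (FA (hF F (X, Z)) (comp2 B X Y Z \<tau> \<sigma>) \<cdot>\<^bsub>Hcat B' (h0 F X) (h0 F Z)\<^esub> hm F (X, Y, Z, g, f))
        \<cdot>\<^bsub>?K\<^esub> ?P"
      using Cmp_assoc[OF k P G2[OF o'(1,3) t'] gp'] homomorphism_hm_natural[OF F o h]
        functor_Cmp[OF GF[OF o'(1,3)] t' hmF[OF c(2)]] by simp
    also have "\<dots> = ?G (FA (hF F (X, Z)) (comp2 B X Y Z \<tau> \<sigma>)) \<cdot>\<^bsub>?K\<^esub> (?p \<cdot>\<^bsub>?K\<^esub> ?P)"
      using Cmp_assoc[OF k P gp G2[OF o'(1,3) F2[OF o(1,3) t]]]
        functor_Cmp[OF GF[OF o'(1,3)] hmF[OF c(1)] F2[OF o(1,3) t]] by simp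
    finally show ?case
      using o c ar by simp
  next
    case (6 X Y Z W h g f)
    note o = 6
    note o' = o(1-4)[THEN F0] note o'' = o'[THEN G0]
    let ?X' = "h0 F X" and ?Y' = "h0 F Y" and ?Z' = "h0 F Z" and ?W' = "h0 F W"
    let ?h' = "FO (hF F (Z, W)) h" and ?g' = "FO (hF F (Y, Z)) g" and ?f' = "FO (hF F (X, Y)) f"
    let ?X'' = "h0 G ?X'" and ?Y'' = "h0 G ?Y'" and ?Z'' = "h0 G ?Z'" and ?W'' = "h0 G ?W'"
    let ?h'' = "FO (hF G (?Z', ?W')) ?h'" and ?f'' = "FO (hF G (?X', ?Y')) ?f'"
    have o1: "?h' \<in> Ob (Hcat B' ?Z' ?W')" "?g' \<in> Ob (Hcat B' ?Y' ?Z')" "?f' \<in> Ob (Hcat B' ?X' ?Y')"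
      using o by (simp_all add: F1)
    have o2: "?h'' \<in> Ob (Hcat B'' ?Z'' ?W'')" "FO (hF G (?Y', ?Z')) ?g' \<in> Ob (Hcat B'' ?Y'' ?Z'')"
      "?f'' \<in> Ob (Hcat B'' ?X'' ?Y'')"
      using o1 o' by (simp_all add: G1)
    let ?hg = "comp1 B Y Z W h g" and ?gf = "comp1 B X Y Z g f"
    let ?hg' = "comp1 B' ?Y' ?Z' ?W' ?h' ?g'" and ?gf' = "comp1 B' ?X' ?Y' ?Z' ?g' ?f'"
    have c: "(X, Y, W, ?hg, f) \<in> composable B" "(Y, Z, W, h, g) \<in> composable B"
      "(X, Z, W, h, ?gf) \<in> composable B" "(X, Y, Z, g, f) \<in> composable B"
      using o by (simp_all add: composable_iff bifunctor_Ob[OF T])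
    have c': "(?X', ?Y', ?W', FO (hF F (Y, W)) ?hg, ?f') \<in> composable B'"
      "(?X', ?Y', ?W', ?hg', ?f') \<in> composable B'" "(?Y', ?Z', ?W', ?h', ?g') \<in> composable B'"
      "(?X', ?Z', ?W', ?h', FO (hF F (X, Z)) ?gf) \<in> composable B'"
      "(?X', ?Z', ?W', ?h', ?gf') \<in> composable B'" "(?X', ?Y', ?Z', ?g', ?f') \<in> composable B'"
      using o o' o1 by (simp_all add: composable_iff bifunctor_Ob[OF T] bifunctor_Ob[OF T'] F1)
    note k' = K'[OF o'(1,4)] and k = K''[OF o''(1,4)] and Gf = GF[OF o'(1,4)]
    note fi = Ide_in_Hom[OF K'[OF o'(1,2)] o1(3)] and hi = Ide_in_Hom[OF K'[OF o'(3,4)] o1(1)]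
    note fi'' = Ide_in_Hom[OF K''[OF o''(1,2)] o2(3)] and hi'' = Ide_in_Hom[OF K''[OF o''(3,4)] o2(1)]
    note a = F2[OF o(1,4) bicategory_Assoc[OF b o, THEN iso_hom_in_Hom[OF K[OF o(1,4)]]]]
    note a' = bicategory_Assoc[OF b' o' o1, THEN iso_hom_in_Hom[OF k']]
    note a'' = bicategory_Assoc[OF b'' o'' o2, THEN iso_hom_in_Hom[OF k]]
    \<comment> \<open>Small letters are the cells of \<open>F\<close> at \<open>(hg, f)\<close>,
      \<open>(h, g)\<close>, \<open>(h, gf)\<close> and \<open>(g, f)\<close>, where
      \<open>hg\<close> and \<open>gf\<close> are composites. Capitals are cells of
      \<open>G\<close>: \<open>P\<close> and \<open>R\<close> use the images under \<open>F\<close>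
      of these composites, \<open>P0\<close> and \<open>R0\<close> the composites of the
      images.\<close>
    note p = hmF[OF c(1)] and q = hmF[OF c(2)] and r = hmF[OF c(3)] and s = hmF[OF c(4)]
    note P = hmG[OF c'(1)] and P0 = hmG[OF c'(2)] and Q = hmG[OF c'(3)]
      and R = hmG[OF c'(4)] and R0 = hmG[OF c'(5)] and S = hmG[OF c'(6)]
    note q1 = bifunctor_Hom[OF T'[OF o'(1,2,4)] q fi] and s1 = bifunctor_Hom[OF T'[OF o'(1,3,4)] hi s]
    note Gq = G2[OF o'(2,4) q] and Gs = G2[OF o'(1,3) s]
    note Gq1 = bifunctor_Hom[OF T''[OF o''(1,2,4)] Gq fi''] and Gs1 = bifunctor_Hom[OF T''[OF o''(1,3,4)] hi'' Gs]
    note Q1 = bifunctor_Hom[OF T''[OF o''(1,2,4)] Q fi''] and S1 = bifunctor_Hom[OF T''[OF o''(1,3,4)] hi'' S]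
    \<comment> \<open>On the left side, naturality of the cells of \<open>G\<close> along
      \<open>q\<close> whiskered with an identity replaces \<open>P\<close> by \<open>P0\<close>. On
      the right side, naturality along \<open>s\<close> replaces \<open>R\<close> by
      \<open>R0\<close>.\<close>
    note slide = Cmp_slide[OF k Q1 Gq1 P functor_Hom[OF Gf p] functor_Hom[OF Gf a] P0 functor_Hom[OF Gf q1]
        homomorphism_hm_natural[OF G o'(1,2,4) q fi, unfolded functor_Ide[OF GF[OF o'(1,2)] o1(3)]]]
    note slide' = Cmp_slide'[OF k a'' S1 Gs1 R functor_Hom[OF Gf r] R0 functor_Hom[OF Gf s1]
        homomorphism_hm_natural[OF G o'(1,3,4) hi s, unfolded functor_Ide[OF GF[OF o'(3,4)] o1(1)]]]
    \<comment> \<open>The associativity law of \<open>F\<close>, transported by \<open>G\<close> and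
      split into separate factors, so that it matches the factors exposed by the two slides.\<close>
    note Fcoh = arg_cong[OF homomorphism_Assoc[OF F o], of "FA (hF G (?X', ?W'))",
        unfolded functor_Cmp[OF Gf Cmp_in_Hom[OF k' q1 p] a] functor_Cmp[OF Gf q1 p]
          functor_Cmp[OF Gf Cmp_in_Hom[OF k' a' s1] r] functor_Cmp[OF Gf a' s1]]
    note Gcoh = homomorphism_Assoc[OF G o' o1]
    note reassoc = Cmp_assoc[OF k Cmp_in_Hom[OF k Q1 P0] functor_Hom[OF Gf a'] functor_Hom[OF Gf s1]]
      Cmp_assoc[OF k Cmp_in_Hom[OF k Q1 P0] Cmp_in_Hom[OF k functor_Hom[OF Gf a'] functor_Hom[OF Gf s1]]
        functor_Hom[OF Gf r]]
    have ar: "Assoc B X Y Z W h g f \<in> Ar (Hcat B X W)"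
      using bicategory_Assoc[OF b o, THEN iso_hom_in_Hom[OF K[OF o(1,4)]]] by (simp add: Hom_iff)
    show ?case
      using o c ar slide slide' Fcoh Gcoh reassoc
      by (simp add: bifunctor_Cmp_left[OF T''[OF o''(1,2,4)] K''[OF o''(1,2)] o2(3) Q Gq]
          bifunctor_Cmp_right[OF T''[OF o''(1,3,4)] K''[OF o''(3,4)] o2(1) S Gs])
  next
    case (7 X Y f)
    note o = 7
    note o' = o(1-2)[THEN F0] note o'' = o'[THEN G0]
    let ?X' = "h0 F X" and ?Y' = "h0 F Y" and ?f' = "FO (hF F (X, Y)) f"
    let ?f'' = "FO (hF G (?X', ?Y')) ?f'"
    note i = bicategory_Unit1[OF b o(2)] and i' = bicategory_Unit1[OF b' o'(2)]
    have f': "?f' \<in> Ob (Hcat B' ?X' ?Y')" and f'': "?f'' \<in> Ob (Hcat B'' (h0 G ?X') (h0 G ?Y'))"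
      using o o' by (simp_all add: F1 G1)
    have c: "(X, Y, Y, Unit1 B Y, f) \<in> composable B"
      "(?X', ?Y', ?Y', FO (hF F (Y, Y)) (Unit1 B Y), ?f') \<in> composable B'"
      "(?X', ?Y', ?Y', Unit1 B' ?Y', ?f') \<in> composable B'"
      using o o' f' i i' by (simp_all add: composable_iff F1)
    note k' = K'[OF o'] and k = K''[OF o''] and Gf = GF[OF o']
    note fi = Ide_in_Hom[OF k' f'] and fi'' = Ide_in_Hom[OF k f'']
    note l = bicategory_LUn[OF b o, THEN iso_hom_in_Hom[OF K[OF o(1,2)]]]
    note Fl = F2[OF o(1,2) l] and p = hmF[OF c(1)] and P = hmG[OF c(2)] and P0 = hmG[OF c(3)]
    note u = huF[OF o(2)] and v = huG[OF o'(2)]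
    note Gu = G2[OF o'(2,2) u]
    note u1 = bifunctor_Hom[OF T'[OF o'(1,2,2)] u fi] and Gu1 = bifunctor_Hom[OF T''[OF o''(1,2,2)] Gu fi'']
      and v1 = bifunctor_Hom[OF T''[OF o''(1,2,2)] v fi'']
    \<comment> \<open>The right side of a unit law contains no structure cell, so a single slide
      suffices: along the unit cell of \<open>F\<close>, whiskered with \<open>?f'\<close>.\<close>
    note slide = Cmp_slide[OF k v1 Gu1 P functor_Hom[OF Gf p] functor_Hom[OF Gf Fl] P0 functor_Hom[OF Gf u1]
        homomorphism_hm_natural[OF G o'(1,2,2) u fi, unfolded functor_Ide[OF Gf f']]]
    note Fcoh = arg_cong[OF homomorphism_LUn[OF F o], of "FA (hF G (?X', ?Y'))",
        unfolded functor_Cmp[OF Gf Cmp_in_Hom[OF k' u1 p] Fl] functor_Cmp[OF Gf u1 p]]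
    have "LUn B X Y f \<in> Ar (Hcat B X Y)"
      using l by (simp add: Hom_iff)
    then show ?case
      using o c slide Fcoh homomorphism_LUn[OF G o' f']
      by (simp add: bifunctor_Cmp_left[OF T''[OF o''(1,2,2)] k f'' v Gu])
  next
    case (8 X Y f)
    note o = 8
    note o' = o(1-2)[THEN F0] note o'' = o'[THEN G0]
    let ?X' = "h0 F X" and ?Y' = "h0 F Y" and ?f' = "FO (hF F (X, Y)) f"
    let ?f'' = "FO (hF G (?X', ?Y')) ?f'"
    note i = bicategory_Unit1[OF b o(1)] and i' = bicategory_Unit1[OF b' o'(1)]
    have f': "?f' \<in> Ob (Hcat B' ?X' ?Y')" and f'': "?f'' \<in> Ob (Hcat B'' (h0 G ?X') (h0 G ?Y'))"
      using o o' by (simp_all add: F1 G1)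
    have c: "(X, X, Y, f, Unit1 B X) \<in> composable B"
      "(?X', ?X', ?Y', ?f', FO (hF F (X, X)) (Unit1 B X)) \<in> composable B'"
      "(?X', ?X', ?Y', ?f', Unit1 B' ?X') \<in> composable B'"
      using o o' f' i i' by (simp_all add: composable_iff F1)
    note k' = K'[OF o'] and k = K''[OF o''] and Gf = GF[OF o']
    note fi = Ide_in_Hom[OF k' f'] and fi'' = Ide_in_Hom[OF k f'']
    note r = bicategory_RUn[OF b o, THEN iso_hom_in_Hom[OF K[OF o(1,2)]]]
    note Fr = F2[OF o(1,2) r] and p = hmF[OF c(1)] and P = hmG[OF c(2)] and P0 = hmG[OF c(3)]
    note u = huF[OF o(1)] and v = huG[OF o'(1)]
    note Gu = G2[OF o'(1,1) u]
    note u1 = bifunctor_Hom[OF T'[OF o'(1,1,2)] fi u] and Gu1 = bifunctor_Hom[OF T''[OF o''(1,1,2)] fi'' Gu]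
      and v1 = bifunctor_Hom[OF T''[OF o''(1,1,2)] fi'' v]
    note slide = Cmp_slide[OF k v1 Gu1 P functor_Hom[OF Gf p] functor_Hom[OF Gf Fr] P0 functor_Hom[OF Gf u1]
        homomorphism_hm_natural[OF G o'(1,1,2) fi u, unfolded functor_Ide[OF Gf f']]]
    note Fcoh = arg_cong[OF homomorphism_RUn[OF F o], of "FA (hF G (?X', ?Y'))",
        unfolded functor_Cmp[OF Gf Cmp_in_Hom[OF k' u1 p] Fr] functor_Cmp[OF Gf u1 p]]
    have "RUn B X Y f \<in> Ar (Hcat B X Y)"
      using r by (simp add: Hom_iff)
    then show ?case
      using o c slide Fcoh homomorphism_RUn[OF G o' f']
      by (simp add: bifunctor_Cmp_right[OF T''[OF o''(1,1,2)] k f'' v Gu])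
  qed
qed

section \<open>The category of bicategories\<close>

lemma comp_bihom_id_right:
  assumes F: "homomorphism B B' F" and e: "ext_bihom B F"
  shows "comp_bihom B B' F (id_bihom B) = F"
proof (rule bihom_eqI[OF ext_bihom_comp_bihom e])
  note b = homomorphism_dom[OF F] and b' = homomorphism_cod[OF F]
  note K' = bicategory_Hcat[OF b'] and F0 = homomorphism_Obj[OF F] and FF = homomorphism_functor[OF F]
  fix X assume X: "X \<in> Obj B"
  then show "h0 (comp_bihom B B' F (id_bihom B)) X = h0 F X" by simp
  note u = homomorphism_hu[OF F X, THEN iso_hom_in_Hom[OF K'[OF F0[OF X] F0[OF X]]]]
  show "hu (comp_bihom B B' F (id_bihom B)) X = hu F X"
    using X Ide_Cmp[OF K'[OF F0[OF X] F0[OF X]] u] functor_Ide[OF FF[OF X X] bicategory_Unit1[OF b X]] by simp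
  fix Y assume Y: "Y \<in> Obj B"
  then show "hF (comp_bihom B B' F (id_bihom B)) (X, Y) = hF F (X, Y)"
    using X e by (simp add: ext_bihom_def comp_func_id_right)
next
  note b = homomorphism_dom[OF F] and b' = homomorphism_cod[OF F]
  note K' = bicategory_Hcat[OF b'] and F0 = homomorphism_Obj[OF F] and FF = homomorphism_functor[OF F]
  note T1 = bifunctor_Ob[OF bicategory_HComp[OF b]]
  fix X Y Z g f assume c: "(X, Y, Z, g, f) \<in> composable B"
  then have o: "X \<in> Obj B" "Y \<in> Obj B" "Z \<in> Obj B" "g \<in> Ob (Hcat B Y Z)" "f \<in> Ob (Hcat B X Y)"
    by (simp_all add: composable_iff)
  note h = homomorphism_hm[OF F c, THEN iso_hom_in_Hom[OF K'[OF o(1,3)[THEN F0]]]]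
  show "hm (comp_bihom B B' F (id_bihom B)) (X, Y, Z, g, f) = hm F (X, Y, Z, g, f)"
    using o c Ide_Cmp[OF K'[OF o(1,3)[THEN F0]] h] functor_Ide[OF FF[OF o(1,3)] T1[OF o]] by simp
qed

lemma comp_bihom_id_left:
  assumes F: "homomorphism B B' F" and e: "ext_bihom B F"
  shows "comp_bihom B B' (id_bihom B') F = F"
proof (rule bihom_eqI[OF ext_bihom_comp_bihom e])
  note K' = bicategory_Hcat[OF homomorphism_cod[OF F]] and F0 = homomorphism_Obj[OF F] and FF = homomorphism_functor[OF F]
  fix X assume X: "X \<in> Obj B"
  then show "h0 (comp_bihom B B' (id_bihom B') F) X = h0 F X" by (simp add: F0)
  note u = homomorphism_hu[OF F X, THEN iso_hom_in_Hom[OF K'[OF F0[OF X] F0[OF X]]]]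
  then have "hu F X \<in> Ar (Hcat B' (h0 F X) (h0 F X))" by (simp add: Hom_iff)
  then show "hu (comp_bihom B B' (id_bihom B') F) X = hu F X"
    using X Cmp_Ide[OF K'[OF F0[OF X] F0[OF X]] u] by (simp add: F0)
  fix Y assume Y: "Y \<in> Obj B"
  then show "hF (comp_bihom B B' (id_bihom B') F) (X, Y) = hF F (X, Y)"
    using X e comp_func_id_left[OF FF[OF X Y]] by (simp add: ext_bihom_def F0)
next
  note K' = bicategory_Hcat[OF homomorphism_cod[OF F]] and F0 = homomorphism_Obj[OF F] and FF = homomorphism_functor[OF F]
  note F1 = functor_Ob[OF FF]
  fix X Y Z g f assume c: "(X, Y, Z, g, f) \<in> composable B"
  then have o: "X \<in> Obj B" "Y \<in> Obj B" "Z \<in> Obj B" "g \<in> Ob (Hcat B Y Z)" "f \<in> Ob (Hcat B X Y)"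
    by (simp_all add: composable_iff)
  note h = homomorphism_hm[OF F c, THEN iso_hom_in_Hom[OF K'[OF o(1,3)[THEN F0]]]]
  then have "hm F (X, Y, Z, g, f) \<in> Ar (Hcat B' (h0 F X) (h0 F Z))" by (simp add: Hom_iff)
  then show "hm (comp_bihom B B' (id_bihom B') F) (X, Y, Z, g, f) = hm F (X, Y, Z, g, f)"
    using o c Cmp_Ide[OF K'[OF o(1,3)[THEN F0]] h] by (simp add: F0 F1 composable_iff)
qed

text \<open>Composition is associative on the nose. For cells \<open>u\<close>, \<open>v\<close>,
  \<open>w\<close> of \<open>F\<close>, \<open>G\<close>, \<open>H\<close> at matching places, one
  side is \<open>H (G u)\<close> after the product of \<open>H v\<close> and \<open>w\<close>, the
  other is \<open>H\<close> applied to the product of \<open>G u\<close> and \<open>v\<close>, after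
  \<open>w\<close>. Functoriality of \<open>H\<close> and vertical associativity identify
  them.\<close>

lemma comp_bihom_assoc:
  assumes F: "homomorphism B B' F" and G: "homomorphism B' B'' G" and H: "homomorphism B'' B''' H"
  shows "comp_bihom B B''' (comp_bihom B' B''' H G) F = comp_bihom B B''' H (comp_bihom B B'' G F)"
proof (rule bihom_eqI[OF ext_bihom_comp_bihom ext_bihom_comp_bihom])
  note K' = bicategory_Hcat[OF homomorphism_cod[OF F]] and K'' = bicategory_Hcat[OF homomorphism_cod[OF G]]
    and K''' = bicategory_Hcat[OF homomorphism_cod[OF H]]
  note F0 = homomorphism_Obj[OF F] and FF = homomorphism_functor[OF F]
  note G0 = homomorphism_Obj[OF G] and GF = homomorphism_functor[OF G]
  note H0 = homomorphism_Obj[OF H] and HF = homomorphism_functor[OF H]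
  note F1 = functor_Ob[OF FF]
  { fix X assume X: "X \<in> Obj B"
    then show "h0 (comp_bihom B B''' (comp_bihom B' B''' H G) F) X
        = h0 (comp_bihom B B''' H (comp_bihom B B'' G F)) X" by (simp add: F0)
    note X' = F0[OF X] note X'' = G0[OF X'] note X''' = H0[OF X'']
    note u = homomorphism_hu[OF F X, THEN iso_hom_in_Hom[OF K'[OF X' X']]]
      and v = homomorphism_hu[OF G X', THEN iso_hom_in_Hom[OF K''[OF X'' X'']]]
      and w = homomorphism_hu[OF H X'', THEN iso_hom_in_Hom[OF K'''[OF X''' X''']]]
    note Gu = functor_Hom[OF GF[OF X' X'] u] and h = HF[OF X'' X'']
    have "hu F X \<in> Ar (Hcat B' (h0 F X) (h0 F X))" using u by (simp add: Hom_iff)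
    then show "hu (comp_bihom B B''' (comp_bihom B' B''' H G) F) X
        = hu (comp_bihom B B''' H (comp_bihom B B'' G F)) X"
      using X X' functor_Cmp[OF h v Gu] Cmp_assoc[OF K'''[OF X''' X'''] w functor_Hom[OF h v] functor_Hom[OF h Gu]]
      by simp
    fix Y assume Y: "Y \<in> Obj B"
    show "hF (comp_bihom B B''' (comp_bihom B' B''' H G) F) (X, Y)
        = hF (comp_bihom B B''' H (comp_bihom B B'' G F)) (X, Y)"
      using X Y by (simp add: F0 comp_func_assoc[OF FF])
  }
  fix X Y Z g f assume c: "(X, Y, Z, g, f) \<in> composable B"
  then have o: "X \<in> Obj B" "Y \<in> Obj B" "Z \<in> Obj B" "g \<in> Ob (Hcat B Y Z)" "f \<in> Ob (Hcat B X Y)"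
    by (simp_all add: composable_iff)
  note o' = o(1-3)[THEN F0] note o'' = o'[THEN G0] note o''' = o''[THEN H0]
  have c': "(h0 F X, h0 F Y, h0 F Z, FO (hF F (Y, Z)) g, FO (hF F (X, Y)) f) \<in> composable B'"
    using o by (simp add: composable_iff F0 F1)
  then have c'': "(h0 G (h0 F X), h0 G (h0 F Y), h0 G (h0 F Z), FO (hF G (h0 F Y, h0 F Z)) (FO (hF F (Y, Z)) g),
      FO (hF G (h0 F X, h0 F Y)) (FO (hF F (X, Y)) f)) \<in> composable B''"
    by (simp add: composable_iff G0 functor_Ob[OF GF])
  note u = homomorphism_hm[OF F c, THEN iso_hom_in_Hom[OF K'[OF o'(1,3)]]]
    and v = homomorphism_hm[OF G c', THEN iso_hom_in_Hom[OF K''[OF o''(1,3)]]]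
    and w = homomorphism_hm[OF H c'', THEN iso_hom_in_Hom[OF K'''[OF o'''(1,3)]]]
  note Gu = functor_Hom[OF GF[OF o'(1,3)] u] and h = HF[OF o''(1,3)]
  have "hm F (X, Y, Z, g, f) \<in> Ar (Hcat B' (h0 F X) (h0 F Z))" using u by (simp add: Hom_iff)
  then show "hm (comp_bihom B B''' (comp_bihom B' B''' H G) F) (X, Y, Z, g, f)
      = hm (comp_bihom B B''' H (comp_bihom B B'' G F)) (X, Y, Z, g, f)"
    using o o' c c' functor_Cmp[OF h v Gu]
      Cmp_assoc[OF K'''[OF o'''(1,3)] w functor_Hom[OF h v] functor_Hom[OF h Gu]]
    by (simp add: F1)
qed

lemma category_Bicat: "category (Bicat :: (('o, 'f, 't) bicat, _) cat)"
proof -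
  have "homomorphism B B' F \<Longrightarrow> bicategory B" "homomorphism B B' F \<Longrightarrow> bicategory B'"
    for B B' :: "('o, 'f, 't) bicat" and F
    by (simp_all add: homomorphism_dom homomorphism_cod)
  then show ?thesis
    by (intro categoryI)
      (auto simp: Bicat_def Hom_def homomorphism_id_bihom ext_bihom_id_bihom ext_bihom_comp_bihom
        comp_bihom_id_left comp_bihom_id_right comp_bihom_assoc intro: homomorphism_comp_bihom)
qed

section \<open>Functoriality of the 2-path-category\<close>

text \<open>By \<open>c1\<close> and \<open>un\<close> identity structure cells have the right
  endpoints, and \<open>c2\<close> is their naturality. Both 2-categories being strict, the
  remaining laws compare products of identities.\<close>

lemma strict_homomorphismI:
  fixes B :: "('o, 'f, 't) bicat" and B' :: "('p, 'g, 's) bicat"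
  assumes B: "strict_2category B" and B': "strict_2category B'"
    and F0: "\<And>X. X \<in> Obj B \<Longrightarrow> h0 F X \<in> Obj B'"
    and FF: "\<And>X Y. X \<in> Obj B \<Longrightarrow> Y \<in> Obj B \<Longrightarrow>
      is_functor (Hcat B X Y) (Hcat B' (h0 F X) (h0 F Y)) (hF F (X, Y))"
    and c1: "\<And>X Y Z g f. (X, Y, Z, g, f) \<in> composable B \<Longrightarrow>
      comp1 B' (h0 F X) (h0 F Y) (h0 F Z) (FO (hF F (Y, Z)) g) (FO (hF F (X, Y)) f)
      = FO (hF F (X, Z)) (comp1 B X Y Z g f)"
    and c2: "\<And>X Y Z \<tau> \<sigma>. X \<in> Obj B \<Longrightarrow> Y \<in> Obj B \<Longrightarrow> Z \<in> Obj B \<Longrightarrow>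
      \<tau> \<in> Ar (Hcat B Y Z) \<Longrightarrow> \<sigma> \<in> Ar (Hcat B X Y) \<Longrightarrow>
      comp2 B' (h0 F X) (h0 F Y) (h0 F Z) (FA (hF F (Y, Z)) \<tau>) (FA (hF F (X, Y)) \<sigma>)
      = FA (hF F (X, Z)) (comp2 B X Y Z \<tau> \<sigma>)"
    and hm: "\<And>X Y Z g f. (X, Y, Z, g, f) \<in> composable B \<Longrightarrow>
      hm F (X, Y, Z, g, f) = Ide (Hcat B' (h0 F X) (h0 F Z)) (FO (hF F (X, Z)) (comp1 B X Y Z g f))"
    and un: "\<And>X. X \<in> Obj B \<Longrightarrow> FO (hF F (X, X)) (Unit1 B X) = Unit1 B' (h0 F X)"
    and hu: "\<And>X. X \<in> Obj B \<Longrightarrow> hu F X = Ide (Hcat B' (h0 F X) (h0 F X)) (Unit1 B' (h0 F X))"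
  shows "strict_homomorphism B B' F"
proof -
  have b: "bicategory B" and b': "bicategory B'"
    using B B' by (simp_all add: strict_2category_def)
  note K = bicategory_Hcat[OF b] and K' = bicategory_Hcat[OF b']
  note I = bicategory_Unit1[OF b] and I' = bicategory_Unit1[OF b']
  note T = bicategory_HComp[OF b] and T' = bicategory_HComp[OF b']
  note T1 = bifunctor_Ob[OF T] and F1 = functor_Ob[OF FF] and Ti = bifunctor_Ide[OF T']
  have c1': "comp1 B' (h0 F X) (h0 F Y) (h0 F Z) (FO (hF F (Y, Z)) g) (FO (hF F (X, Y)) f)
      = FO (hF F (X, Z)) (comp1 B X Y Z g f)"
    if "X \<in> Obj B" "Y \<in> Obj B" "Z \<in> Obj B" "g \<in> Ob (Hcat B Y Z)" "f \<in> Ob (Hcat B X Y)" for X Y Z g f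
    using that by (simp add: c1 composable_iff)
  have assoc: "comp1 B X Y W (comp1 B Y Z W h g) f = comp1 B X Z W h (comp1 B X Y Z g f)"
    "Assoc B X Y Z W h g f = Ide (Hcat B X W) (comp1 B X Z W h (comp1 B X Y Z g f))"
    if "X \<in> Obj B" "Y \<in> Obj B" "Z \<in> Obj B" "W \<in> Obj B"
      "h \<in> Ob (Hcat B Z W)" "g \<in> Ob (Hcat B Y Z)" "f \<in> Ob (Hcat B X Y)" for X Y Z W h g f
    using B that unfolding strict_2category_def by blast+
  have assoc': "Assoc B' X Y Z W h g f = Ide (Hcat B' X W) (comp1 B' X Z W h (comp1 B' X Y Z g f))"
    if "X \<in> Obj B'" "Y \<in> Obj B'" "Z \<in> Obj B'" "W \<in> Obj B'"
      "h \<in> Ob (Hcat B' Z W)" "g \<in> Ob (Hcat B' Y Z)" "f \<in> Ob (Hcat B' X Y)" for X Y Z W h g f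
    using B' that unfolding strict_2category_def by blast
  have unit: "comp1 B X Y Y (Unit1 B Y) f = f" "LUn B X Y f = Ide (Hcat B X Y) f"
    "comp1 B X X Y f (Unit1 B X) = f" "RUn B X Y f = Ide (Hcat B X Y) f"
    if "X \<in> Obj B" "Y \<in> Obj B" "f \<in> Ob (Hcat B X Y)" for X Y f
    using B that unfolding strict_2category_def by blast+
  have unit': "comp1 B' X Y Y (Unit1 B' Y) f = f" "LUn B' X Y f = Ide (Hcat B' X Y) f"
    "comp1 B' X X Y f (Unit1 B' X) = f" "RUn B' X Y f = Ide (Hcat B' X Y) f"
    if "X \<in> Obj B'" "Y \<in> Obj B'" "f \<in> Ob (Hcat B' X Y)" for X Y f
    using B' that unfolding strict_2category_def by blast+
  have ide: "Ide (Hcat B' X Y) f \<cdot>\<^bsub>Hcat B' X Y\<^esub> Ide (Hcat B' X Y) f = Ide (Hcat B' X Y) f"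
    if "X \<in> Obj B'" "Y \<in> Obj B'" "f \<in> Ob (Hcat B' X Y)" for X Y f
    using that by (metis K' Ide_in_Hom Cmp_Ide)
  have "homomorphism B B' F"
  proof (rule homomorphismI[OF b b'], goal_cases)
    case (3 X Y Z g f)
    then show ?case by (simp add: c1 hm) (simp add: composable_iff F0 F1 T1 Ide_iso K')
  next
    case (5 X Y Z \<tau> \<sigma> g g' f f')
    note o = 5(1-3) and h = 5(4,5)
    note t = functor_Hom[OF FF[OF o(1,3)] bifunctor_Hom[OF T[OF o] h]]
    have "\<tau> \<in> Ar (Hcat B Y Z)" "\<sigma> \<in> Ar (Hcat B X Y)"
      using h by (simp_all add: Hom_iff)
    then show ?case
      using o Hom_Ob[OF K[OF o(2,3)] h(1)] Hom_Ob[OF K[OF o(1,2)] h(2)]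
        Ide_Cmp[OF K'[OF o(1,3)[THEN F0]] t] Cmp_Ide[OF K'[OF o(1,3)[THEN F0]] t]
      by (simp add: c2 hm composable_iff)
  qed (simp_all add: F0 FF F1 T1 I I' K' Ide_iso composable_iff hm hu un assoc assoc' unit unit' c1' Ti ide
      functor_Ide[OF FF])
  then show ?thesis
    by (auto simp: strict_homomorphism_def c1 hm un hu)
qed

section \<open>The strict homomorphism induced by a functor\<close>

lemma path_2cat_simps [simp]:
  "Obj (path_2cat C) = Ob C" "Hcat (path_2cat C) = path_hom C" "Unit1 (path_2cat C) X = (0, [])"
  "comp1 (path_2cat C) X Y Z t s = concat_path t s"
  "comp2 (path_2cat C) X Y Z \<tau> \<sigma> = concat_cell \<tau> \<sigma>"
  by (simp_all add: path_2cat_def)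

definition map_cell :: "('a \<Rightarrow> 'b) \<Rightarrow> 'a path_cell \<Rightarrow> 'b path_cell" where
  "map_cell f = (\<lambda>(x, u, y). (map_path f x, u, map_path f y))"

text \<open>The local functor that occurs unnamed inside \<open>path_bihom\<close>. It depends only
  on the arrow part of a functor, and is restricted so that the homomorphism is extensional.\<close>

definition path_func :: "('o, 'a) cat \<Rightarrow> ('a \<Rightarrow> 'b) \<Rightarrow> 'o \<Rightarrow> 'o
    \<Rightarrow> ('a path, 'a path_cell, 'b path, 'b path_cell) func" where
  "path_func C f X Y = \<lparr>FO = restrict (map_path f) (Ob (path_hom C X Y)),
     FA = restrict (map_cell f) (Ar (path_hom C X Y))\<rparr>"

lemma path_func_simps [simp]:
  "x \<in> Ob (path_hom C X Y) \<Longrightarrow> FO (path_func C f X Y) x = map_path f x"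
  "\<sigma> \<in> Ar (path_hom C X Y) \<Longrightarrow> FA (path_func C f X Y) \<sigma> = map_cell f \<sigma>"
  by (simp_all add: path_func_def)

lemma ext_func_path_func: "ext_func (path_hom C X Y) (path_func C f X Y)"
  by (simp add: ext_func_def path_func_def)

lemma path_bihom_simps [simp]:
  "X \<in> Ob C \<Longrightarrow> h0 (path_bihom C F D) X = FO F X"
  "X \<in> Ob C \<Longrightarrow> Y \<in> Ob C \<Longrightarrow> hF (path_bihom C F D) (X, Y) = path_func C (FA F) X Y"
  "(X, Y, Z, g, f) \<in> composable (path_2cat C) \<Longrightarrow> hm (path_bihom C F D) (X, Y, Z, g, f)
     = Ide (path_hom D (FO F X) (FO F Z)) (map_path (FA F) (concat_path g f))"
  "X \<in> Ob C \<Longrightarrow> hu (path_bihom C F D) X = Ide (path_hom D (FO F X) (FO F X)) (0, [])"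
  by (simp_all add: path_bihom_def path_func_def map_cell_def)

lemma ext_bihom_path_bihom: "ext_bihom (path_2cat C) (path_bihom C F D)"
  by (simp add: ext_bihom_def ext_func_path_func) (simp add: path_bihom_def)

lemma map_path_Nil: "map_path f (0, []) = (0, [])"
  by (simp add: map_path_def)

lemma map_path_concat: "map_path f (concat_path t s) = concat_path (map_path f t) (map_path f s)"
  by (simp add: map_path_def concat_path_def split: prod.split)

lemma map_cell_concat: "map_cell f (concat_cell \<tau> \<sigma>) = concat_cell (map_cell f \<tau>) (map_cell f \<sigma>)"
  by (cases \<tau>, cases \<sigma>) (simp add: map_cell_def concat_cell_def map_path_concat)

text \<open>Applying \<open>F\<close> leaves the map of \<open>\<Delta>\<close> unchanged. The image
  of a cell is therefore a cell exactly when \<open>F\<close> commutes with the action on chains,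
  which is \<open>chain_map_natural\<close>.\<close>

lemma is_functor_path_func:
  assumes F: "is_functor C D F"
  shows "is_functor (path_hom C X Y) (path_hom D (FO F X) (FO F Y)) (path_func C (FA F) X Y)"
proof -
  note C = functor_dom[OF F] and D = functor_cod[OF F]
  note K = category_path_hom[OF C] and L = category_path_hom[OF D]
  show ?thesis
  proof (rule is_functorI[OF K L])
    fix x assume x: "x \<in> Ob (path_hom C X Y)"
    then show "FO (path_func C (FA F) X Y) x \<in> Ob (path_hom D (FO F X) (FO F Y))"
      by (cases x) (simp, simp add: map_path_def path_hom_Ob_iff is_chain_map[OF F])
    have "Ide (path_hom C X Y) x \<in> Ar (path_hom C X Y)"
      using Ide_in_Hom[OF K x] by (simp add: Hom_iff)
    then show "FA (path_func C (FA F) X Y) (Ide (path_hom C X Y) x)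
      = Ide (path_hom D (FO F X) (FO F Y)) (FO (path_func C (FA F) X Y) x)"
      using x by (cases x) (simp add: map_cell_def map_path_def)
  next
    fix \<sigma> assume \<sigma>: "\<sigma> \<in> Ar (path_hom C X Y)"
    then have ob: "Dom (path_hom C X Y) \<sigma> \<in> Ob (path_hom C X Y)" "Cod (path_hom C X Y) \<sigma> \<in> Ob (path_hom C X Y)"
      using Hom_Ob[OF K Ar_in_Hom] by blast+
    have "map_cell (FA F) \<sigma> \<in> Hom (path_hom D (FO F X) (FO F Y))
        (map_path (FA F) (Dom (path_hom C X Y) \<sigma>)) (map_path (FA F) (Cod (path_hom C X Y) \<sigma>))"
      using \<sigma>
    proof (elim path_hom_ArE)
      fix s u m
      assume eq: "\<sigma> = ((length s, s), (length s, u, m), (m, chain_map C X (length s, u, m) s))"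
        and s: "is_chain C X s Y" and ue: "u \<in> {..<length s} \<rightarrow>\<^sub>E {..<m}"
        and u: "mono_on {..<length s} u" "\<And>i. i < length s \<Longrightarrow> u i < m"
      have "(length s, u, m) \<in> Hom Delta (length (map (FA F) s)) m"
        using ue u by (simp add: Hom_iff Delta_Ar_iff)
      from path_hom_ArI(1)[OF D is_chain_map[OF F s] this] show ?thesis
        using chain_map_natural[OF F s u] by (simp add: eq map_cell_def map_path_def)
    qed
    then show "FA (path_func C (FA F) X Y) \<sigma> \<in> Hom (path_hom D (FO F X) (FO F Y))
        (FO (path_func C (FA F) X Y) (Dom (path_hom C X Y) \<sigma>))
        (FO (path_func C (FA F) X Y) (Cod (path_hom C X Y) \<sigma>))"
      using \<sigma> ob by simp
  next
    fix \<sigma> \<tau> assume ar: "\<sigma> \<in> Ar (path_hom C X Y)" "\<tau> \<in> Ar (path_hom C X Y)"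
      and "Cod (path_hom C X Y) \<sigma> = Dom (path_hom C X Y) \<tau>"
    then have "\<tau> \<cdot>\<^bsub>path_hom C X Y\<^esub> \<sigma> \<in> Ar (path_hom C X Y)"
      using Cmp_in_Hom[OF K Ar_in_Hom[OF ar(1)], of \<tau>] Ar_in_Hom[OF ar(2)] by (simp add: Hom_iff)
    moreover have "map_cell (FA F) (\<tau> \<cdot>\<^bsub>path_hom C X Y\<^esub> \<sigma>)
        = map_cell (FA F) \<tau> \<cdot>\<^bsub>path_hom D (FO F X) (FO F Y)\<^esub> map_cell (FA F) \<sigma>"
      by (cases \<sigma>, cases \<tau>) (simp add: map_cell_def)
    ultimately show "FA (path_func C (FA F) X Y) (\<tau> \<cdot>\<^bsub>path_hom C X Y\<^esub> \<sigma>)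
      = FA (path_func C (FA F) X Y) \<tau> \<cdot>\<^bsub>path_hom D (FO F X) (FO F Y)\<^esub> FA (path_func C (FA F) X Y) \<sigma>"
      using ar by simp
  qed
qed

lemma unit_path_Ob: "X \<in> Ob C \<Longrightarrow> (0, []) \<in> Ob (path_hom C X X)"
  by (simp add: path_hom_Ob_iff)

context
  fixes C :: "('o, 'a) cat"
  assumes C: "category C"
begin

lemma concat_path_Ob:
  "g \<in> Ob (path_hom C Y Z) \<Longrightarrow> f \<in> Ob (path_hom C X Y) \<Longrightarrow> concat_path g f \<in> Ob (path_hom C X Z)"
  using bifunctor_Ob[OF is_functor_concat[OF C]] by simp

lemma concat_cell_Ar:
  "\<tau> \<in> Ar (path_hom C Y Z) \<Longrightarrow> \<sigma> \<in> Ar (path_hom C X Y) \<Longrightarrow> concat_cell \<tau> \<sigma> \<in> Ar (path_hom C X Z)"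
  using bifunctor_Hom[OF is_functor_concat[OF C] Ar_in_Hom Ar_in_Hom] by (simp add: Hom_iff)

lemma path_hom_Ar_ends:
  assumes "(x, u, y) \<in> Ar (path_hom C X Y)"
  shows "x \<in> Ob (path_hom C X Y)" "y \<in> Ob (path_hom C X Y)"
  using Hom_Ob[OF category_path_hom[OF C] Ar_in_Hom[OF assms]] by simp_all

end

text \<open>Identity and composite functors are restricted to \<open>C\<close>, so they agree with
  \<open>id\<close> and \<open>\<circ>\<close> only on arrows of \<open>C\<close>. The entries of a
  chain are such arrows.\<close>

lemma map_path_cong:
  assumes "x \<in> Ob (path_hom C X Y)" and "\<And>a. a \<in> Ar C \<Longrightarrow> f a = g a"
  shows "map_path f x = map_path g x"
proof -
  have "is_chain C A s B \<Longrightarrow> map f s = map g s" for A s B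
    by (induction s arbitrary: A) (auto simp: assms(2))
  then show ?thesis
    using assms(1) by (cases x) (auto simp: map_path_def path_hom_Ob_iff)
qed

lemma strict_homomorphism_path_bihom:
  assumes F: "is_functor C D F"
  shows "strict_homomorphism (path_2cat C) (path_2cat D) (path_bihom C F D)"
proof -
  note C = functor_dom[OF F] and D = functor_cod[OF F]
  show ?thesis
    by (rule strict_homomorphismI[OF strict_2category_path_2cat[OF C] strict_2category_path_2cat[OF D]])
      (auto simp: functor_Ob[OF F] is_functor_path_func[OF F] composable_iff concat_path_Ob[OF C]
        map_path_concat concat_cell_Ar[OF C] map_cell_concat unit_path_Ob map_path_Nil)
qed

lemma path_bihom_id_func:
  assumes C: "category C"
  shows "path_bihom C (id_func C) C = id_bihom (path_2cat C)"
proof -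
  have x: "map_path (FA (id_func C)) x = x" if "x \<in> Ob (path_hom C X Y)" for x X Y
    using map_path_cong[OF that, of "FA (id_func C)" id] by (cases x) (simp add: map_path_def)
  have \<sigma>: "map_cell (FA (id_func C)) \<sigma> = \<sigma>" if "\<sigma> \<in> Ar (path_hom C X Y)" for \<sigma> X Y
  proof -
    obtain x u y where \<sigma>: "\<sigma> = (x, u, y)" by (cases \<sigma>)
    from path_hom_Ar_ends[OF C that[unfolded this]] show ?thesis
      by (simp add: \<sigma> map_cell_def x[of _ X Y])
  qed
  from x \<sigma> have "path_func C (FA (id_func C)) X Y = id_func (path_hom C X Y)" for X Y
    by (intro func_eqI) (auto simp: path_func_def id_func_def intro!: restrict_ext)
  then show ?thesis
    by (intro bihom_eqI[OF ext_bihom_path_bihom ext_bihom_id_bihom])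
      (auto simp: composable_iff intro!: arg_cong[of _ _ "Ide _"] x concat_path_Ob[OF C])
qed

text \<open>On paths and cells this is compatibility of \<open>map\<close> with composition of
  functions. A structure cell of the right side is a product of two identities, one of them the
  image of an identity under a local functor.\<close>

lemma path_bihom_comp_func:
  assumes F: "is_functor C D F" and G: "is_functor D E G"
  shows "path_bihom C (comp_func C G F) E
    = comp_bihom (path_2cat C) (path_2cat E) (path_bihom D G E) (path_bihom C F D)"
proof -
  note C = functor_dom[OF F] and D = functor_dom[OF G] and E = functor_cod[OF G]
  note F0 = functor_Ob[OF F] and G0 = functor_Ob[OF G]
  note K = category_path_hom[OF E]
  have Fx: "map_path (FA F) x \<in> Ob (path_hom D (FO F X) (FO F Y))"
    if "x \<in> Ob (path_hom C X Y)" for x X Y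
    using functor_Ob[OF is_functor_path_func[OF F] that] that by simp
  have Gx: "map_path (FA G) x \<in> Ob (path_hom E (FO G X) (FO G Y))"
    if "x \<in> Ob (path_hom D X Y)" for x X Y
    using functor_Ob[OF is_functor_path_func[OF G] that] that by simp
  have F\<sigma>: "map_cell (FA F) \<sigma> \<in> Ar (path_hom D (FO F X) (FO F Y))"
    if "\<sigma> \<in> Ar (path_hom C X Y)" for \<sigma> X Y
    using functor_Hom[OF is_functor_path_func[OF F] Ar_in_Hom[OF that]] that by (simp add: Hom_iff)
  have x: "map_path (FA (comp_func C G F)) x = map_path (FA G) (map_path (FA F) x)"
    if "x \<in> Ob (path_hom C X Y)" for x X Y
    using map_path_cong[OF that, of "FA (comp_func C G F)" "FA G \<circ> FA F"] by (cases x) (simp add: map_path_def)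
  have \<sigma>: "map_cell (FA (comp_func C G F)) \<sigma> = map_cell (FA G) (map_cell (FA F) \<sigma>)"
    if "\<sigma> \<in> Ar (path_hom C X Y)" for \<sigma> X Y
  proof -
    obtain x u y where \<sigma>: "\<sigma> = (x, u, y)" by (cases \<sigma>)
    from path_hom_Ar_ends[OF C that[unfolded this]] show ?thesis
      by (simp add: \<sigma> map_cell_def x[of _ X Y])
  qed
  from x \<sigma> have hF: "path_func C (FA (comp_func C G F)) X Y
      = comp_func (path_hom C X Y) (path_func D (FA G) (FO F X) (FO F Y)) (path_func C (FA F) X Y)" for X Y
    by (intro func_eqI) (auto simp: path_func_def comp_func_def compose_def Fx F\<sigma> intro!: restrict_ext)
  have G_Ide: "FA (path_func D (FA G) (FO F X) (FO F Y)) (Ide (path_hom D (FO F X) (FO F Y)) x)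
      = Ide (path_hom E (FO G (FO F X)) (FO G (FO F Y))) (map_path (FA G) x)"
    if "x \<in> Ob (path_hom D (FO F X) (FO F Y))" for x X Y
    using functor_Ide[OF is_functor_path_func[OF G] that] that by simp
  have ide: "Ide (path_hom E X Y) x \<cdot>\<^bsub>path_hom E X Y\<^esub> Ide (path_hom E X Y) x = Ide (path_hom E X Y) x"
    if "x \<in> Ob (path_hom E X Y)" for x X Y
    using that by (metis K Ide_in_Hom Cmp_Ide)
  show ?thesis
  proof (rule bihom_eqI[OF ext_bihom_path_bihom ext_bihom_comp_bihom], goal_cases)
    case (3 X Y Z g f)
    then have p: "concat_path g f \<in> Ob (path_hom C X Z)"
      by (auto simp: composable_iff concat_path_Ob[OF C])
    from 3 show ?case
      by (simp add: composable_iff F0 x[OF p] Fx G_Ide[OF Fx[OF p]] ide[OF Gx[OF Fx[OF p]]]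
          map_path_concat[symmetric])
  qed (simp_all add: hF F0 G0 G_Ide ide unit_path_Ob map_path_Nil del: path_hom_simps)
qed

theorem mainTheorem1:
  fixes C :: "('o, 'a) cat"
  assumes "category C"
  shows
    \<comment> \<open>(i)\<close>
    "(strict_2category (path_2cat C) \<and>
      Obj (path_2cat C) = Ob C \<and>
      (\<forall>A\<in>Ob C. \<forall>B\<in>Ob C.
         is_functor (Hcat (path_2cat C) A B) Delta path_length \<and>
         posetal_over (Hcat (path_2cat C) A B) path_length \<and>
         (0 \<in> FO path_length ` Ob (Hcat (path_2cat C) A B) \<longleftrightarrow> A = B)) \<and>
      (\<forall>A\<in>Ob C. is_monoidal_functor (endo_mon (path_2cat C) A) Delta_mon path_length)) \<and>
     \<comment> \<open>(ii)\<close>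
     (isomorphic_cat C one_cat \<longrightarrow>
        (\<forall>A\<in>Ob C. \<exists>\<Phi>. is_monoidal_iso (endo_mon (path_2cat C) A) Delta_mon \<Phi>)) \<and>
     \<comment> \<open>(iii)\<close>
     (is_functor (Cat :: (('o, 'a) cat, _) cat) Bicat path_functor \<and>
      (\<forall>D F E. (D, F, E) \<in> Ar (Cat :: (('o, 'a) cat, _) cat) \<longrightarrow>
         strict_homomorphism (path_2cat D) (path_2cat E) (path_bihom D F E)))"
proof (intro conjI)
  show "\<forall>D F E. (D, F, E) \<in> Ar (Cat :: (('o, 'a) cat, _) cat) \<longrightarrow>
         strict_homomorphism (path_2cat D) (path_2cat E) (path_bihom D F E)"
    by (simp add: Cat_def strict_homomorphism_path_bihom)
  have "bicategory (path_2cat D)" if "category D" for D :: "('o, 'a) cat"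
    using strict_2category_path_2cat[OF that] by (simp add: strict_2category_def)
  moreover have "homomorphism (path_2cat D) (path_2cat E) (path_bihom D F E)"
    if "is_functor D E F" for D E :: "('o, 'a) cat" and F
    using strict_homomorphism_path_bihom[OF that] by (simp add: strict_homomorphism_def)
  ultimately show "is_functor (Cat :: (('o, 'a) cat, _) cat) Bicat path_functor"
    by (intro is_functorI category_Cat category_Bicat)
      (auto simp: Cat_def Bicat_def path_functor_def Hom_def ext_bihom_path_bihom path_bihom_id_func
        path_bihom_comp_func)
  show "isomorphic_cat C one_cat \<longrightarrow>
      (\<forall>A\<in>Ob C. \<exists>\<Phi>. is_monoidal_iso (endo_mon (path_2cat C) A) Delta_mon \<Phi>)"
    \<comment> \<open>The witness is the length functor.\<close>
    using is_monoidal_iso_path_length[OF assms] by blast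
qed (use strict_2category_path_2cat[OF assms] is_functor_path_length[OF assms]
    posetal_over_path_length[OF assms] zero_length_iff[OF assms]
    is_monoidal_functor_path_length[OF assms]
    in \<open>auto\<close>)

end
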